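(* Let $N\ge1$ be an integer and $\beta\in\mathbb C$ with $\beta^4=(-1)^N$. (1) For every $N\ge1$, the Drinfeld double of $H(N)$ is isomorphic to $Q(N,\beta)$ as a $\mathbb C$-algebra. (2) For even $N$ and $\beta=\pm1$, the Drinfeld double of $H(N)$ is isomorphic to $Q(N,\beta)$ as a Hopf algebra. (3) Moreover, if (in addition to $N$ even) $\beta=1$, this isomorphism is an isomorphism of quasi-triangular Hopf algebras.
   Context: $H(N)$ is the Hopf algebra over $\mathbb C$ generated by $k$ and $f_1,\dots,f_N$ with relations $\{f_i,f_j\}=0$, $\{f_i,k\}=0$, $k^2=1$ (where $\{x,y\}=xy+yx$) and $\Delta(f_i)=f_i\otimes k+1\otimes f_i$, $\Delta(k)=k\otimes k$, $\varepsilon(f_i)=0$, $\varepsilon(k)=1$, $S(f_i)=-f_ik$, $S(k)=k$. The Drinfeld double of a finite-dimensional Hopf algebra $H$ is $D(H)=H^*\otimes H$ as a vector space, with product $(\phi\otimes a)(\psi\otimes b)=\sum_{(a)}\phi\cdot\psi(S^{-1}(a''')(-)a')\otimes a''b$, where $H^*$ carries the Hopf structure of $(H^{op})^*$: $(\phi\psi)(a)=(\phi\otimes\psi)(\Delta(a))$, $\Delta(\phi)(a\otimes b)=\phi(ba)$, antipode $\phi\mapsto\phi\circ S^{-1}$; coproduct $\Delta(\phi\otimes a)=\sum(\phi'\otimes a')\otimes(\phi''\otimes a'')$; R-matrix $\sum_ib_i\otimes b_i^*$ for a basis $b_i$ of $H$ (with $H$, $H^*$ embedded in $D(H)$). $Q=Q(N,\beta)$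 is the unital associative $\mathbb C$-algebra generated by $K$, $f_i^\pm$ ($1\le i\le N$) with relations $\{f_i^\pm,K\}=0$, $\{f_i^+,f_j^-\}=\delta_{ij}e_1$, $\{f_i^\pm,f_j^\pm\}=0$, $K^4=1$, where $e_0=\frac12(1+K^2)$, $e_1=\frac12(1-K^2)$. Put $\omega_\pm=(e_0\pm ie_1)K$. Its (quasi-)Hopf structure is $\Delta(K)=K\otimes K-(1+(-1)^N)(e_1\otimes e_1)(K\otimes K)$, $\Delta(f_i^\pm)=f_i^\pm\otimes1+\omega_\pm\otimes f_i^\pm$, $\varepsilon(K)=1$, $\varepsilon(f_i^\pm)=0$, $S(K)=K^{(-1)^N}$, $S(f_k^\pm)=f_k^\pm(e_0\pm(-1)^Nie_1)K$, coassociator $\Phi=1\otimes1\otimes1+e_1\otimes e_1\otimes\{(K^N-1)e_0+(\beta^2(iK)^N-1)e_1\}$, $\boldsymbol\alpha=1$, $\boldsymbol\beta=e_0+\beta^2(iK)^Ne_1$. For even $N$ and $\beta^2=1$ one has $\Phi=1\otimes1\otimes1$ and $\boldsymbol\alpha=\boldsymbol\beta=1$, so $Q(N,\beta)$ is a Hopf algebra. The R-matrix is $R=\big(\sum_{n,m\in\{0,1\}}\beta^{nm}\rho_{n,m}\,e_n\otimes e_m\big)\prod_{k=1}^N(1\otimes1-2f_k^-\omega_-\otimes f_k^+)$, $\rho_{n,m}=\frac12\sum_{p,q=0}^1(-1)^{pq}i^{-pn+qm}K^p\otimes K^q$. *)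

theory Defs
  imports Complex_Main "HOL-Library.Poly_Mapping" "HOL-Library.Numeral_Type"
begin

section \<open>Complex vector spaces and algebras\<close>

class complex_vector = ab_group_add +
  fixes scaleC :: "complex \<Rightarrow> 'a \<Rightarrow> 'a" (infixr "*\<^sub>C" 75)
  assumes scaleC_add_right: "c *\<^sub>C (x + y) = c *\<^sub>C x + c *\<^sub>C y"
    and scaleC_add_left: "(c + d) *\<^sub>C x = c *\<^sub>C x + d *\<^sub>C x"
    and scaleC_scaleC: "c *\<^sub>C d *\<^sub>C x = (c * d) *\<^sub>C x"
    and scaleC_one: "1 *\<^sub>C x = x"

global_interpretation cvec: vector_space "scaleC :: complex \<Rightarrow> 'a \<Rightarrow> 'a::complex_vector"
  by unfold_locales (rule scaleC_add_right scaleC_add_left scaleC_scaleC scaleC_one)+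

abbreviation clinear :: "('a::complex_vector \<Rightarrow> 'b::complex_vector) \<Rightarrow> bool"
  where "clinear \<equiv> Vector_Spaces.linear scaleC scaleC"

lemma clinearI:
  assumes "\<And>x y. f (x + y) = f x + f y" "\<And>c x. f (c *\<^sub>C x) = c *\<^sub>C f x"
  shows "clinear f"
  by unfold_locales (use assms in auto)

lemma clinearD:
  assumes "clinear f"
  shows "f (x + y) = f x + f y" "f (c *\<^sub>C x) = c *\<^sub>C f x" "f 0 = 0" "f (x - y) = f x - f y"
proof -
  interpret Vector_Spaces.linear scaleC scaleC f by fact
  show "f (x + y) = f x + f y" "f (c *\<^sub>C x) = c *\<^sub>C f x" "f 0 = 0" "f (x - y) = f x - f y"
    by (rule add scale zero diff)+
qed

text \<open>
  Unital associative algebras. The class \<open>ring_1\<close> is not used because it includes \<open>0 \<noteq> 1\<close>,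
  which can fail in an algebra given by generators and relations.
\<close>

class complex_algebra_1 = complex_vector + ring + monoid_mult +
  assumes mult_scaleC_left: "(c *\<^sub>C x) * y = c *\<^sub>C (x * y)"
    and mult_scaleC_right: "x * (c *\<^sub>C y) = c *\<^sub>C (x * y)"

instantiation complex :: complex_algebra_1
begin

definition scaleC_complex :: "complex \<Rightarrow> complex \<Rightarrow> complex"
  where "scaleC_complex = (*)"

instance
  by standard (auto simp: scaleC_complex_def algebra_simps)

end

definition alg_hom :: "('a::complex_algebra_1 \<Rightarrow> 'b::complex_algebra_1) \<Rightarrow> bool"
  where "alg_hom f \<longleftrightarrow> clinear f \<and> f 1 = 1 \<and> (\<forall>x y. f (x * y) = f x * f y)"

definition alg_antihom :: "('a::complex_algebra_1 \<Rightarrow> 'b::complex_algebra_1) \<Rightarrow> bool"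
  where "alg_antihom f \<longleftrightarrow> clinear f \<and> f 1 = 1 \<and> (\<forall>x y. f (x * y) = f y * f x)"

instantiation poly_mapping :: (type, complex_vector) complex_vector
begin

lift_definition scaleC_poly_mapping :: "complex \<Rightarrow> ('a \<Rightarrow>\<^sub>0 'b) \<Rightarrow> 'a \<Rightarrow>\<^sub>0 'b"
  is "\<lambda>c f x. c *\<^sub>C f x"
  by (erule finite_subset[rotated]) (auto simp: cvec.scale_zero_right)

instance
  by (standard; transfer)
     (auto simp: fun_eq_iff scaleC_add_right scaleC_add_left scaleC_scaleC scaleC_one)

end

section \<open>Algebras presented by generators and relations\<close>

datatype 'g free_monoid = Word (letters: "'g list")

instantiation free_monoid :: (type) monoid_add
begin

definition zero_free_monoid :: "'a free_monoid"
  where "0 = Word []"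

definition plus_free_monoid :: "'a free_monoid \<Rightarrow> 'a free_monoid \<Rightarrow> 'a free_monoid"
  where "u + v = Word (letters u @ letters v)"

instance
  by standard (auto simp: zero_free_monoid_def plus_free_monoid_def)

end

text \<open>Noncommutative polynomials; the product inherited from \<open>poly_mapping\<close> is the
  convolution over concatenation of words.\<close>

type_synonym 'g free_algebra = "'g free_monoid \<Rightarrow>\<^sub>0 complex"

definition var :: "'g \<Rightarrow> 'g free_algebra"
  where "var g = Poly_Mapping.single (Word [g]) 1"

lemma scaleC_eq_single_mult:
  "c *\<^sub>C (x :: 'g free_algebra) = Poly_Mapping.single 0 c * x"
proof -
  have "c *\<^sub>C x = Poly_Mapping.map ((*) c) x"
    by (rule poly_mapping_eqI)
       (simp add: scaleC_poly_mapping.rep_eq Poly_Mapping.map.rep_eq scaleC_complex_def when_def)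
  then show ?thesis by (simp add: mult_map_scale_conv_mult)
qed

lemma single_zero_commute:
  "Poly_Mapping.single 0 c * (x :: 'g free_algebra) = x * Poly_Mapping.single 0 c"
proof (induction x rule: update_induct)
  case const
  then show ?case by simp
next
  case (update f a b)
  have "Poly_Mapping.update a b f = f + Poly_Mapping.single a b"
    using update by (intro poly_mapping_eqI)
      (auto simp: lookup_update lookup_add lookup_single in_keys_iff when_def)
  then show ?case
    using update by (simp add: distrib_left distrib_right mult_single mult.commute)
qed

inductive_set two_sided_ideal :: "'a::ring_1 set \<Rightarrow> 'a set" for R
  where
    zero: "0 \<in> two_sided_ideal R"
  | base: "r \<in> R \<Longrightarrow> r \<in> two_sided_ideal R"
  | add: "x \<in> two_sided_ideal R \<Longrightarrow> y \<in> two_sided_ideal R \<Longrightarrow> x + y \<in> two_sided_ideal R"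
  | mult_left: "x \<in> two_sided_ideal R \<Longrightarrow> a * x \<in> two_sided_ideal R"
  | mult_right: "x \<in> two_sided_ideal R \<Longrightarrow> x * a \<in> two_sided_ideal R"

lemma two_sided_ideal_uminus: "x \<in> two_sided_ideal R \<Longrightarrow> - x \<in> two_sided_ideal R"
  using two_sided_ideal.mult_left[of x R "-1"] by simp

lemma two_sided_ideal_diff:
  "x \<in> two_sided_ideal R \<Longrightarrow> y \<in> two_sided_ideal R \<Longrightarrow> x - y \<in> two_sided_ideal R"
  using two_sided_ideal.add[OF _ two_sided_ideal_uminus, of x R y] by simp

text \<open>A type of generators carries a set of relators, i.e. of noncommutative polynomials that
  are to vanish.\<close>

class presentation =
  fixes relators :: "'a free_algebra set"

quotient_type (overloaded) 'g presented_algebra = "'g::presentation free_algebra" /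
  "\<lambda>x y. x - y \<in> two_sided_ideal (relators :: 'g free_algebra set)"
proof (rule equivpI)
  let ?I = "two_sided_ideal (relators :: 'g free_algebra set)"
  show "reflp (\<lambda>x y. x - y \<in> ?I)"
    by (rule reflpI) (simp add: two_sided_ideal.zero)
  show "symp (\<lambda>x y. x - y \<in> ?I)"
    using two_sided_ideal_uminus by (intro sympI) fastforce
  show "transp (\<lambda>x y. x - y \<in> ?I)"
  proof (rule transpI)
    fix x y z assume "x - y \<in> ?I" "y - z \<in> ?I"
    from two_sided_ideal.add[OF this] show "x - z \<in> ?I" by simp
  qed
qed

instantiation presented_algebra :: (presentation) complex_algebra_1
begin

lift_definition zero_presented_algebra :: "'a presented_algebra" is 0 .

lift_definition one_presented_algebra :: "'a presented_algebra" is 1 .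

lift_definition plus_presented_algebra ::
  "'a presented_algebra \<Rightarrow> 'a presented_algebra \<Rightarrow> 'a presented_algebra" is "(+)"
  by (metis add_diff_add two_sided_ideal.add)

lift_definition uminus_presented_algebra ::
  "'a presented_algebra \<Rightarrow> 'a presented_algebra" is uminus
  by (metis minus_diff_eq minus_diff_minus two_sided_ideal_uminus)

lift_definition minus_presented_algebra ::
  "'a presented_algebra \<Rightarrow> 'a presented_algebra \<Rightarrow> 'a presented_algebra" is "(-)"
proof -
  fix w x y z :: "'a free_algebra"
  assume "w - x \<in> two_sided_ideal relators" "y - z \<in> two_sided_ideal relators"
  from two_sided_ideal_diff[OF this] show "w - y - (x - z) \<in> two_sided_ideal relators"
    by (simp add: algebra_simps)
qed

lift_definition times_presented_algebra ::
  "'a presented_algebra \<Rightarrow> 'a presented_algebra \<Rightarrow> 'a presented_algebra" is "(*)"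
proof -
  fix w x y z :: "'a free_algebra"
  assume "w - x \<in> two_sided_ideal relators" "y - z \<in> two_sided_ideal relators"
  then have "(w - x) * y + x * (y - z) \<in> two_sided_ideal relators"
    by (intro two_sided_ideal.add two_sided_ideal.mult_left two_sided_ideal.mult_right)
  then show "w * y - x * z \<in> two_sided_ideal relators"
    by (simp add: algebra_simps)
qed

lift_definition scaleC_presented_algebra ::
  "complex \<Rightarrow> 'a presented_algebra \<Rightarrow> 'a presented_algebra" is scaleC
  by (metis cvec.scale_right_diff_distrib scaleC_eq_single_mult two_sided_ideal.mult_left)

instance
proof
  fix c d :: complex and x y z :: "'a presented_algebra"
  have eqI: "p - q \<in> two_sided_ideal relators" if "p = q" for p q :: "'a free_algebra"
    using that by (simp add: two_sided_ideal.zero)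
  show "x + y + z = x + (y + z)" by transfer (rule eqI, simp add: algebra_simps)
  show "x + y = y + x" by transfer (rule eqI, simp add: algebra_simps)
  show "0 + x = x" by transfer (rule eqI, simp)
  show "- x + x = 0" by transfer (rule eqI, simp)
  show "x - y = x + - y" by transfer (rule eqI, simp)
  show "c *\<^sub>C (x + y) = c *\<^sub>C x + c *\<^sub>C y" by transfer (rule eqI, rule scaleC_add_right)
  show "(c + d) *\<^sub>C x = c *\<^sub>C x + d *\<^sub>C x" by transfer (rule eqI, rule scaleC_add_left)
  show "c *\<^sub>C d *\<^sub>C x = (c * d) *\<^sub>C x" by transfer (rule eqI, rule scaleC_scaleC)
  show "1 *\<^sub>C x = x" by transfer (rule eqI, rule scaleC_one)
  show "x * y * z = x * (y * z)" by transfer (rule eqI, rule mult.assoc)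
  show "(x + y) * z = x * z + y * z" by transfer (rule eqI, rule distrib_right)
  show "x * (y + z) = x * y + x * z" by transfer (rule eqI, rule distrib_left)
  show "1 * x = x" by transfer (rule eqI, simp)
  show "x * 1 = x" by transfer (rule eqI, simp)
  show "(c *\<^sub>C x) * y = c *\<^sub>C (x * y)"
    by transfer (rule eqI, simp only: scaleC_eq_single_mult mult.assoc)
  show "x * (c *\<^sub>C y) = c *\<^sub>C (x * y)"
    by transfer (rule eqI, metis scaleC_eq_single_mult mult.assoc single_zero_commute)
qed

end

lift_definition gen :: "'g::presentation \<Rightarrow> 'g presented_algebra" is var .

text \<open>
  The next two are meaningful when \<open>v\<close> kills the relators (with products reversed in the second
  case); the extension then exists and, the generators generating, is unique.
\<close>

definition hom_extension :: "('g::presentation \<Rightarrow> 'b::complex_algebra_1) \<Rightarrow> 'g presented_algebra \<Rightarrow> 'b"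
  where "hom_extension v = (THE f. alg_hom f \<and> (\<forall>g. f (gen g) = v g))"

definition antihom_extension :: "('g::presentation \<Rightarrow> 'b::complex_algebra_1) \<Rightarrow> 'g presented_algebra \<Rightarrow> 'b"
  where "antihom_extension v = (THE f. alg_antihom f \<and> (\<forall>g. f (gen g) = v g))"

section \<open>Tensor products\<close>

inductive_set bilinear_relations :: "('a::complex_vector \<times> 'b::complex_vector \<Rightarrow>\<^sub>0 complex) set"
  where
    add_left: "Poly_Mapping.single (a + a', b) 1 - (Poly_Mapping.single (a, b) 1 +
      Poly_Mapping.single (a', b) 1) \<in> bilinear_relations"
  | add_right: "Poly_Mapping.single (a, b + b') 1 - (Poly_Mapping.single (a, b) 1 +
      Poly_Mapping.single (a, b') 1) \<in> bilinear_relations"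
  | scale_left: "Poly_Mapping.single (c *\<^sub>C a, b) 1 - c *\<^sub>C Poly_Mapping.single (a, b) 1
      \<in> bilinear_relations"
  | scale_right: "Poly_Mapping.single (a, c *\<^sub>C b) 1 - c *\<^sub>C Poly_Mapping.single (a, b) 1
      \<in> bilinear_relations"

quotient_type (overloaded) ('a, 'b) tensor =
  "'a::complex_vector \<times> 'b::complex_vector \<Rightarrow>\<^sub>0 complex" /
  "\<lambda>s t. s - t \<in> cvec.span (bilinear_relations :: ('a \<times> 'b \<Rightarrow>\<^sub>0 complex) set)"
proof (rule equivpI)
  let ?I = "cvec.span (bilinear_relations :: ('a \<times> 'b \<Rightarrow>\<^sub>0 complex) set)"
  show "reflp (\<lambda>x y. x - y \<in> ?I)"
    by (rule reflpI) (simp add: cvec.span_zero)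
  show "symp (\<lambda>x y. x - y \<in> ?I)"
    using cvec.span_neg by (intro sympI) fastforce
  show "transp (\<lambda>x y. x - y \<in> ?I)"
  proof (rule transpI)
    fix x y z assume "x - y \<in> ?I" "y - z \<in> ?I"
    from cvec.span_add[OF this] show "x - z \<in> ?I" by simp
  qed
qed

instantiation tensor :: (complex_vector, complex_vector) complex_vector
begin

lift_definition zero_tensor :: "('a, 'b) tensor" is 0 .

lift_definition plus_tensor :: "('a, 'b) tensor \<Rightarrow> ('a, 'b) tensor \<Rightarrow> ('a, 'b) tensor" is "(+)"
  by (metis add_diff_add cvec.span_add)

lift_definition uminus_tensor :: "('a, 'b) tensor \<Rightarrow> ('a, 'b) tensor" is uminus
  by (metis minus_diff_eq minus_diff_minus cvec.span_neg)

lift_definition minus_tensor :: "('a, 'b) tensor \<Rightarrow> ('a, 'b) tensor \<Rightarrow> ('a, 'b) tensor" is "(-)"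
proof -
  fix w x y z :: "'a \<times> 'b \<Rightarrow>\<^sub>0 complex"
  assume "w - x \<in> cvec.span bilinear_relations" "y - z \<in> cvec.span bilinear_relations"
  from cvec.span_diff[OF this] show "w - y - (x - z) \<in> cvec.span bilinear_relations"
    by (simp add: algebra_simps)
qed

lift_definition scaleC_tensor :: "complex \<Rightarrow> ('a, 'b) tensor \<Rightarrow> ('a, 'b) tensor" is scaleC
  by (metis cvec.scale_right_diff_distrib cvec.span_scale)

instance
proof
  fix c d :: complex and x y z :: "('a, 'b) tensor"
  have eqI: "p - q \<in> cvec.span bilinear_relations" if "p = q" for p q :: "'a \<times> 'b \<Rightarrow>\<^sub>0 complex"
    using that by (simp add: cvec.span_zero)
  show "x + y + z = x + (y + z)" by transfer (rule eqI, simp add: algebra_simps)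
  show "x + y = y + x" by transfer (rule eqI, simp add: algebra_simps)
  show "0 + x = x" by transfer (rule eqI, simp)
  show "- x + x = 0" by transfer (rule eqI, simp)
  show "x - y = x + - y" by transfer (rule eqI, simp)
  show "c *\<^sub>C (x + y) = c *\<^sub>C x + c *\<^sub>C y" by transfer (rule eqI, rule scaleC_add_right)
  show "(c + d) *\<^sub>C x = c *\<^sub>C x + d *\<^sub>C x" by transfer (rule eqI, rule scaleC_add_left)
  show "c *\<^sub>C d *\<^sub>C x = (c * d) *\<^sub>C x" by transfer (rule eqI, rule scaleC_scaleC)
  show "1 *\<^sub>C x = x" by transfer (rule eqI, rule scaleC_one)
qed

end

lift_definition pure_tensor :: "'a::complex_vector \<Rightarrow> 'b::complex_vector \<Rightarrow> ('a, 'b) tensor"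
  (infixr "\<otimes>\<^sub>C" 73) is "\<lambda>a b. Poly_Mapping.single (a, b) 1" .

text \<open>Meaningful for bilinear \<open>F\<close> only; see lemma \<open>tensor_lift\<close> below.\<close>

definition tensor_lift ::
  "('a::complex_vector \<Rightarrow> 'b::complex_vector \<Rightarrow> 'c::complex_vector) \<Rightarrow> ('a, 'b) tensor \<Rightarrow> 'c"
  where "tensor_lift F = (THE L. clinear L \<and> (\<forall>a b. L (a \<otimes>\<^sub>C b) = F a b))"

definition tensor_map ::
  "('a::complex_vector \<Rightarrow> 'c::complex_vector) \<Rightarrow> ('b::complex_vector \<Rightarrow> 'd::complex_vector) \<Rightarrow>
    ('a, 'b) tensor \<Rightarrow> ('c, 'd) tensor"
  where "tensor_map f g = tensor_lift (\<lambda>a b. f a \<otimes>\<^sub>C g b)"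

lemma pure_tensor_add_left: "(a + a') \<otimes>\<^sub>C b = a \<otimes>\<^sub>C b + a' \<otimes>\<^sub>C b"
  by transfer (rule cvec.span_base, rule bilinear_relations.add_left)

lemma pure_tensor_add_right: "a \<otimes>\<^sub>C (b + b') = a \<otimes>\<^sub>C b + a \<otimes>\<^sub>C b'"
  by transfer (rule cvec.span_base, rule bilinear_relations.add_right)

lemma pure_tensor_scale_left: "(c *\<^sub>C a) \<otimes>\<^sub>C b = c *\<^sub>C (a \<otimes>\<^sub>C b)"
  by transfer (rule cvec.span_base, rule bilinear_relations.scale_left)

lemma pure_tensor_scale_right: "a \<otimes>\<^sub>C (c *\<^sub>C b) = c *\<^sub>C (a \<otimes>\<^sub>C b)"
  by transfer (rule cvec.span_base, rule bilinear_relations.scale_right)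

lemma tensor_induct [case_names zero add]:
  assumes "P 0" "\<And>t a b. P t \<Longrightarrow> P (t + a \<otimes>\<^sub>C b)"
  shows "P t"
proof -
  have "P (abs_tensor p)" for p
  proof (induction p rule: update_induct)
    case const
    show ?case using assms(1) unfolding zero_tensor_def .
  next
    case (update p q c)
    have "Poly_Mapping.update q c p = p + c *\<^sub>C Poly_Mapping.single q 1"
      using update by (intro poly_mapping_eqI)
        (auto simp: lookup_update lookup_add lookup_single in_keys_iff when_def
          scaleC_poly_mapping.rep_eq scaleC_complex_def)
    moreover have "abs_tensor (Poly_Mapping.single q 1) = fst q \<otimes>\<^sub>C snd q"
      by (simp add: pure_tensor.abs_eq)
    ultimately have "abs_tensor (Poly_Mapping.update q c p) =
        abs_tensor p + (c *\<^sub>C fst q) \<otimes>\<^sub>C snd q"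
      by (simp only: plus_tensor.abs_eq[symmetric] scaleC_tensor.abs_eq[symmetric]
          pure_tensor_scale_left)
    then show ?case using assms(2)[OF update(3)] by (simp only:)
  qed
  then show ?thesis by (rule tensor.abs_induct)
qed

lemma clinear_tensor_eqI:
  assumes "clinear f" "clinear g" "\<And>a b. f (a \<otimes>\<^sub>C b) = g (a \<otimes>\<^sub>C b)"
  shows "f t = g t"
  by (induction t rule: tensor_induct) (simp_all add: assms clinearD)

definition cbilinear ::
  "('a::complex_vector \<Rightarrow> 'b::complex_vector \<Rightarrow> 'c::complex_vector) \<Rightarrow> bool"
  where "cbilinear F \<longleftrightarrow> (\<forall>a. clinear (F a)) \<and> (\<forall>b. clinear (\<lambda>a. F a b))"

lemma cbilinearI:
  assumes "\<And>a a' b. F (a + a') b = F a b + F a' b" "\<And>c a b. F (c *\<^sub>C a) b = c *\<^sub>C F a b"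
    "\<And>a b b'. F a (b + b') = F a b + F a b'" "\<And>c a b. F a (c *\<^sub>C b) = c *\<^sub>C F a b"
  shows "cbilinear F"
  unfolding cbilinear_def by (intro conjI allI clinearI assms)

lemma cbilinearD:
  assumes "cbilinear F"
  shows "F (a + a') b = F a b + F a' b" "F (c *\<^sub>C a) b = c *\<^sub>C F a b"
    "F a (b + b') = F a b + F a b'" "F a (c *\<^sub>C b) = c *\<^sub>C F a b"
  using assms unfolding cbilinear_def by (metis clinearD(1), metis clinearD(2),
    metis clinearD(1), metis clinearD(2))

lemma tensor_lift_exists:
  fixes F :: "'a::complex_vector \<Rightarrow> 'b::complex_vector \<Rightarrow> 'c::complex_vector"
  assumes F: "cbilinear F"
  shows "\<exists>L. clinear L \<and> (\<forall>a b. L (a \<otimes>\<^sub>C b) = F a b)"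
proof -
  define E where "E p = (\<Sum>q\<in>Poly_Mapping.keys p. Poly_Mapping.lookup p q *\<^sub>C F (fst q) (snd q))"
    for p :: "'a \<times> 'b \<Rightarrow>\<^sub>0 complex"
  have E_super: "E p = (\<Sum>q\<in>S. Poly_Mapping.lookup p q *\<^sub>C F (fst q) (snd q))"
    if "finite S" "Poly_Mapping.keys p \<subseteq> S" for p S
    unfolding E_def using that by (intro sum.mono_neutral_left) (auto simp: in_keys_iff)
  have E: "clinear E"
  proof (rule clinearI)
    fix p q :: "'a \<times> 'b \<Rightarrow>\<^sub>0 complex"
    let ?S = "Poly_Mapping.keys p \<union> Poly_Mapping.keys q"
    have "E (p + q) = (\<Sum>x\<in>?S. Poly_Mapping.lookup (p + q) x *\<^sub>C F (fst x) (snd x))"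
      by (rule E_super) (use keys_add[of p q] in auto)
    also have "\<dots> = (\<Sum>x\<in>?S. Poly_Mapping.lookup p x *\<^sub>C F (fst x) (snd x)) +
        (\<Sum>x\<in>?S. Poly_Mapping.lookup q x *\<^sub>C F (fst x) (snd x))"
      by (simp add: lookup_add scaleC_add_left sum.distrib)
    also have "\<dots> = E p + E q"
      by (subst (1 2) E_super[of ?S]) auto
    finally show "E (p + q) = E p + E q" .
  next
    fix c and p :: "'a \<times> 'b \<Rightarrow>\<^sub>0 complex"
    have "E (c *\<^sub>C p) = (\<Sum>x\<in>Poly_Mapping.keys p. Poly_Mapping.lookup (c *\<^sub>C p) x *\<^sub>C F (fst x) (snd x))"
      by (rule E_super)
        (auto simp: in_keys_iff scaleC_poly_mapping.rep_eq scaleC_complex_def)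
    then show "E (c *\<^sub>C p) = c *\<^sub>C E p"
      by (simp add: E_def scaleC_poly_mapping.rep_eq scaleC_complex_def scaleC_scaleC
          cvec.scale_sum_right)
  qed
  have E_single: "E (Poly_Mapping.single (a, b) 1) = F a b" for a b
    by (simp add: E_def scaleC_one)
  have E_rel: "E p = 0" if "p \<in> bilinear_relations" for p
    using that by cases (simp_all add: clinearD[OF E] E_single cbilinearD[OF F])
  have E_null: "E p = 0" if "p \<in> cvec.span bilinear_relations" for p
    using that by (induction rule: cvec.span_induct_alt) (simp_all add: clinearD[OF E] E_rel)
  define L where "L t = E (rep_tensor t)" for t
  have L_abs: "L (abs_tensor p) = E p" for p
  proof -
    have "rep_tensor (abs_tensor p) - p \<in> cvec.span bilinear_relations"
      using Quotient3_rep_abs[OF Quotient3_tensor, of p] by (simp add: cvec.span_zero)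
    from E_null[OF this] show ?thesis by (simp add: L_def clinearD[OF E])
  qed
  have surj: "\<exists>p. t = abs_tensor p" for t :: "('a, 'b) tensor"
    by (rule tensor.abs_induct) (rule exI, rule refl)
  have "clinear L"
  proof (rule clinearI)
    fix s t :: "('a, 'b) tensor"
    obtain p q where "s = abs_tensor p" "t = abs_tensor q" using surj by blast
    then show "L (s + t) = L s + L t"
      by (simp add: plus_tensor.abs_eq L_abs clinearD[OF E])
  next
    fix c and s :: "('a, 'b) tensor"
    obtain p where "s = abs_tensor p" using surj by blast
    then show "L (c *\<^sub>C s) = c *\<^sub>C L s"
      by (simp add: scaleC_tensor.abs_eq L_abs clinearD[OF E])
  qed
  moreover have "L (a \<otimes>\<^sub>C b) = F a b" for a b
    by (simp add: pure_tensor.abs_eq L_abs E_single)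
  ultimately show ?thesis by blast
qed

lemma tensor_lift:
  assumes "cbilinear F"
  shows "clinear (tensor_lift F)" "tensor_lift F (a \<otimes>\<^sub>C b) = F a b"
proof -
  have "\<exists>!L. clinear L \<and> (\<forall>a b. L (a \<otimes>\<^sub>C b) = F a b)"
  proof (rule ex_ex1I)
    fix L L' assume "clinear L \<and> (\<forall>a b. L (a \<otimes>\<^sub>C b) = F a b)"
      "clinear L' \<and> (\<forall>a b. L' (a \<otimes>\<^sub>C b) = F a b)"
    then have "clinear L" "clinear L'" "L (a \<otimes>\<^sub>C b) = L' (a \<otimes>\<^sub>C b)" for a b
      by simp_all
    then have "L t = L' t" for t
      by (rule clinear_tensor_eqI)
    then show "L = L'" by (rule ext)
  qed (rule tensor_lift_exists[OF assms])
  from theI'[OF this]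
  show "clinear (tensor_lift F)" "tensor_lift F (a \<otimes>\<^sub>C b) = F a b"
    by (simp_all add: tensor_lift_def)
qed

instantiation tensor :: (complex_algebra_1, complex_algebra_1) complex_algebra_1
begin

definition one_tensor :: "('a, 'b) tensor"
  where "1 = 1 \<otimes>\<^sub>C 1"

definition times_tensor :: "('a, 'b) tensor \<Rightarrow> ('a, 'b) tensor \<Rightarrow> ('a, 'b) tensor"
  where "s * t = tensor_lift (\<lambda>a b. tensor_lift (\<lambda>c d. (a * c) \<otimes>\<^sub>C (b * d)) t) s"

instance
proof -
  let ?m = "\<lambda>a b c d. (a * c) \<otimes>\<^sub>C (b * d) :: ('a, 'b) tensor"
  have m: "cbilinear (?m a b)" for a b
    by (rule cbilinearI) (simp_all add: distrib_left mult_scaleC_right pure_tensor_add_left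
        pure_tensor_add_right pure_tensor_scale_left pure_tensor_scale_right)
  define T where "T a b = tensor_lift (?m a b)" for a b
  have T_pure: "T a b (c \<otimes>\<^sub>C d) = ?m a b c d" for a b c d
    by (simp add: T_def tensor_lift(2)[OF m])
  have lin: "T a b (s + t) = T a b s + T a b t" "T a b (c *\<^sub>C t) = c *\<^sub>C T a b t"
    "T a b 0 = 0" for a b c s t
    using clinearD[OF tensor_lift(1)[OF m]] by (simp_all add: T_def)
  have times_T: "s * t = tensor_lift (\<lambda>a b. T a b t) s" for s t :: "('a, 'b) tensor"
    by (simp add: times_tensor_def T_def)
  have inner: "cbilinear (\<lambda>a b. T a b t)" for t
  proof (rule cbilinearI)
    show "T (a + a') b t = T a b t + T a' b t" for a a' b
      by (induction t rule: tensor_induct)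
        (simp_all add: lin T_pure distrib_right pure_tensor_add_left)
    show "T a (b + b') t = T a b t + T a b' t" for a b b'
      by (induction t rule: tensor_induct)
        (simp_all add: lin T_pure distrib_right pure_tensor_add_right)
    show "T (c *\<^sub>C a) b t = c *\<^sub>C T a b t" for c a b
      by (induction t rule: tensor_induct)
        (simp_all add: lin T_pure mult_scaleC_left scaleC_add_right pure_tensor_scale_left)
    show "T a (c *\<^sub>C b) t = c *\<^sub>C T a b t" for c a b
      by (induction t rule: tensor_induct)
        (simp_all add: lin T_pure mult_scaleC_left scaleC_add_right pure_tensor_scale_right)
  qed
  note outer = clinearD[OF tensor_lift(1)[OF inner]]
  have pure: "(a \<otimes>\<^sub>C b) * (c \<otimes>\<^sub>C d) = ?m a b c d" for a b c d
    unfolding times_T tensor_lift(2)[OF inner] by (rule T_pure)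
  have l: "(s + t) * u = s * u + t * u" "(c *\<^sub>C s) * u = c *\<^sub>C (s * u)" "0 * u = 0"
    for s t u :: "('a, 'b) tensor" and c
    by (simp_all add: times_T outer)
  have r: "u * (s + t) = u * s + u * t \<and> u * (c *\<^sub>C s) = c *\<^sub>C (u * s) \<and> u * 0 = 0"
    for s t u :: "('a, 'b) tensor" and c
  proof (induction u rule: tensor_induct)
    case zero
    then show ?case by (simp add: l)
  next
    case (add u a b)
    have "(a \<otimes>\<^sub>C b) * t = T a b t" for t
      by (simp add: times_T tensor_lift(2)[OF inner])
    then show ?case using add by (simp add: l lin scaleC_add_right)
  qed
  have assoc_pure: "(a \<otimes>\<^sub>C b) * (c \<otimes>\<^sub>C d) * t = (a \<otimes>\<^sub>C b) * ((c \<otimes>\<^sub>C d) * t)"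
    for a b c d and t :: "('a, 'b) tensor"
    by (induction t rule: tensor_induct) (simp_all add: r pure mult.assoc)
  have assoc_pure': "(a \<otimes>\<^sub>C b) * s * t = (a \<otimes>\<^sub>C b) * (s * t)"
    for a b and s t :: "('a, 'b) tensor"
    by (induction s rule: tensor_induct) (simp_all add: r l assoc_pure)
  show "OFCLASS(('a, 'b) tensor, complex_algebra_1_class)"
  proof
    fix s t u :: "('a, 'b) tensor" and c
    show "s * t * u = s * (t * u)"
      by (induction s rule: tensor_induct) (simp_all add: l assoc_pure')
    show "(s + t) * u = s * u + t * u" "(c *\<^sub>C s) * u = c *\<^sub>C (s * u)"
      by (rule l)+
    show "u * (s + t) = u * s + u * t" "u * (c *\<^sub>C s) = c *\<^sub>C (u * s)"
      using r by blast+
    show "1 * s = s" "s * 1 = s"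
      by (induction s rule: tensor_induct) (simp_all add: one_tensor_def l r pure)
  qed
qed

end

section \<open>Dual spaces\<close>

typedef (overloaded) 'a dual = "{f :: 'a::complex_vector \<Rightarrow> complex. clinear f}"
  morphisms dual_apply functional
  by (rule exI[of _ "\<lambda>_. 0"]) (simp add: clinearI)

setup_lifting type_definition_dual

instantiation dual :: (complex_vector) complex_vector
begin

lift_definition zero_dual :: "'a dual" is "\<lambda>_. 0"
  by (rule clinearI) simp_all

lift_definition plus_dual :: "'a dual \<Rightarrow> 'a dual \<Rightarrow> 'a dual" is "\<lambda>f g x. f x + g x"
  by (rule clinearI) (simp_all add: clinearD scaleC_add_right)

lift_definition uminus_dual :: "'a dual \<Rightarrow> 'a dual" is "\<lambda>f x. - f x"
  by (rule clinearI) (simp_all add: clinearD)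

lift_definition minus_dual :: "'a dual \<Rightarrow> 'a dual \<Rightarrow> 'a dual" is "\<lambda>f g x. f x - g x"
  by (rule clinearI) (simp_all add: clinearD cvec.scale_right_diff_distrib)

lift_definition scaleC_dual :: "complex \<Rightarrow> 'a dual \<Rightarrow> 'a dual" is "\<lambda>c f x. c *\<^sub>C f x"
  by (rule clinearI) (simp_all add: clinearD scaleC_add_right scaleC_scaleC mult.commute)

instance
  by (standard; transfer)
     (simp_all add: fun_eq_iff scaleC_add_right scaleC_add_left scaleC_scaleC scaleC_one)

end

section \<open>Quasi-Hopf structures\<close>

text \<open>
  These records hold the data only, as in \<open>HOL-Algebra\<close>: the axioms do not enter into what
  it means for a map to be an isomorphism. The triple tensor power is nested to the
  right: \<open>x \<otimes>\<^sub>C y \<otimes>\<^sub>C z\<close> is \<open>x \<otimes>\<^sub>C (y \<otimes>\<^sub>C z)\<close>.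
\<close>

record 'a algebra_structure =
  amult :: "'a \<Rightarrow> 'a \<Rightarrow> 'a"
  aunit :: 'a

record (overloaded) ('a::complex_vector) hopf_structure = "'a algebra_structure" +
  comult :: "'a \<Rightarrow> ('a, 'a) tensor"
  counit :: "'a \<Rightarrow> complex"
  antipode :: "'a \<Rightarrow> 'a"

record (overloaded) ('a::complex_vector) quasi_hopf_structure = "'a hopf_structure" +
  coassociator :: "('a, ('a, 'a) tensor) tensor"
  alpha_elem :: 'a
  beta_elem :: 'a

record (overloaded) ('a::complex_vector) qt_quasi_hopf_structure = "'a quasi_hopf_structure" +
  rmatrix :: "('a, 'a) tensor"

text \<open>\<open>\<Sum> F a' a''\<close> and \<open>\<Sum> F a' a'' a'''\<close> in Sweedler notation, the latter for
  \<open>(\<Delta> \<otimes> id) (\<Delta> a)\<close>.\<close>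

definition sweedler2 ::
  "('a::complex_vector, 'm) hopf_structure_scheme \<Rightarrow> ('a \<Rightarrow> 'a \<Rightarrow> 'b::complex_vector) \<Rightarrow> 'a \<Rightarrow> 'b"
  where "sweedler2 H F a = tensor_lift F (comult H a)"

definition sweedler3 ::
  "('a::complex_vector, 'm) hopf_structure_scheme \<Rightarrow>
    ('a \<Rightarrow> 'a \<Rightarrow> 'a \<Rightarrow> 'b::complex_vector) \<Rightarrow> 'a \<Rightarrow> 'b"
  where "sweedler3 H F a =
    sweedler2 H (\<lambda>x a3. sweedler2 H (\<lambda>a1 a2. F a1 a2 a3) x) a"

text \<open>A quasi-Hopf algebra is a Hopf algebra (with the same \<open>\<Delta>\<close>, \<open>\<epsilon>\<close>, \<open>S\<close>) when its
  coassociator and its elements \<open>\<alpha>\<close>, \<open>\<beta>\<close> are trivial.\<close>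

definition trivially_coassociated ::
  "('a::complex_vector, 'm) quasi_hopf_structure_scheme \<Rightarrow> bool"
  where "trivially_coassociated H \<longleftrightarrow>
    coassociator H = aunit H \<otimes>\<^sub>C aunit H \<otimes>\<^sub>C aunit H \<and>
    alpha_elem H = aunit H \<and> beta_elem H = aunit H"

definition algebra_iso ::
  "('a::complex_vector, 'm) algebra_structure_scheme \<Rightarrow>
    ('b::complex_vector, 'n) algebra_structure_scheme \<Rightarrow> ('a \<Rightarrow> 'b) \<Rightarrow> bool"
  where "algebra_iso A B h \<longleftrightarrow>
    clinear h \<and> bij h \<and> h (aunit A) = aunit B \<and>
    (\<forall>x y. h (amult A x y) = amult B (h x) (h y))"

definition hopf_iso ::
  "('a::complex_vector, 'm) quasi_hopf_structure_scheme \<Rightarrow>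
    ('b::complex_vector, 'n) quasi_hopf_structure_scheme \<Rightarrow> ('a \<Rightarrow> 'b) \<Rightarrow> bool"
  where "hopf_iso A B h \<longleftrightarrow>
    trivially_coassociated A \<and> trivially_coassociated B \<and> algebra_iso A B h \<and>
    (\<forall>x. comult B (h x) = tensor_map h h (comult A x)) \<and>
    (\<forall>x. counit B (h x) = counit A x) \<and>
    (\<forall>x. antipode B (h x) = h (antipode A x))"

definition quasitriangular_hopf_iso ::
  "('a::complex_vector, 'm) qt_quasi_hopf_structure_scheme \<Rightarrow>
    ('b::complex_vector, 'n) qt_quasi_hopf_structure_scheme \<Rightarrow> ('a \<Rightarrow> 'b) \<Rightarrow> bool"
  where "quasitriangular_hopf_iso A B h \<longleftrightarrow>
    hopf_iso A B h \<and> rmatrix B = tensor_map h h (rmatrix A)"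

section \<open>The Drinfeld double\<close>

text \<open>The dual of \<open>H\<close> with the Hopf structure of \<open>(H\<^sup>o\<^sup>p)\<^sup>*\<close>.\<close>

definition dual_mult ::
  "('a::complex_vector, 'm) hopf_structure_scheme \<Rightarrow> 'a dual \<Rightarrow> 'a dual \<Rightarrow> 'a dual"
  where "dual_mult H \<phi> \<psi> =
    functional (sweedler2 H (\<lambda>x y. dual_apply \<phi> x * dual_apply \<psi> y))"

definition dual_unit :: "('a::complex_vector, 'm) hopf_structure_scheme \<Rightarrow> 'a dual"
  where "dual_unit H = functional (counit H)"

text \<open>Determined by \<open>\<Delta>(\<phi>)(a \<otimes> b) = \<phi>(b a)\<close>; existence needs \<open>H\<close> to be finite-dimensional.\<close>

definition dual_comult ::
  "('a::complex_vector, 'm) hopf_structure_scheme \<Rightarrow> 'a dual \<Rightarrow> ('a dual, 'a dual) tensor"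
  where "dual_comult H \<phi> = (THE t. \<forall>a b.
    tensor_lift (\<lambda>\<phi>1 \<phi>2. dual_apply \<phi>1 a * dual_apply \<phi>2 b) t = dual_apply \<phi> (amult H b a))"

definition dual_counit :: "('a::complex_vector, 'm) hopf_structure_scheme \<Rightarrow> 'a dual \<Rightarrow> complex"
  where "dual_counit H \<phi> = dual_apply \<phi> (aunit H)"

definition dual_antipode :: "('a::complex_vector, 'm) hopf_structure_scheme \<Rightarrow> 'a dual \<Rightarrow> 'a dual"
  where "dual_antipode H \<phi> = functional (\<lambda>x. dual_apply \<phi> (inv (antipode H) x))"

definition double_mult ::
  "('a::complex_vector, 'm) hopf_structure_scheme \<Rightarrow>
    ('a dual, 'a) tensor \<Rightarrow> ('a dual, 'a) tensor \<Rightarrow> ('a dual, 'a) tensor"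
  where "double_mult H s t =
    tensor_lift (\<lambda>\<phi> a. tensor_lift (\<lambda>\<psi> b.
      sweedler3 H (\<lambda>a1 a2 a3.
        dual_mult H \<phi>
          (functional (\<lambda>x. dual_apply \<psi> (amult H (amult H (inv (antipode H) a3) x) a1)))
        \<otimes>\<^sub>C amult H a2 b) a) t) s"

definition double_comult ::
  "('a::complex_vector, 'm) hopf_structure_scheme \<Rightarrow>
    ('a dual, 'a) tensor \<Rightarrow> (('a dual, 'a) tensor, ('a dual, 'a) tensor) tensor"
  where "double_comult H =
    tensor_lift (\<lambda>\<phi> a. tensor_lift (\<lambda>\<phi>1 \<phi>2.
      sweedler2 H (\<lambda>a1 a2. (\<phi>1 \<otimes>\<^sub>C a1) \<otimes>\<^sub>C (\<phi>2 \<otimes>\<^sub>C a2)) a) (dual_comult H \<phi>))"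

text \<open>The antipode is the antihomomorphism extending those of \<open>H\<close> and of its dual:
  \<open>\<phi> \<otimes> a\<close> is the product of \<open>\<phi> \<otimes> 1\<close> and \<open>\<epsilon> \<otimes> a\<close>.\<close>

definition double_antipode ::
  "('a::complex_vector, 'm) hopf_structure_scheme \<Rightarrow>
    ('a dual, 'a) tensor \<Rightarrow> ('a dual, 'a) tensor"
  where "double_antipode H =
    tensor_lift (\<lambda>\<phi> a. double_mult H
      (dual_unit H \<otimes>\<^sub>C antipode H a) (dual_antipode H \<phi> \<otimes>\<^sub>C aunit H))"

text \<open>For finite-dimensional \<open>H\<close> the R-matrix does not depend on the chosen basis.\<close>

definition chosen_basis :: "'a::complex_vector set"
  where "chosen_basis = (SOME B. cvec.independent B \<and> cvec.span B = UNIV)"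

definition double_rmatrix ::
  "('a::complex_vector, 'm) hopf_structure_scheme \<Rightarrow>
    (('a dual, 'a) tensor, ('a dual, 'a) tensor) tensor"
  where "double_rmatrix H =
    (\<Sum>b\<in>chosen_basis.
      (dual_unit H \<otimes>\<^sub>C b) \<otimes>\<^sub>C
      (functional (\<lambda>x. cvec.representation chosen_basis x b) \<otimes>\<^sub>C aunit H))"

definition drinfeld_double ::
  "('a::complex_vector, 'm) hopf_structure_scheme \<Rightarrow>
    ('a dual, 'a) tensor qt_quasi_hopf_structure"
  where "drinfeld_double H =
    (let u = dual_unit H \<otimes>\<^sub>C aunit H in
    \<lparr> amult = double_mult H,
      aunit = u,
      comult = double_comult H,
      counit = tensor_lift (\<lambda>\<phi> a. dual_counit H \<phi> * counit H a),
      antipode = double_antipode H,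
      coassociator = u \<otimes>\<^sub>C u \<otimes>\<^sub>C u,
      alpha_elem = u,
      beta_elem = u,
      rmatrix = double_rmatrix H \<rparr>)"

section \<open>The Hopf algebra \<open>H(N)\<close>\<close>

text \<open>The index set \<open>{1..N}\<close> is a finite linearly ordered type \<open>'n\<close> with \<open>N = CARD('n)\<close>.\<close>

datatype 'n H_gen = H_k | H_f 'n

instantiation H_gen :: (type) presentation
begin

definition relators_H_gen :: "'a H_gen free_algebra set"
  where "relators_H_gen =
    {var (H_f i) * var (H_f j) + var (H_f j) * var (H_f i) | i j. True} \<union>
    {var (H_f i) * var H_k + var H_k * var (H_f i) | i. True} \<union>
    {var H_k ^ 2 - 1}"

instance ..

end

type_synonym 'n H_algebra = "'n H_gen presented_algebra"

definition H_hopf :: "'n H_algebra hopf_structure"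
  where "H_hopf =
    (let k = gen H_k; f = (\<lambda>i. gen (H_f i)) in
    \<lparr> amult = (*),
      aunit = 1,
      comult = hom_extension (\<lambda>g. case g of
          H_k \<Rightarrow> k \<otimes>\<^sub>C k
        | H_f i \<Rightarrow> f i \<otimes>\<^sub>C k + 1 \<otimes>\<^sub>C f i),
      counit = hom_extension (\<lambda>g. case g of H_k \<Rightarrow> 1 | H_f i \<Rightarrow> 0),
      antipode = antihom_extension (\<lambda>g. case g of
          H_k \<Rightarrow> k
        | H_f i \<Rightarrow> - (f i * k)) \<rparr>)"

section \<open>The quasi-Hopf algebra \<open>Q(N, \<beta>)\<close>\<close>

datatype 'n Q_gen = Q_K | Q_fp 'n | Q_fm 'n

instantiation Q_gen :: (type) presentation
begin

definition relators_Q_gen :: "'a Q_gen free_algebra set"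
  where "relators_Q_gen =
    (let K = var Q_K; fp = (\<lambda>i. var (Q_fp i)); fm = (\<lambda>i. var (Q_fm i));
         e1 = (1/2) *\<^sub>C (1 - K ^ 2)
     in {fp i * K + K * fp i | i. True} \<union>
        {fm i * K + K * fm i | i. True} \<union>
        {fp i * fm j + fm j * fp i - (if i = j then e1 else 0) | i j. True} \<union>
        {fp i * fp j + fp j * fp i | i j. True} \<union>
        {fm i * fm j + fm j * fm i | i j. True} \<union>
        {K ^ 4 - 1})"

instance ..

end

type_synonym 'n Q_algebra = "'n Q_gen presented_algebra"

definition Q_e :: "nat \<Rightarrow> 'n Q_algebra"
  where "Q_e n = (1/2) *\<^sub>C (if n = 0 then 1 + gen Q_K ^ 2 else 1 - gen Q_K ^ 2)"

definition omega_p :: "'n Q_algebra"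
  where "omega_p = (Q_e 0 + \<i> *\<^sub>C Q_e 1) * gen Q_K"

definition omega_m :: "'n Q_algebra"
  where "omega_m = (Q_e 0 - \<i> *\<^sub>C Q_e 1) * gen Q_K"

text \<open>In the antipode, \<open>K\<close> to the power \<open>(-1)\<^sup>N\<close> is \<open>K ^ 3\<close> for odd \<open>N\<close>, since \<open>K ^ 4 = 1\<close>.\<close>

definition Q_comult :: "'n::finite Q_algebra \<Rightarrow> ('n Q_algebra, 'n Q_algebra) tensor"
  where "Q_comult = hom_extension (\<lambda>g. case g of
      Q_K \<Rightarrow> gen Q_K \<otimes>\<^sub>C gen Q_K -
        (1 + (-1) ^ CARD('n)) *\<^sub>C ((Q_e 1 \<otimes>\<^sub>C Q_e 1) * (gen Q_K \<otimes>\<^sub>C gen Q_K))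
    | Q_fp i \<Rightarrow> gen (Q_fp i) \<otimes>\<^sub>C 1 + omega_p \<otimes>\<^sub>C gen (Q_fp i)
    | Q_fm i \<Rightarrow> gen (Q_fm i) \<otimes>\<^sub>C 1 + omega_m \<otimes>\<^sub>C gen (Q_fm i))"

definition Q_antipode :: "'n::finite Q_algebra \<Rightarrow> 'n Q_algebra"
  where "Q_antipode = antihom_extension (\<lambda>g. case g of
      Q_K \<Rightarrow> (if even CARD('n) then gen Q_K else gen Q_K ^ 3)
    | Q_fp i \<Rightarrow> gen (Q_fp i) * (Q_e 0 + ((-1) ^ CARD('n) * \<i>) *\<^sub>C Q_e 1) * gen Q_K
    | Q_fm i \<Rightarrow> gen (Q_fm i) * (Q_e 0 - ((-1) ^ CARD('n) * \<i>) *\<^sub>C Q_e 1) * gen Q_K)"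

definition Q_coassociator ::
  "complex \<Rightarrow> ('n::finite Q_algebra, ('n Q_algebra, 'n Q_algebra) tensor) tensor"
  where "Q_coassociator \<beta> =
    1 \<otimes>\<^sub>C 1 \<otimes>\<^sub>C 1 +
    Q_e 1 \<otimes>\<^sub>C Q_e 1 \<otimes>\<^sub>C
      ((gen Q_K ^ CARD('n) - 1) * Q_e 0 +
       (\<beta>\<^sup>2 *\<^sub>C (\<i> *\<^sub>C gen Q_K) ^ CARD('n) - 1) * Q_e 1)"

definition Q_rho :: "nat \<Rightarrow> nat \<Rightarrow> ('n Q_algebra, 'n Q_algebra) tensor"
  where "Q_rho n m = (1/2) *\<^sub>C
    (\<Sum>p\<le>1. \<Sum>q\<le>1. ((-1) ^ (p * q) * \<i> powi (- int (p * n) + int (q * m))) *\<^sub>C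
      (gen Q_K ^ p \<otimes>\<^sub>C gen Q_K ^ q))"

definition Q_rmatrix ::
  "complex \<Rightarrow> ('n::{finite, linorder} Q_algebra, 'n Q_algebra) tensor"
  where "Q_rmatrix \<beta> =
    (\<Sum>n\<le>1. \<Sum>m\<le>1. \<beta> ^ (n * m) *\<^sub>C (Q_rho n m * (Q_e n \<otimes>\<^sub>C Q_e m))) *
    prod_list (map (\<lambda>k. 1 \<otimes>\<^sub>C 1 - 2 *\<^sub>C ((gen (Q_fm k) * omega_m) \<otimes>\<^sub>C gen (Q_fp k)))
      (sorted_list_of_set UNIV))"

definition Q_quasi_hopf ::
  "complex \<Rightarrow> 'n::{finite, linorder} Q_algebra qt_quasi_hopf_structure"
  where "Q_quasi_hopf \<beta> =
    \<lparr> amult = (*),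
      aunit = 1,
      comult = Q_comult,
      counit = hom_extension (\<lambda>g. case g of Q_K \<Rightarrow> 1 | Q_fp i \<Rightarrow> 0 | Q_fm i \<Rightarrow> 0),
      antipode = Q_antipode,
      coassociator = Q_coassociator \<beta>,
      alpha_elem = 1,
      beta_elem = Q_e 0 + \<beta>\<^sup>2 *\<^sub>C (\<i> *\<^sub>C gen Q_K) ^ CARD('n) * Q_e 1,
      rmatrix = Q_rmatrix \<beta> \<rparr>"

end

theory Submission
  imports Defs
begin

text \<open>
  Let \<open>\<kappa>\<close> and \<open>G\<^sub>i\<close> in the dual of \<open>H = H(N)\<close> be the character \<open>k \<mapsto> -1\<close>, \<open>f\<^sub>j \<mapsto> 0\<close> and the functional
  \<open>k\<^sup>a f\<^sub>j \<mapsto> \<delta>\<^sub>i\<^sub>j\<close> that vanishes on all other monomials. In the double, \<open>k, \<kappa>\<close> are commuting involutions,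
  both anticommute with \<open>f\<^sub>i, G\<^sub>i\<close>, and \<open>f\<^sub>i G\<^sub>j - G\<^sub>j f\<^sub>i = \<delta>\<^sub>i\<^sub>j (k - \<kappa>)\<close>. These are the relations satisfied in \<open>Q\<close>
  by \<open>\<omega>\<^sub>-\<close>, \<open>\<omega>\<^sub>+\<close>, \<open>f\<^sub>i\<^sup>- \<omega>\<^sub>-\<close> and \<open>-2 f\<^sub>i\<^sup>+\<close>, which generate \<open>Q\<close>. So \<open>Q\<close> acts on the double through
  left multiplication by \<open>k, \<kappa>, f\<^sub>i, G\<^sub>i\<close>, and applying this action to the unit gives the inverse of the
  isomorphism. The isomorphism itself is \<open>\<phi> \<otimes> a \<mapsto> (\<phi> \<otimes> id)(\<Theta>) B(a)\<close>, where \<open>B\<close> is the homomorphism from \<open>H\<close>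
  to \<open>Q\<close> and \<open>\<Theta> = (1/2) (\<Sum> (-1)\<^sup>p\<^sup>q k\<^sup>p \<otimes> \<omega>\<^sub>+\<^sup>q) \<Prod>\<^sub>j (1 - 2 f\<^sub>j \<otimes> f\<^sub>j\<^sup>+)\<close> is the canonical element of
  \<open>H \<otimes> H\<^sup>*\<close> with its second leg mapped to \<open>Q\<close>. Compatibility with every structure
  map becomes an identity for \<open>\<Theta>\<close>, checked factor by factor.
\<close>

section \<open>Linear and multiplicative maps\<close>

text \<open>No basis of \<open>H(N)\<close> or \<open>Q\<close> is available at the start, and the
  product of the double is a bare formula whose associativity is not given. Therefore identities
  between functionals are proved by induction on words, through shifts by generators;
  \<open>Q\<close> is handled only by its universal property, with values in linear operators on the
  double; and bijectivity comes from two mutually inverse maps instead of a dimension count. A basis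
  of \<open>H(N)\<close> enters only for the coproduct of the dual and the R-matrix of the double.

  An element \<open>K\<close> with \<open>K^4 = 1\<close> carries the same information as two
  commuting involutions: \<open>omega_p\<close> and \<open>omega_m\<close> are combinations of
  \<open>K\<close> and \<open>K^3\<close> that square to 1, their product is \<open>K^2\<close>, and
  \<open>K\<close> is a combination of them. For even \<open>N\<close> the correction term in the
  coproduct of \<open>K\<close> is what makes both of them grouplike, as \<open>k\<close> and
  \<kappa> are in the double. The parameter \<beta> enters the coassociator and the element
  \<open>beta_elem\<close> through its square, but the R-matrix through \<beta> itself; this is the
  source of the different conditions on \<beta>.\<close>

lemma clinear_id: "clinear (\<lambda>x. x)"
  by (rule clinearI) simp_all

lemma clinear_compose: "clinear f \<Longrightarrow> clinear g \<Longrightarrow> clinear (\<lambda>x. f (g x))"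
  by (rule clinearI) (simp_all add: clinearD)

lemma clinear_sum: "clinear f \<Longrightarrow> f (sum g S) = (\<Sum>x\<in>S. f (g x))"
  by (induction S rule: infinite_finite_induct) (simp_all add: clinearD)

lemma alg_homI:
  assumes "clinear f" "f 1 = 1" "\<And>x y. f (x * y) = f x * f y"
  shows "alg_hom f"
  using assms by (simp add: alg_hom_def)

lemma alg_homD:
  assumes "alg_hom f"
  shows "clinear f" "f 1 = 1" "f (x * y) = f x * f y" "f (x + y) = f x + f y"
    "f (c *\<^sub>C x) = c *\<^sub>C f x" "f 0 = 0" "f (x - y) = f x - f y"
  using assms by (auto simp: alg_hom_def clinearD)

lemma alg_hom_uminus: "alg_hom f \<Longrightarrow> f (- x) = - f x"
  using alg_homD(7)[of f 0 x] by (simp add: alg_homD)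

lemma alg_hom_prod_list: "alg_hom f \<Longrightarrow> f (prod_list xs) = prod_list (map f xs)"
  by (induction xs) (simp_all add: alg_homD)

lemma alg_hom_id: "alg_hom (\<lambda>x. x)"
  by (rule alg_homI) (simp_all add: clinear_id)

lemma alg_hom_compose: "alg_hom f \<Longrightarrow> alg_hom g \<Longrightarrow> alg_hom (\<lambda>x. f (g x))"
  by (rule alg_homI) (simp_all add: alg_hom_def clinear_compose)

lemma alg_antihomI:
  assumes "clinear f" "f 1 = 1" "\<And>x y. f (x * y) = f y * f x"
  shows "alg_antihom f"
  using assms by (simp add: alg_antihom_def)

lemma alg_antihomD:
  assumes "alg_antihom f"
  shows "clinear f" "f 1 = 1" "f (x * y) = f y * f x" "f (x + y) = f x + f y"
    "f (c *\<^sub>C x) = c *\<^sub>C f x" "f 0 = 0" "f (x - y) = f x - f y"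
  using assms by (auto simp: alg_antihom_def clinearD)

lemma alg_antihom_uminus: "alg_antihom f \<Longrightarrow> f (- x) = - f x"
  using alg_antihomD(7)[of f 0 x] by (simp add: alg_antihomD)

lemma alg_hom_antihom_compose: "alg_hom f \<Longrightarrow> alg_antihom g \<Longrightarrow> alg_antihom (\<lambda>x. f (g x))"
  by (rule alg_antihomI) (simp_all add: alg_hom_def alg_antihom_def clinear_compose)

lemma alg_antihom_hom_compose: "alg_antihom f \<Longrightarrow> alg_hom g \<Longrightarrow> alg_antihom (\<lambda>x. f (g x))"
  by (rule alg_antihomI) (simp_all add: alg_hom_def alg_antihom_def clinear_compose)

lemma alg_antihom_antihom_compose: "alg_antihom f \<Longrightarrow> alg_antihom g \<Longrightarrow> alg_hom (\<lambda>x. f (g x))"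
  by (rule alg_homI) (simp_all add: alg_antihom_def clinear_compose)

lemmas scaleC_ring_simps =
  mult_scaleC_left mult_scaleC_right scaleC_add_right scaleC_scaleC

section \<open>The universal property of presented algebras\<close>

definition free_eval :: "('g \<Rightarrow> 'b::complex_algebra_1) \<Rightarrow> 'g free_algebra \<Rightarrow> 'b" where
  "free_eval v p = (\<Sum>w\<in>Poly_Mapping.keys p.
    Poly_Mapping.lookup p w *\<^sub>C prod_list (map v (letters w)))"

lemma free_eval_super:
  assumes "finite S" "Poly_Mapping.keys p \<subseteq> S"
  shows "free_eval v p = (\<Sum>w\<in>S. Poly_Mapping.lookup p w *\<^sub>C prod_list (map v (letters w)))"
  unfolding free_eval_def using assms by (intro sum.mono_neutral_left) (auto simp: in_keys_iff)

lemma free_eval_add: "free_eval v (p + q) = free_eval v p + free_eval v q"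
proof -
  let ?S = "Poly_Mapping.keys p \<union> Poly_Mapping.keys q"
  have "free_eval v (p + q) =
      (\<Sum>w\<in>?S. Poly_Mapping.lookup (p + q) w *\<^sub>C prod_list (map v (letters w)))"
    by (rule free_eval_super) (use keys_add[of p q] in auto)
  also have "\<dots> = (\<Sum>w\<in>?S. Poly_Mapping.lookup p w *\<^sub>C prod_list (map v (letters w))) +
      (\<Sum>w\<in>?S. Poly_Mapping.lookup q w *\<^sub>C prod_list (map v (letters w)))"
    by (simp add: lookup_add scaleC_add_left sum.distrib)
  also have "\<dots> = free_eval v p + free_eval v q"
    by (subst (1 2) free_eval_super[of ?S]) auto
  finally show ?thesis .
qed

lemma free_eval_zero: "free_eval v 0 = 0"
  by (simp add: free_eval_def)

lemma free_eval_single: "free_eval v (Poly_Mapping.single w c) = c *\<^sub>C prod_list (map v (letters w))"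
  by (simp add: free_eval_def)

lemma free_algebra_induct [case_names zero add]:
  assumes "P 0" "\<And>p w c. P p \<Longrightarrow> P (p + Poly_Mapping.single w c)"
  shows "P (p :: 'g free_algebra)"
proof (induction p rule: update_induct)
  case const
  then show ?case by (fact assms(1))
next
  case (update f a b)
  have "Poly_Mapping.update a b f = f + Poly_Mapping.single a b"
    using update by (intro poly_mapping_eqI)
      (auto simp: lookup_update lookup_add lookup_single in_keys_iff when_def)
  then show ?case using assms(2)[OF update(3)] by simp
qed

lemma free_eval_mult: "free_eval v (p * q) = free_eval v p * free_eval v q"
proof (induction p rule: free_algebra_induct)
  case zero
  then show ?case by (simp add: free_eval_zero)
next
  case (add p w c)
  have "free_eval v (Poly_Mapping.single w c * q) =
      free_eval v (Poly_Mapping.single w c) * free_eval v q"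
    by (induction q rule: free_algebra_induct)
       (simp_all add: free_eval_zero free_eval_add distrib_left mult_single free_eval_single
         plus_free_monoid_def mult_scaleC_left mult_scaleC_right scaleC_scaleC mult.commute)
  with add show ?case by (simp add: distrib_right free_eval_add)
qed

lemma free_eval_one: "free_eval v 1 = 1"
  using free_eval_single[of v 0 1] by (simp add: zero_free_monoid_def flip: single_one)

lemma free_eval_scale: "free_eval v (c *\<^sub>C p) = c *\<^sub>C free_eval v p"
  by (simp add: scaleC_eq_single_mult free_eval_mult free_eval_single zero_free_monoid_def
      mult_scaleC_left)

lemma free_eval_var: "free_eval v (var g) = v g"
  by (simp add: var_def free_eval_single scaleC_one)

lemma free_eval_uminus: "free_eval v (- p) = - free_eval v p"
  using free_eval_add[of v p "- p"] by (simp add: free_eval_zero add_eq_0_iff)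

lemma free_eval_diff: "free_eval v (p - q) = free_eval v p - free_eval v q"
  using free_eval_add[of v p "- q"] by (simp add: free_eval_uminus)

lemma free_eval_power: "free_eval v (p ^ n) = free_eval v p ^ n"
  by (induction n) (simp_all add: free_eval_one free_eval_mult)

lemmas free_eval_simps = free_eval_add free_eval_zero free_eval_mult free_eval_one
  free_eval_scale free_eval_var free_eval_diff free_eval_power

lemma presented_surj: "\<exists>p. x = abs_presented_algebra p"
  by (rule presented_algebra.abs_induct) (rule exI, rule refl)

lemma presented_induct_left [case_names zero add scale one gen]:
  fixes x :: "'g::presentation presented_algebra"
  assumes "P 0" "\<And>x y. P x \<Longrightarrow> P y \<Longrightarrow> P (x + y)" "\<And>c x. P x \<Longrightarrow> P (c *\<^sub>C x)" "P 1"
    "\<And>g x. P x \<Longrightarrow> P (gen g * x)"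
  shows "P x"
proof -
  have w: "P (abs_presented_algebra (Poly_Mapping.single (Word l) 1))" for l :: "'g list"
  proof (induction l)
    case Nil
    have "Poly_Mapping.single (Word []) 1 = (1 :: 'g free_algebra)"
      by (metis single_one zero_free_monoid_def)
    then show ?case using assms(4) by (simp add: one_presented_algebra.abs_eq)
  next
    case (Cons g l)
    have "Poly_Mapping.single (Word (g # l)) 1 = var g * Poly_Mapping.single (Word l) 1"
      by (simp add: var_def mult_single plus_free_monoid_def)
    then show ?case using assms(5)[OF Cons, of g]
      by (simp add: gen.abs_eq times_presented_algebra.abs_eq)
  qed
  have "P (abs_presented_algebra p)" for p
  proof (induction p rule: free_algebra_induct)
    case zero
    then show ?case using assms(1) by (simp add: zero_presented_algebra.abs_eq)
  next
    case (add p w c)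
    obtain l where l: "w = Word l" by (cases w)
    have "Poly_Mapping.single w c = c *\<^sub>C Poly_Mapping.single w 1"
      by (simp add: scaleC_eq_single_mult mult_single)
    then have "abs_presented_algebra (p + Poly_Mapping.single w c) =
        abs_presented_algebra p + c *\<^sub>C abs_presented_algebra (Poly_Mapping.single w 1)"
      by (simp add: plus_presented_algebra.abs_eq scaleC_presented_algebra.abs_eq)
    then show ?case using add assms(2,3) w[of l] l by simp
  qed
  then show ?thesis using presented_surj[of x] by blast
qed

lemma presented_induct_mult [case_names zero add scale one gen mult]:
  fixes x :: "'g::presentation presented_algebra"
  assumes "P 0" "\<And>x y. P x \<Longrightarrow> P y \<Longrightarrow> P (x + y)" "\<And>c x. P x \<Longrightarrow> P (c *\<^sub>C x)" "P 1"
    "\<And>g. P (gen g)" "\<And>x y. P x \<Longrightarrow> P y \<Longrightarrow> P (x * y)"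
  shows "P x"
  by (induction x rule: presented_induct_left) (use assms in auto)

lemma presented_induct_right [case_names zero add scale one gen]:
  fixes x :: "'g::presentation presented_algebra"
  assumes "P 0" "\<And>x y. P x \<Longrightarrow> P y \<Longrightarrow> P (x + y)" "\<And>c x. P x \<Longrightarrow> P (c *\<^sub>C x)" "P 1"
    "\<And>g x. P x \<Longrightarrow> P (x * gen g)"
  shows "P x"
proof -
  \<comment> \<open>\<open>P\<close> itself need not be closed under products. The property that
    right multiplication by \<open>x\<close> preserves \<open>P\<close> is, so
    \<open>presented_induct_mult\<close> applies to it.\<close>
  have "\<forall>y. P y \<longrightarrow> P (y * x)"
  proof (induction x rule: presented_induct_mult)
    case (mult x y)
    then show ?case by (simp flip: mult.assoc)
  qed (use assms in \<open>auto simp: distrib_left mult_scaleC_right\<close>)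
  from this[rule_format, OF assms(4)] show ?thesis by simp
qed

lemma alg_hom_eqI:
  assumes "alg_hom f" "alg_hom f'" "\<And>g. f (gen g) = f' (gen g)"
  shows "f x = f' x"
  by (induction x rule: presented_induct_left) (simp_all add: assms alg_homD)

lemma alg_antihom_eqI:
  assumes "alg_antihom f" "alg_antihom f'" "\<And>g. f (gen g) = f' (gen g)"
  shows "f x = f' x"
  by (induction x rule: presented_induct_left) (simp_all add: assms alg_antihomD)

lemma hom_extension_exists:
  fixes v :: "'g::presentation \<Rightarrow> 'b::complex_algebra_1"
  assumes rel: "\<And>r. r \<in> relators \<Longrightarrow> free_eval v r = 0"
  shows "\<exists>f. alg_hom f \<and> (\<forall>g. f (gen g) = v g)"
proof -
  have ideal: "free_eval v p = 0" if "p \<in> two_sided_ideal relators" for p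
    using that by induction (simp_all add: free_eval_simps rel)
  define f where "f x = free_eval v (rep_presented_algebra x)" for x
  have f_abs: "f (abs_presented_algebra p) = free_eval v p" for p
  proof -
    have "rep_presented_algebra (abs_presented_algebra p) - p \<in> two_sided_ideal relators"
      using Quotient3_rep_abs[OF Quotient3_presented_algebra, of p] by (simp add: two_sided_ideal.zero)
    from ideal[OF this] show ?thesis by (simp add: f_def free_eval_diff)
  qed
  have "alg_hom f"
  proof (intro alg_homI clinearI)
    fix x y :: "'g presented_algebra" and c
    obtain p q where "x = abs_presented_algebra p" "y = abs_presented_algebra q"
      using presented_surj by blast
    then show "f (x + y) = f x + f y" "f (c *\<^sub>C x) = c *\<^sub>C f x" "f (x * y) = f x * f y"
      by (simp_all add: plus_presented_algebra.abs_eq scaleC_presented_algebra.abs_eq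
          times_presented_algebra.abs_eq f_abs free_eval_simps)
    show "f 1 = 1"
      by (simp add: one_presented_algebra.abs_eq f_abs free_eval_simps)
  qed
  moreover have "f (gen g) = v g" for g
    by (simp add: gen.abs_eq f_abs free_eval_simps)
  ultimately show ?thesis by blast
qed

lemma hom_extension:
  assumes "\<And>r. r \<in> relators \<Longrightarrow> free_eval v r = 0"
  shows "alg_hom (hom_extension v)" "hom_extension v (gen g) = v g"
proof -
  have "\<exists>!f. alg_hom f \<and> (\<forall>g. f (gen g) = v g)"
    by (rule ex_ex1I[OF hom_extension_exists[OF assms]], assumption)
      (rule ext, rule alg_hom_eqI, simp_all)
  from theI'[OF this] show "alg_hom (hom_extension v)" "hom_extension v (gen g) = v g"
    by (simp_all add: hom_extension_def)
qed

text \<open>An antihomomorphism is a homomorphism into the opposite algebra; this reduces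
  \<open>antihom_extension\<close> to the universal property already proved.\<close>

datatype 'a opposite = Opposite (unopposite: 'a)

instantiation opposite :: (complex_algebra_1) complex_algebra_1
begin

definition "0 = Opposite 0"
definition "1 = Opposite 1"
definition "x + y = Opposite (unopposite x + unopposite y)"
definition "x - y = Opposite (unopposite x - unopposite y)"
definition "- x = Opposite (- unopposite x)"
definition "x * y = Opposite (unopposite y * unopposite x)"
definition "c *\<^sub>C x = Opposite (c *\<^sub>C unopposite x)"

instance
  by standard (simp_all add: zero_opposite_def one_opposite_def plus_opposite_def
      minus_opposite_def uminus_opposite_def times_opposite_def scaleC_opposite_def
      algebra_simps scaleC_ring_simps scaleC_add_left)

end

lemma antihom_extension:
  fixes v :: "'g::presentation \<Rightarrow> 'b::complex_algebra_1"
  assumes "\<And>r. r \<in> relators \<Longrightarrow> free_eval (\<lambda>g. Opposite (v g)) r = 0"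
  shows "alg_antihom (antihom_extension v)" "antihom_extension v (gen g) = v g"
proof -
  obtain f :: "'g presented_algebra \<Rightarrow> 'b opposite"
    where f: "alg_hom f" "\<And>g. f (gen g) = Opposite (v g)"
    using hom_extension_exists[OF assms] by blast
  have "alg_antihom (\<lambda>x. unopposite (f x))"
    by (intro alg_antihomI clinearI) (simp_all add: alg_homD[OF f(1)] plus_opposite_def
        scaleC_opposite_def one_opposite_def times_opposite_def)
  then have ex: "\<exists>f. alg_antihom f \<and> (\<forall>g. f (gen g) = v g)"
    by (rule_tac exI[of _ "\<lambda>x. unopposite (f x)"]) (simp add: f)
  have "\<exists>!f. alg_antihom f \<and> (\<forall>g. f (gen g) = v g)"
    by (rule ex_ex1I[OF ex]) (rule ext, rule alg_antihom_eqI, simp_all)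
  from theI'[OF this] show "alg_antihom (antihom_extension v)" "antihom_extension v (gen g) = v g"
    by (simp_all add: antihom_extension_def)
qed

section \<open>Tensor products of algebras\<close>

lemmas pure_tensor_simps = pure_tensor_add_left pure_tensor_add_right
  pure_tensor_scale_left pure_tensor_scale_right

lemma cbilinear_pure_tensor: "cbilinear (\<otimes>\<^sub>C)"
  by (rule cbilinearI) (rule pure_tensor_simps)+

lemma cbilinear_clinear:
  assumes "cbilinear F"
  shows "clinear (F a)" "clinear (\<lambda>a. F a b)"
  using assms by (simp_all add: cbilinear_def)

lemma pure_tensor_zero [simp]: "0 \<otimes>\<^sub>C b = 0" "a \<otimes>\<^sub>C 0 = 0"
  using cbilinear_clinear[OF cbilinear_pure_tensor, THEN clinearD(3)] by auto

lemma pure_tensor_diff_left: "(a - a') \<otimes>\<^sub>C b = a \<otimes>\<^sub>C b - a' \<otimes>\<^sub>C b"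
  using cbilinear_clinear(2)[OF cbilinear_pure_tensor, THEN clinearD(4)] .

lemma pure_tensor_diff_right: "a \<otimes>\<^sub>C (b - b') = a \<otimes>\<^sub>C b - a \<otimes>\<^sub>C b'"
  using cbilinear_clinear(1)[OF cbilinear_pure_tensor, THEN clinearD(4)] .

lemma pure_tensor_uminus_left: "(- a) \<otimes>\<^sub>C b = - (a \<otimes>\<^sub>C b)"
  using pure_tensor_diff_left[of 0 a b] by simp

lemma pure_tensor_uminus_right: "a \<otimes>\<^sub>C (- b) = - (a \<otimes>\<^sub>C b)"
  using pure_tensor_diff_right[of a 0 b] by simp

lemma cbilinear_compose: "cbilinear F \<Longrightarrow> clinear f \<Longrightarrow> clinear g \<Longrightarrow> cbilinear (\<lambda>x y. F (f x) (g y))"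
  by (rule cbilinearI) (simp_all add: clinearD cbilinearD)

lemma cbilinear_post: "clinear f \<Longrightarrow> cbilinear F \<Longrightarrow> cbilinear (\<lambda>x y. f (F x y))"
  by (rule cbilinearI) (simp_all add: clinearD cbilinearD)

lemma cbilinear_times: "cbilinear ((*) :: 'a::complex_algebra_1 \<Rightarrow> _)"
  by (rule cbilinearI) (simp_all add: algebra_simps scaleC_ring_simps)

lemma tensor_lift_post:
  assumes "clinear f" "cbilinear F"
  shows "f (tensor_lift F t) = tensor_lift (\<lambda>x y. f (F x y)) t"
proof (rule clinear_tensor_eqI)
  note post = cbilinear_post[OF assms]
  show "clinear (\<lambda>t. f (tensor_lift F t))"
    by (rule clinear_compose[OF assms(1) tensor_lift(1)[OF assms(2)]])
  show "clinear (tensor_lift (\<lambda>x y. f (F x y)))"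
    by (rule tensor_lift(1)[OF post])
  show "f (tensor_lift F (a \<otimes>\<^sub>C b)) = tensor_lift (\<lambda>x y. f (F x y)) (a \<otimes>\<^sub>C b)" for a b
    by (simp add: tensor_lift(2)[OF post] tensor_lift(2)[OF assms(2)])
qed

lemma tensor_map:
  assumes "clinear f" "clinear g"
  shows "clinear (tensor_map f g)" "tensor_map f g (a \<otimes>\<^sub>C b) = f a \<otimes>\<^sub>C g b"
  using tensor_lift[OF cbilinear_compose[OF cbilinear_pure_tensor assms]]
  by (simp_all add: tensor_map_def)

lemma times_pure_tensor:
  fixes a c :: "'a::complex_algebra_1" and b d :: "'b::complex_algebra_1"
  shows "(a \<otimes>\<^sub>C b) * (c \<otimes>\<^sub>C d) = (a * c) \<otimes>\<^sub>C (b * d)"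
proof -
  have m: "cbilinear (\<lambda>c d. (a * c) \<otimes>\<^sub>C (b * d))"
    for a :: 'a and b :: 'b
    by (rule cbilinearI) (simp_all add: distrib_left mult_scaleC_right pure_tensor_simps)
  define T where "T a b = tensor_lift (\<lambda>c d. (a * c) \<otimes>\<^sub>C (b * d))" for a :: 'a and b :: 'b
  have T: "T a b (c \<otimes>\<^sub>C d) = (a * c) \<otimes>\<^sub>C (b * d)" "T a b (s + t) = T a b s + T a b t"
    "T a b 0 = 0" for a b c d s t
    using tensor_lift(2)[OF m] clinearD[OF tensor_lift(1)[OF m]] by (simp_all add: T_def)
  have "cbilinear (\<lambda>a b. T a b t)" for t :: "('a, 'b) tensor"
    by (rule cbilinearI; induction t rule: tensor_induct)
      (simp_all add: T distrib_right mult_scaleC_left pure_tensor_simps scaleC_add_right)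
  from tensor_lift(2)[OF this, of "c \<otimes>\<^sub>C d" a b] show ?thesis
    unfolding times_tensor_def T_def[symmetric] by (simp only: T(1))
qed

lemma pure_tensor_one: "1 \<otimes>\<^sub>C 1 = 1"
  by (simp add: one_tensor_def)

text \<open>Three different maps are allowed because in \<open>alg_hom_H_op\<close> they are
  \<open>sandwich_op\<close> with third arguments \<open>z\<close>, \<open>w\<close> and
  \<open>z * w\<close>.\<close>

lemma tensor_lift_mult:
  fixes F G P :: "'a::complex_algebra_1 \<Rightarrow> 'b::complex_algebra_1 \<Rightarrow> 'c::complex_algebra_1"
  assumes "cbilinear F" "cbilinear G" "cbilinear P"
    and P: "\<And>a b c d. P (a * c) (b * d) = F a b * G c d"
  shows "tensor_lift P (s * t) = tensor_lift F s * tensor_lift G t"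
proof (induction s rule: tensor_induct)
  note lins = clinearD[OF tensor_lift(1)[OF assms(1)]] clinearD[OF tensor_lift(1)[OF assms(2)]]
    clinearD[OF tensor_lift(1)[OF assms(3)]] tensor_lift(2)[OF assms(1)]
    tensor_lift(2)[OF assms(2)] tensor_lift(2)[OF assms(3)]
  case zero
  then show ?case by (simp add: lins)
  case (add s a b)
  have "tensor_lift P ((a \<otimes>\<^sub>C b) * t) = F a b * tensor_lift G t"
    by (induction t rule: tensor_induct) (simp_all add: lins distrib_left times_pure_tensor P)
  with add show ?case by (simp add: lins distrib_right)
qed

lemma alg_hom_tensor_lift:
  fixes F :: "'a::complex_algebra_1 \<Rightarrow> 'b::complex_algebra_1 \<Rightarrow> 'c::complex_algebra_1"
  assumes "cbilinear F" "F 1 1 = 1" "\<And>a b c d. F (a * c) (b * d) = F a b * F c d"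
  shows "alg_hom (tensor_lift F)"
proof (rule alg_homI)
  show "clinear (tensor_lift F)" "tensor_lift F 1 = 1"
    using tensor_lift(1)[OF assms(1)] tensor_lift(2)[OF assms(1), of 1 1] assms(2)
    by (simp_all add: pure_tensor_one)
  show "tensor_lift F (s * t) = tensor_lift F s * tensor_lift F t" for s t
    by (rule tensor_lift_mult[OF assms(1,1,1,3)])
qed

lemma alg_hom_tensor_map:
  fixes f :: "'a::complex_algebra_1 \<Rightarrow> 'c::complex_algebra_1"
    and g :: "'b::complex_algebra_1 \<Rightarrow> 'd::complex_algebra_1"
  assumes "alg_hom f" "alg_hom g"
  shows "alg_hom (tensor_map f g)"
  unfolding tensor_map_def
proof (rule alg_hom_tensor_lift)
  show "cbilinear (\<lambda>a b. f a \<otimes>\<^sub>C g b)"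
    by (rule cbilinear_compose[OF cbilinear_pure_tensor alg_homD(1)[OF assms(1)]
          alg_homD(1)[OF assms(2)]])
qed (simp_all add: alg_homD[OF assms(1)] alg_homD[OF assms(2)] pure_tensor_one times_pure_tensor)

lemma alg_antihom_tensor_map:
  fixes f :: "'a::complex_algebra_1 \<Rightarrow> 'c::complex_algebra_1"
    and g :: "'b::complex_algebra_1 \<Rightarrow> 'd::complex_algebra_1"
  assumes "alg_antihom f" "alg_antihom g"
  shows "alg_antihom (tensor_map f g)"
proof (rule alg_antihomI)
  note m = tensor_map[OF alg_antihomD(1)[OF assms(1)] alg_antihomD(1)[OF assms(2)]]
  note lins = clinearD[OF m(1)] m(2) alg_antihomD[OF assms(1)] alg_antihomD[OF assms(2)]
  show "clinear (tensor_map f g)" by (rule m)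
  show "tensor_map f g 1 = 1"
    using m(2)[of 1 1] by (simp add: lins pure_tensor_one)
  show "tensor_map f g (s * t) = tensor_map f g t * tensor_map f g s" for s t
  proof (induction s rule: tensor_induct)
    case (add s a b)
    have "tensor_map f g ((a \<otimes>\<^sub>C b) * t) = tensor_map f g t * tensor_map f g (a \<otimes>\<^sub>C b)"
      by (induction t rule: tensor_induct)
        (simp_all add: lins distrib_left distrib_right times_pure_tensor)
    with add show ?case by (simp add: lins distrib_left distrib_right)
  qed (simp add: lins)
qed

section \<open>The algebra of endomorphisms\<close>

text \<open>Operators on the double are to be values of \<open>hom_extension\<close>, so they need a
  type in the class \<open>complex_algebra_1\<close>.\<close>

typedef (overloaded) 'a endo = "{f :: 'a::complex_vector \<Rightarrow> 'a. clinear f}"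
  morphisms endo_apply Endo
  by (rule exI[of _ "\<lambda>x. x"]) (simp add: clinear_id)

setup_lifting type_definition_endo

instantiation endo :: (complex_vector) complex_algebra_1
begin

lift_definition zero_endo :: "'a endo" is "\<lambda>_. 0"
  by (rule clinearI) simp_all

lift_definition one_endo :: "'a endo" is "\<lambda>x. x"
  by (rule clinear_id)

lift_definition plus_endo :: "'a endo \<Rightarrow> 'a endo \<Rightarrow> 'a endo" is "\<lambda>f g x. f x + g x"
  by (rule clinearI) (simp_all add: clinearD scaleC_add_right)

lift_definition uminus_endo :: "'a endo \<Rightarrow> 'a endo" is "\<lambda>f x. - f x"
  by (rule clinearI) (simp_all add: clinearD)

lift_definition minus_endo :: "'a endo \<Rightarrow> 'a endo \<Rightarrow> 'a endo" is "\<lambda>f g x. f x - g x"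
  by (rule clinearI) (simp_all add: clinearD cvec.scale_right_diff_distrib)

lift_definition times_endo :: "'a endo \<Rightarrow> 'a endo \<Rightarrow> 'a endo" is "\<lambda>f g x. f (g x)"
  by (rule clinear_compose)

lift_definition scaleC_endo :: "complex \<Rightarrow> 'a endo \<Rightarrow> 'a endo" is "\<lambda>c f x. c *\<^sub>C f x"
  by (rule clinearI) (simp_all add: clinearD scaleC_add_right scaleC_scaleC mult.commute)

instance
  by (standard; transfer)
     (simp_all add: fun_eq_iff scaleC_add_right scaleC_add_left scaleC_scaleC scaleC_one clinearD)

end

lemma clinear_endo_apply: "clinear (endo_apply e)"
  using endo_apply[of e] by simp

lemma endo_apply_Endo: "clinear f \<Longrightarrow> endo_apply (Endo f) = f"
  by (simp add: Endo_inverse)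

lemmas endo_apply_simps =
  zero_endo.rep_eq one_endo.rep_eq plus_endo.rep_eq uminus_endo.rep_eq minus_endo.rep_eq
  times_endo.rep_eq scaleC_endo.rep_eq

lemma clinear_endo_eval: "clinear (\<lambda>e. endo_apply e x)"
  by (rule clinearI) (simp_all add: endo_apply_simps)

lemma endo_tensor_eqI:
  fixes d e :: "('a::complex_vector, 'b::complex_vector) tensor endo"
  assumes "\<And>a b. endo_apply d (a \<otimes>\<^sub>C b) = endo_apply e (a \<otimes>\<^sub>C b)"
  shows "d = e"
  using clinear_tensor_eqI[OF clinear_endo_apply clinear_endo_apply assms]
  by (simp add: endo_apply_inject[symmetric] fun_eq_iff)

section \<open>Functionals and contractions\<close>

lemma clinear_dual_apply: "clinear (dual_apply \<phi>)"
  using dual_apply[of \<phi>] by simp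

lemma dual_apply_simps:
  "dual_apply \<phi> (x + y) = dual_apply \<phi> x + dual_apply \<phi> y"
  "dual_apply \<phi> (c *\<^sub>C x) = c * dual_apply \<phi> x"
  "dual_apply \<phi> 0 = 0"
  "dual_apply \<phi> (x - y) = dual_apply \<phi> x - dual_apply \<phi> y"
  "dual_apply 0 x = 0"
  "dual_apply (\<phi> + \<psi>) x = dual_apply \<phi> x + dual_apply \<psi> x"
  "dual_apply (\<phi> - \<psi>) x = dual_apply \<phi> x - dual_apply \<psi> x"
  "dual_apply (- \<phi>) x = - dual_apply \<phi> x"
  "dual_apply (c *\<^sub>C \<phi>) x = c * dual_apply \<phi> x"
  using clinearD[OF clinear_dual_apply]
  by (simp_all add: scaleC_complex_def zero_dual.rep_eq plus_dual.rep_eq minus_dual.rep_eq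
      uminus_dual.rep_eq scaleC_dual.rep_eq)

lemma dual_apply_uminus: "dual_apply \<phi> (- x) = - dual_apply \<phi> x"
  using dual_apply_simps(4)[of \<phi> 0 x] by (simp add: dual_apply_simps)

lemma dual_eqI: "(\<And>x. dual_apply \<phi> x = dual_apply \<psi> x) \<Longrightarrow> \<phi> = \<psi>"
  by (simp add: dual_apply_inject[symmetric] fun_eq_iff)

lemma dual_apply_functional: "clinear f \<Longrightarrow> dual_apply (functional f) = f"
  by (simp add: functional_inverse)

definition dual_pull :: "('a::complex_vector \<Rightarrow> 'b::complex_vector) \<Rightarrow> 'b dual \<Rightarrow> 'a dual"
  where "dual_pull f \<phi> = functional (\<lambda>x. dual_apply \<phi> (f x))"

lemma dual_apply_pull: "clinear f \<Longrightarrow> dual_apply (dual_pull f \<phi>) x = dual_apply \<phi> (f x)"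
  by (simp add: dual_pull_def dual_apply_functional clinear_compose clinear_dual_apply)

text \<open>The two-sided action of the algebra on its dual. The functional
  \<open>\<psi>(S^{-1}(a''')(-)a')\<close> in the product of the double is a shift of \<psi> by the
  inverse antipode of \<open>a'''\<close> on the left and by \<open>a'\<close> on the right.\<close>

definition dual_shift :: "'a::complex_algebra_1 \<Rightarrow> 'a \<Rightarrow> 'a dual \<Rightarrow> 'a dual"
  where "dual_shift a b \<phi> = functional (\<lambda>x. dual_apply \<phi> (a * x * b))"

lemma clinear_times: "clinear (\<lambda>x. a * x * b :: 'a::complex_algebra_1)"
  by (rule clinearI) (simp_all add: algebra_simps scaleC_ring_simps)

lemma dual_apply_shift: "dual_apply (dual_shift a b \<phi>) x = dual_apply \<phi> (a * x * b)"
  by (simp add: dual_shift_def dual_apply_functional clinear_compose[OF clinear_dual_apply clinear_times])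

definition contract :: "'a::complex_vector dual \<Rightarrow> ('a, 'b::complex_vector) tensor \<Rightarrow> 'b"
  where "contract \<phi> = tensor_lift (\<lambda>x q. dual_apply \<phi> x *\<^sub>C q)"

lemma cbilinear_contract: "cbilinear (\<lambda>x q. dual_apply \<phi> x *\<^sub>C q)"
  by (rule cbilinearI) (simp_all add: dual_apply_simps scaleC_add_left scaleC_add_right
      scaleC_scaleC mult.commute)

lemma clinear_contract: "clinear (contract \<phi>)"
  unfolding contract_def by (rule tensor_lift(1)[OF cbilinear_contract])

lemma contract_pure: "contract \<phi> (x \<otimes>\<^sub>C q) = dual_apply \<phi> x *\<^sub>C q"
  unfolding contract_def by (rule tensor_lift(2)[OF cbilinear_contract])

lemmas contract_simps = clinearD[OF clinear_contract] contract_pure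

lemma contract_post: "clinear f \<Longrightarrow> contract \<phi> (tensor_map (\<lambda>x. x) f t) = f (contract \<phi> t)"
  by (induction t rule: tensor_induct)
    (simp_all add: contract_simps clinearD tensor_map clinear_id clinearD[OF tensor_map(1)])

lemma contract_pull: "clinear f \<Longrightarrow> contract \<phi> (tensor_map f (\<lambda>x. x) t) = contract (dual_pull f \<phi>) t"
  by (induction t rule: tensor_induct)
    (simp_all add: contract_simps tensor_map clinear_id clinearD[OF tensor_map(1)] dual_apply_pull)

text \<open>Factors on the first leg move into the functional as shifts, factors on the second leg
  come out. This turns commutation rules for \<open>theta\<close> into commutation rules for
  \<open>dual_to_Q\<close>.\<close>

lemma contract_mult:
  fixes t :: "('a::complex_algebra_1, 'b::complex_algebra_1) tensor"
  shows "contract \<phi> ((a \<otimes>\<^sub>C q) * t * (b \<otimes>\<^sub>C r)) = q * contract (dual_shift a b \<phi>) t * r"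
  by (induction t rule: tensor_induct)
    (simp_all add: contract_simps distrib_left distrib_right times_pure_tensor dual_apply_shift
      mult_scaleC_left mult_scaleC_right)

lemma clinear_contract_left: "clinear (\<lambda>\<phi>. contract \<phi> t)"
proof (rule clinearI)
  show "contract (\<phi> + \<psi>) t = contract \<phi> t + contract \<psi> t" for \<phi> \<psi>
    by (induction t rule: tensor_induct)
      (simp_all add: contract_simps dual_apply_simps scaleC_add_left)
  show "contract (c *\<^sub>C \<phi>) t = c *\<^sub>C contract \<phi> t" for c \<phi>
    by (induction t rule: tensor_induct)
      (simp_all add: contract_simps dual_apply_simps scaleC_scaleC scaleC_add_right)
qed

section \<open>The Hopf algebra \<open>H(N)\<close>\<close>

abbreviation hk :: "'n H_algebra" where "hk \<equiv> gen H_k"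
abbreviation hf :: "'n \<Rightarrow> 'n H_algebra" where "hf i \<equiv> gen (H_f i)"

lemma presented_relator: "r \<in> relators \<Longrightarrow> abs_presented_algebra r = 0"
  unfolding zero_presented_algebra_def
  by (simp add: presented_algebra.abs_eq_iff two_sided_ideal.base)

lemma hk_hk: "hk * hk = (1 :: 'n H_algebra)"
proof -
  have "abs_presented_algebra (var H_k ^ 2 - 1 :: 'n H_gen free_algebra) = 0"
    by (rule presented_relator) (simp add: relators_H_gen_def)
  then show ?thesis
    by (simp add: gen.abs_eq times_presented_algebra.abs_eq one_presented_algebra.abs_eq
        power2_eq_square flip: minus_presented_algebra.abs_eq)
qed

lemma hf_hk: "hf i * hk = - (hk * hf i)"
proof -
  have "abs_presented_algebra (var (H_f i) * var H_k + var H_k * var (H_f i)) = 0"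
    by (rule presented_relator) (auto simp: relators_H_gen_def)
  then show ?thesis
    by (simp add: gen.abs_eq times_presented_algebra.abs_eq eq_neg_iff_add_eq_0
        flip: plus_presented_algebra.abs_eq)
qed

lemma hf_hf: "hf i * hf j = - (hf j * hf i)"
proof -
  have "abs_presented_algebra (var (H_f i) * var (H_f j) + var (H_f j) * var (H_f i)) = 0"
    by (rule presented_relator) (auto simp: relators_H_gen_def)
  then show ?thesis
    by (simp add: gen.abs_eq times_presented_algebra.abs_eq eq_neg_iff_add_eq_0
        flip: plus_presented_algebra.abs_eq)
qed

text \<open>Characteristic zero: an element that anticommutes with itself has square zero.\<close>

lemma self_eq_uminus: "x = - x \<longleftrightarrow> x = (0 :: 'a::complex_vector)"
proof
  assume "x = - x"
  then have "(2 :: complex) *\<^sub>C x = 0"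
    using scaleC_add_left[of 1 1 x] by (simp add: eq_neg_iff_add_eq_0)
  then show "x = 0" by simp
qed simp

lemma hf_sq: "hf i * hf i = 0"
  using hf_hf[of i i] by (simp add: self_eq_uminus)

text \<open>Once \<open>mult.assoc\<close> has nested products to the right, a rule for
  \<open>x * y\<close> no longer matches inside a longer product; this gives the form that
  does.\<close>

lemma left_assoc: "x * y = z \<Longrightarrow> x * (y * w) = z * (w :: 'a::semigroup_mult)"
  by (simp flip: mult.assoc)

lemma relators_H_cases:
  assumes "r \<in> (relators :: 'n H_gen free_algebra set)"
  obtains i j where "r = var (H_f i) * var (H_f j) + var (H_f j) * var (H_f i)"
  | i where "r = var (H_f i) * var H_k + var H_k * var (H_f i)"
  | "r = var H_k ^ 2 - 1"
  using assms by (auto simp: relators_H_gen_def)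

lemma H_hom:
  fixes v :: "'n H_gen \<Rightarrow> 'b::complex_algebra_1"
  assumes "v H_k * v H_k = 1" "\<And>i. v (H_f i) * v H_k = - (v H_k * v (H_f i))"
    "\<And>i j. v (H_f i) * v (H_f j) = - (v (H_f j) * v (H_f i))"
  shows "alg_hom (hom_extension v)" "hom_extension v (gen g) = v g"
proof -
  have rel: "v (H_f i) * v H_k + v H_k * v (H_f i) = 0"
    "v H_k * v (H_f i) + v (H_f i) * v H_k = 0"
    "v (H_f i) * v (H_f j) + v (H_f j) * v (H_f i) = 0" for i j
    using assms(2)[of i] assms(3)[of i j] by simp_all
  have kill: "free_eval v r = 0" if "r \<in> relators" for r
    using that
    by (cases rule: relators_H_cases)
      (simp_all add: rel free_eval_simps power2_eq_square assms(1))
  show "alg_hom (hom_extension v)" "hom_extension v (gen g) = v g"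
    by (rule hom_extension, erule kill)+
qed

text \<open>Each relator of \<open>H(N)\<close> is unchanged when its products are reversed, so the
  conditions are those of \<open>H_hom\<close>.\<close>

lemma H_antihom:
  fixes v :: "'n H_gen \<Rightarrow> 'b::complex_algebra_1"
  assumes "v H_k * v H_k = 1" "\<And>i. v (H_f i) * v H_k = - (v H_k * v (H_f i))"
    "\<And>i j. v (H_f i) * v (H_f j) = - (v (H_f j) * v (H_f i))"
  shows "alg_antihom (antihom_extension v)" "antihom_extension v (gen g) = v g"
proof -
  have rel: "v (H_f i) * v H_k + v H_k * v (H_f i) = 0"
    "v H_k * v (H_f i) + v (H_f i) * v H_k = 0"
    "v (H_f i) * v (H_f j) + v (H_f j) * v (H_f i) = 0" for i j
    using assms(2)[of i] assms(3)[of i j] by simp_all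
  have kill: "free_eval (\<lambda>g. Opposite (v g)) r = 0" if "r \<in> relators" for r
    using that
    by (cases rule: relators_H_cases)
      (simp_all add: rel free_eval_simps power2_eq_square assms(1) times_opposite_def
        plus_opposite_def minus_opposite_def one_opposite_def zero_opposite_def)
  show "alg_antihom (antihom_extension v)" "antihom_extension v (gen g) = v g"
    by (rule antihom_extension, erule kill)+
qed

lemma H_alg_hom_eqI:
  fixes f f' :: "'n H_algebra \<Rightarrow> 'b::complex_algebra_1"
  assumes "alg_hom f" "alg_hom f'" "f hk = f' hk" "\<And>i. f (hf i) = f' (hf i)"
  shows "f x = f' x"
proof (rule alg_hom_eqI[OF assms(1,2)])
  show "f (gen g) = f' (gen g)" for g
    by (cases g) (simp_all add: assms(3,4))
qed

lemma H_alg_antihom_eqI: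
  fixes f f' :: "'n H_algebra \<Rightarrow> 'b::complex_algebra_1"
  assumes "alg_antihom f" "alg_antihom f'" "f hk = f' hk" "\<And>i. f (hf i) = f' (hf i)"
  shows "f x = f' x"
proof (rule alg_antihom_eqI[OF assms(1,2)])
  show "f (gen g) = f' (gen g)" for g
    by (cases g) (simp_all add: assms(3,4))
qed

lemma H_hopf_simps [simp]: "amult H_hopf = (*)" "aunit H_hopf = 1"
  by (simp_all add: H_hopf_def Let_def)

lemma H_comult:
  shows alg_hom_H_comult: "alg_hom (comult (H_hopf :: 'n H_algebra hopf_structure))"
    and H_comult_k: "comult H_hopf (hk :: 'n H_algebra) = hk \<otimes>\<^sub>C hk"
    and H_comult_f: "comult H_hopf (hf (i :: 'n)) = hf i \<otimes>\<^sub>C hk + 1 \<otimes>\<^sub>C hf i"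
proof -
  define v :: "'n H_gen \<Rightarrow> ('n H_algebra, 'n H_algebra) tensor"
    where "v = case_H_gen (hk \<otimes>\<^sub>C hk) (\<lambda>i. hf i \<otimes>\<^sub>C hk + 1 \<otimes>\<^sub>C hf i)"
  have eq: "comult H_hopf = hom_extension v"
    by (simp add: H_hopf_def v_def Let_def)
  have ff: "v (H_f i) * v (H_f j) = - (v (H_f j) * v (H_f i))" for i j
    by (simp add: v_def times_pure_tensor hk_hk distrib_left distrib_right hf_hk hf_hf[of i j]
        pure_tensor_uminus_left pure_tensor_uminus_right)
  have "alg_hom (hom_extension v)" "hom_extension v (gen g) = v g" for g
    by (rule H_hom[where v = v, OF _ _ ff]; simp add: v_def times_pure_tensor hk_hk pure_tensor_one distrib_left
        distrib_right hf_hk pure_tensor_uminus_left pure_tensor_uminus_right)+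
  then show "alg_hom (comult (H_hopf :: 'n H_algebra hopf_structure))"
    "comult H_hopf (hk :: 'n H_algebra) = hk \<otimes>\<^sub>C hk"
    "comult H_hopf (hf i) = hf i \<otimes>\<^sub>C hk + 1 \<otimes>\<^sub>C hf i"
    by (simp_all add: eq v_def)
qed

lemma H_counit:
  shows alg_hom_H_counit: "alg_hom (counit (H_hopf :: 'n H_algebra hopf_structure))"
    and H_counit_k: "counit H_hopf (hk :: 'n H_algebra) = 1"
    and H_counit_f: "counit H_hopf (hf (i :: 'n)) = 0"
proof -
  define v :: "'n H_gen \<Rightarrow> complex" where "v = case_H_gen 1 (\<lambda>i. 0)"
  have eq: "counit H_hopf = hom_extension v"
    by (simp add: H_hopf_def v_def Let_def)
  have "alg_hom (hom_extension v)" "hom_extension v (gen g) = v g" for g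
    by (rule H_hom; simp add: v_def)+
  then show "alg_hom (counit (H_hopf :: 'n H_algebra hopf_structure))"
    "counit H_hopf (hk :: 'n H_algebra) = 1" "counit H_hopf (hf i) = 0"
    by (simp_all add: eq v_def)
qed

lemma H_antipode:
  shows alg_antihom_H_antipode: "alg_antihom (antipode (H_hopf :: 'n H_algebra hopf_structure))"
    and H_antipode_k: "antipode H_hopf (hk :: 'n H_algebra) = hk"
    and H_antipode_f: "antipode H_hopf (hf (i :: 'n)) = - (hf i * hk)"
proof -
  define v :: "'n H_gen \<Rightarrow> 'n H_algebra" where "v = case_H_gen hk (\<lambda>i. - (hf i * hk))"
  have eq: "antipode H_hopf = antihom_extension v"
    by (simp add: H_hopf_def v_def Let_def)
  have ff: "v (H_f i) * v (H_f j) = - (v (H_f j) * v (H_f i))" for i j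
    by (simp add: v_def hf_hk mult.assoc left_assoc[OF hf_hk] left_assoc[OF hk_hk] hf_hf[of i j])
  have "alg_antihom (antihom_extension v)" "antihom_extension v (gen g) = v g" for g
    by (rule H_antihom[where v = v, OF _ _ ff]; simp add: v_def hk_hk hf_hk mult.assoc left_assoc[OF hk_hk])+
  then show "alg_antihom (antipode (H_hopf :: 'n H_algebra hopf_structure))"
    "antipode H_hopf (hk :: 'n H_algebra) = hk" "antipode H_hopf (hf i) = - (hf i * hk)"
    by (simp_all add: eq v_def)
qed

text \<open>The square of the antipode sends each \<open>f_i\<close> to its negative, so the
  antipode is not its own inverse: the sign in its value at \<open>f_i\<close> has to be
  dropped.\<close>

definition antipode_inv :: "'n H_algebra \<Rightarrow> 'n H_algebra"
  where "antipode_inv = antihom_extension (case_H_gen hk (\<lambda>i. hf i * hk))"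

lemma antipode_inv:
  shows alg_antihom_antipode_inv: "alg_antihom (antipode_inv :: 'n H_algebra \<Rightarrow> 'n H_algebra)"
    and antipode_inv_k: "antipode_inv (hk :: 'n H_algebra) = hk"
    and antipode_inv_f: "antipode_inv (hf (i :: 'n)) = hf i * hk"
proof -
  define v :: "'n H_gen \<Rightarrow> 'n H_algebra" where "v = case_H_gen hk (\<lambda>i. hf i * hk)"
  have ff: "v (H_f i) * v (H_f j) = - (v (H_f j) * v (H_f i))" for i j
    by (simp add: v_def hf_hk mult.assoc left_assoc[OF hf_hk] left_assoc[OF hk_hk] hf_hf[of i j])
  have "alg_antihom (antihom_extension v)" "antihom_extension v (gen g) = v g" for g
    by (rule H_antihom[where v = v, OF _ _ ff]; simp add: v_def hk_hk hf_hk mult.assoc left_assoc[OF hk_hk])+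
  then show "alg_antihom (antipode_inv :: 'n H_algebra \<Rightarrow> 'n H_algebra)"
    "antipode_inv (hk :: 'n H_algebra) = hk" "antipode_inv (hf i) = hf i * hk"
    by (simp_all add: antipode_inv_def v_def)
qed

lemma antipode_antipode_inv: "antipode H_hopf (antipode_inv x) = x"
  by (rule H_alg_hom_eqI[OF alg_antihom_antihom_compose[OF alg_antihom_H_antipode alg_antihom_antipode_inv]
        alg_hom_id])
    (simp_all add: alg_antihomD[OF alg_antihom_H_antipode] H_antipode_k H_antipode_f antipode_inv_k antipode_inv_f
      alg_antihom_uminus[OF alg_antihom_H_antipode] hf_hk mult.assoc left_assoc[OF hk_hk])

lemma antipode_inv_antipode: "antipode_inv (antipode H_hopf x) = x"
  by (rule H_alg_hom_eqI[OF alg_antihom_antihom_compose[OF alg_antihom_antipode_inv alg_antihom_H_antipode]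
        alg_hom_id])
    (simp_all add: alg_antihomD[OF alg_antihom_antipode_inv] alg_antihom_uminus[OF alg_antihom_antipode_inv]
      H_antipode_k H_antipode_f antipode_inv_k antipode_inv_f hf_hk mult.assoc left_assoc[OF hk_hk])

lemma inv_antipode: "inv (antipode H_hopf) = antipode_inv"
  by (rule inv_equality) (simp_all add: antipode_antipode_inv antipode_inv_antipode)

subsection \<open>The functionals \<open>\<kappa>\<close> and \<open>G\<^sub>i\<close>\<close>

text \<open>Upper triangular two by two matrices. The corner entry of a product is
  \<open>a b' + b c'\<close>, so an algebra map into them has characters on the diagonal and a
  derivation twisted by these two characters in the corner.\<close>

datatype upper = Upper complex complex complex

instantiation upper :: complex_algebra_1
begin

fun plus_upper where "Upper a b c + Upper a' b' c' = Upper (a + a') (b + b') (c + c')"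
fun minus_upper where "Upper a b c - Upper a' b' c' = Upper (a - a') (b - b') (c - c')"
fun uminus_upper where "- Upper a b c = Upper (- a) (- b) (- c)"
fun times_upper where
  "Upper a b c * Upper a' b' c' = Upper (a * a') (a * b' + b * c') (c * c')"
fun scaleC_upper where "z *\<^sub>C Upper a b c = Upper (z * a) (z * b) (z * c)"
definition "0 = Upper 0 0 0"
definition "1 = Upper 1 0 1"

instance
proof
  fix a b c :: upper and z z' :: complex
  show "a + b + c = a + (b + c)" by (cases a; cases b; cases c) simp
  show "a + b = b + a" by (cases a; cases b) simp
  show "0 + a = a" by (cases a) (simp add: zero_upper_def)
  show "- a + a = 0" by (cases a) (simp add: zero_upper_def)
  show "a - b = a + - b" by (cases a; cases b) simp
  show "z *\<^sub>C (a + b) = z *\<^sub>C a + z *\<^sub>C b" by (cases a; cases b) (simp add: algebra_simps)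
  show "(z + z') *\<^sub>C a = z *\<^sub>C a + z' *\<^sub>C a" by (cases a) (simp add: algebra_simps)
  show "z *\<^sub>C z' *\<^sub>C a = (z * z') *\<^sub>C a" by (cases a) simp
  show "1 *\<^sub>C a = a" by (cases a) simp
  show "a * b * c = a * (b * c)" by (cases a; cases b; cases c) (simp add: algebra_simps)
  show "(a + b) * c = a * c + b * c" by (cases a; cases b; cases c) (simp add: algebra_simps)
  show "a * (b + c) = a * b + a * c" by (cases a; cases b; cases c) (simp add: algebra_simps)
  show "1 * a = a" "a * 1 = a" by (cases a; simp add: one_upper_def)+
  show "(z *\<^sub>C a) * b = z *\<^sub>C (a * b)" "a * (z *\<^sub>C b) = z *\<^sub>C (a * b)"
    by (cases a; cases b; simp add: algebra_simps)+
qed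

end

fun upper12 :: "upper \<Rightarrow> complex" where "upper12 (Upper a b c) = b"
fun upper11 :: "upper \<Rightarrow> complex" where "upper11 (Upper a b c) = a"
fun upper22 :: "upper \<Rightarrow> complex" where "upper22 (Upper a b c) = c"

lemma upper_times_simps:
  "upper11 (x * y) = upper11 x * upper11 y"
  "upper22 (x * y) = upper22 x * upper22 y"
  "upper12 (x * y) = upper11 x * upper12 y + upper12 x * upper22 y"
  by (cases x; cases y; simp)+

lemma clinear_upper: "clinear upper11" "clinear upper12" "clinear upper22"
proof -
  have "upper11 (x + y) = upper11 x + upper11 y" "upper12 (x + y) = upper12 x + upper12 y"
    "upper22 (x + y) = upper22 x + upper22 y" "upper11 (c *\<^sub>C x) = c *\<^sub>C upper11 x"
    "upper12 (c *\<^sub>C x) = c *\<^sub>C upper12 x" "upper22 (c *\<^sub>C x) = c *\<^sub>C upper22 x" for x y c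
    by (cases x; cases y; simp add: scaleC_complex_def)+
  then show "clinear upper11" "clinear upper12" "clinear upper22"
    by (simp_all add: clinearI)
qed

text \<open>Both \<open>G\<^sub>i\<close> and \<open>\<kappa>\<close> are matrix entries of the two-dimensional representation
  \<open>k \<mapsto> diag(1, -1)\<close>, \<open>f\<^sub>j \<mapsto> \<delta>\<^sub>i\<^sub>j E\<^sub>1\<^sub>2\<close>; the remaining entry is the counit.\<close>

definition upper_rep :: "'n \<Rightarrow> 'n H_algebra \<Rightarrow> upper" where
  "upper_rep i = hom_extension (case_H_gen (Upper 1 0 (- 1)) (\<lambda>j. Upper 0 (if i = j then 1 else 0) 0))"

text \<open>The lower right entry is the same for every index, as \<open>kappa_apply\<close> shows,
  so \<open>undefined\<close> is a safe choice.\<close>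

definition kappa :: "'n H_algebra dual" where
  "kappa = functional (\<lambda>x. upper22 (upper_rep undefined x))"

definition Gf :: "'n \<Rightarrow> 'n H_algebra dual" where
  "Gf i = functional (\<lambda>x. upper12 (upper_rep i x))"

definition eps :: "'n H_algebra dual" where
  "eps = dual_unit H_hopf"

lemma upper_rep:
  shows alg_hom_upper_rep: "alg_hom (upper_rep (i :: 'n))"
    and upper_rep_k: "upper_rep i hk = Upper 1 0 (- 1)"
    and upper_rep_f: "upper_rep i (hf j) = Upper 0 (if i = j then 1 else 0) 0"
proof -
  define v :: "'n H_gen \<Rightarrow> upper"
    where "v = case_H_gen (Upper 1 0 (- 1)) (\<lambda>j. Upper 0 (if i = j then 1 else 0) 0)"
  have "alg_hom (hom_extension v)" "hom_extension v (gen g) = v g" for g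
    by (rule H_hom; simp add: v_def one_upper_def)+
  then show "alg_hom (upper_rep (i :: 'n))" "upper_rep i hk = Upper 1 0 (- 1)"
    "upper_rep i (hf j) = Upper 0 (if i = j then 1 else 0) 0"
    by (simp_all add: upper_rep_def v_def)
qed

lemma alg_hom_upper: 
  "alg_hom (\<lambda>x. upper11 (upper_rep i x))" "alg_hom (\<lambda>x. upper22 (upper_rep i x))"
  by (rule alg_homI; simp add: clinear_compose[OF clinear_upper(1) alg_homD(1)[OF alg_hom_upper_rep]]
      clinear_compose[OF clinear_upper(3) alg_homD(1)[OF alg_hom_upper_rep]]
      alg_homD[OF alg_hom_upper_rep] upper_times_simps; simp add: one_upper_def)+

lemma kappa_apply: "dual_apply kappa x = upper22 (upper_rep i x)"
proof -
  have "dual_apply kappa x = upper22 (upper_rep undefined x)"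
    by (simp add: kappa_def dual_apply_functional
        clinear_compose[OF clinear_upper(3) alg_homD(1)[OF alg_hom_upper_rep]])
  also have "\<dots> = upper22 (upper_rep i x)"
    by (rule H_alg_hom_eqI[OF alg_hom_upper(2) alg_hom_upper(2)])
      (simp_all add: upper_rep_k upper_rep_f)
  finally show ?thesis .
qed

lemma eps_counit: "dual_apply eps x = counit H_hopf x"
  by (simp add: eps_def dual_unit_def dual_apply_functional alg_homD(1)[OF alg_hom_H_counit])

lemma eps_apply: "dual_apply eps x = upper11 (upper_rep i x)"
  unfolding eps_counit
  by (rule H_alg_hom_eqI[OF alg_hom_H_counit alg_hom_upper(1)])
    (simp_all add: upper_rep_k upper_rep_f H_counit_k H_counit_f)

lemma Gf_apply: "dual_apply (Gf i) x = upper12 (upper_rep i x)"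
  by (simp add: Gf_def dual_apply_functional
      clinear_compose[OF clinear_upper(2) alg_homD(1)[OF alg_hom_upper_rep]])

lemma alg_hom_kappa: "alg_hom (dual_apply kappa)"
  using alg_hom_upper(2) by (simp flip: kappa_apply)

lemma alg_hom_eps: "alg_hom (dual_apply eps)"
  using alg_hom_upper(1) by (simp flip: eps_apply)

lemma kappa_simps:
  fixes x y :: "'n H_algebra" and i :: 'n
  shows "dual_apply kappa (1 :: 'n H_algebra) = 1" "dual_apply kappa (hk :: 'n H_algebra) = - 1"
    "dual_apply kappa (hf i) = 0"
    "dual_apply kappa (x * y) = dual_apply kappa x * dual_apply kappa y"
  by (simp_all add: kappa_apply[where i = i] upper_rep_k upper_rep_f alg_homD[OF alg_hom_upper(2)])

lemma eps_simps:
  fixes x y :: "'n H_algebra" and i :: 'n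
  shows "dual_apply eps (1 :: 'n H_algebra) = 1" "dual_apply eps (hk :: 'n H_algebra) = 1"
    "dual_apply eps (hf i) = 0"
    "dual_apply eps (x * y) = dual_apply eps x * dual_apply eps y"
  by (simp_all add: eps_apply[where i = i] upper_rep_k upper_rep_f alg_homD[OF alg_hom_upper(1)])

text \<open>The product rule is that of a matrix corner. In the dual, whose coproduct reverses
  arguments, it reads \<Delta>(G) = G \<otimes> \<epsilon> + \<kappa> \<otimes> G, which is the
  pattern of \<Delta>(f^+) in \<open>Q\<close>.\<close>

lemma Gf_simps:
  "dual_apply (Gf i) 1 = 0" "dual_apply (Gf i) hk = 0"
  "dual_apply (Gf i) (hf j) = (if i = j then 1 else 0)"
  "dual_apply (Gf i) (x * y) =
    dual_apply eps x * dual_apply (Gf i) y + dual_apply (Gf i) x * dual_apply kappa y"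
  by (simp_all add: Gf_apply eps_apply[where i = i] kappa_apply[where i = i] upper_rep_k
      upper_rep_f alg_homD[OF alg_hom_upper_rep] upper_times_simps one_upper_def)

section \<open>The convolution algebra of \<open>H(N)\<close>\<close>

lemma alg_hom_contract:
  assumes "alg_hom (dual_apply \<chi>)"
  shows "alg_hom (contract \<chi>)"
  unfolding contract_def
  by (rule alg_hom_tensor_lift[OF cbilinear_contract])
    (simp_all add: alg_homD[OF assms] mult_scaleC_left mult_scaleC_right scaleC_scaleC mult.commute)

abbreviation H_delta :: "'n H_algebra \<Rightarrow> ('n H_algebra, 'n H_algebra) tensor"
  where "H_delta \<equiv> comult H_hopf"

abbreviation dm :: "'n H_algebra dual \<Rightarrow> 'n H_algebra dual \<Rightarrow> 'n H_algebra dual"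
  where "dm \<equiv> dual_mult H_hopf"

lemmas H_delta_simps = alg_homD[OF alg_hom_H_comult] H_comult_k H_comult_f

lemma cbilinear_dual_product: "cbilinear (\<lambda>x y. dual_apply \<phi> x * dual_apply \<psi> y)"
  by (rule cbilinearI) (simp_all add: dual_apply_simps algebra_simps scaleC_complex_def)

lemma dual_apply_contract:
  "dual_apply \<psi> (contract \<phi> t) = tensor_lift (\<lambda>x y. dual_apply \<phi> x * dual_apply \<psi> y) t"
  by (induction t rule: tensor_induct)
    (simp_all add: contract_simps dual_apply_simps clinearD[OF tensor_lift(1)[OF cbilinear_dual_product]]
      tensor_lift(2)[OF cbilinear_dual_product])

text \<open>Convolution by \<phi> is the transpose of the operator \<open>contract \<phi>\<close>
  after \<Delta>. Associativity and the action of \<kappa> and the \<open>G_i\<close> are read off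
  from these operators.\<close>

lemma dual_mult_apply: "dual_apply (dm \<phi> \<psi>) x = dual_apply \<psi> (contract \<phi> (H_delta x))"
proof -
  have "clinear (\<lambda>x. dual_apply \<psi> (contract \<phi> (H_delta x)))"
    by (intro clinear_compose[OF clinear_dual_apply] clinear_compose[OF clinear_contract]
        alg_homD(1)[OF alg_hom_H_comult])
  then show ?thesis
    by (simp add: dual_mult_def sweedler2_def[abs_def] dual_apply_contract dual_apply_functional)
qed

lemma cbilinear_dual_mult: "cbilinear dm"
  by (rule cbilinearI; rule dual_eqI)
    (simp_all add: dual_mult_apply dual_apply_simps clinearD[OF clinear_contract_left])

lemmas dual_mult_simps = clinearD[OF cbilinear_clinear(1)[OF cbilinear_dual_mult]]
  clinearD[OF cbilinear_clinear(2)[OF cbilinear_dual_mult]]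

lemma dual_mult_uminus: "dm (- \<phi>) \<psi> = - dm \<phi> \<psi>" "dm \<phi> (- \<psi>) = - dm \<phi> \<psi>"
  using dual_mult_simps(4)[of \<phi> 0 \<psi>] dual_mult_simps(8)[of 0 \<phi> \<psi>]
  by (simp_all add: dual_mult_simps)

lemma cbilinear_dual_shift: "cbilinear (\<lambda>a b. dual_shift a b \<phi>)" "clinear (dual_shift a b)"
  by (intro cbilinearI clinearI dual_eqI;
      simp add: dual_apply_shift dual_apply_simps algebra_simps scaleC_ring_simps)+

lemma dual_shift_one: "dual_shift 1 1 \<phi> = \<phi>"
  by (rule dual_eqI) (simp add: dual_apply_shift)

lemma contract_mult_right:
  fixes t :: "('a::complex_algebra_1, 'b::complex_algebra_1) tensor"
  shows "contract \<phi> (t * (b \<otimes>\<^sub>C r)) = contract (dual_shift 1 b \<phi>) t * r"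
  using contract_mult[of \<phi> 1 1 t b r] by (simp add: pure_tensor_one)

lemma contract_mult_left:
  fixes t :: "('a::complex_algebra_1, 'b::complex_algebra_1) tensor"
  shows "contract \<phi> ((a \<otimes>\<^sub>C q) * t) = q * contract (dual_shift a 1 \<phi>) t"
  using contract_mult[of \<phi> a q t 1 1] by (simp add: pure_tensor_one)

text \<open>As \<Delta> is multiplicative, generators act on a convolution through their coproduct:
  \<open>k\<close> as an automorphism, \<open>f_i\<close> as a twisted derivation.\<close>

lemma dual_mult_shift:
  "dual_shift 1 hk (dm \<phi> \<psi>) = dm (dual_shift 1 hk \<phi>) (dual_shift 1 hk \<psi>)"
  "dual_shift 1 (hf i) (dm \<phi> \<psi>) =
    dm (dual_shift 1 (hf i) \<phi>) (dual_shift 1 hk \<psi>) + dm \<phi> (dual_shift 1 (hf i) \<psi>)"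
  "dual_shift hk 1 (dm \<phi> \<psi>) = dm (dual_shift hk 1 \<phi>) (dual_shift hk 1 \<psi>)"
  "dual_shift (hf i) 1 (dm \<phi> \<psi>) =
    dm (dual_shift (hf i) 1 \<phi>) (dual_shift hk 1 \<psi>) + dm \<phi> (dual_shift (hf i) 1 \<psi>)"
  by (rule dual_eqI; simp add: dual_apply_shift dual_mult_apply H_delta_simps distrib_left
      distrib_right contract_simps contract_mult_right contract_mult_left dual_shift_one
      dual_apply_simps)+

lemma H_induct_right [case_names zero add scale one k f]:
  fixes x :: "'n H_algebra"
  assumes "P 0" "\<And>x y. P x \<Longrightarrow> P y \<Longrightarrow> P (x + y)" "\<And>c x. P x \<Longrightarrow> P (c *\<^sub>C x)" "P 1"
    "\<And>x. P x \<Longrightarrow> P (x * hk)" "\<And>i x. P x \<Longrightarrow> P (x * hf i)"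
  shows "P x"
proof (induction x rule: presented_induct_right)
  case (gen g x)
  then show ?case using assms by (cases g) auto
qed (use assms in auto)

text \<open>Stands in for a comparison on a basis. For products of \<kappa> and the
  \<open>G_i\<close> every shift is again a short expression of this kind, so the induction on words
  closes after a few rewrites.\<close>

lemma dual_eqI_right:
  fixes \<phi> \<psi> :: "'n H_algebra dual"
  assumes "dual_apply \<phi> 1 = dual_apply \<psi> 1"
    and "\<And>x. dual_apply \<phi> x = dual_apply \<psi> x \<Longrightarrow>
      dual_apply (dual_shift 1 hk \<phi>) x = dual_apply (dual_shift 1 hk \<psi>) x"
    and "\<And>i x. dual_apply \<phi> x = dual_apply \<psi> x \<Longrightarrow>
      dual_apply (dual_shift 1 (hf i) \<phi>) x = dual_apply (dual_shift 1 (hf i) \<psi>) x"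
  shows "\<phi> = \<psi>"
proof (rule dual_eqI)
  show "dual_apply \<phi> x = dual_apply \<psi> x" for x
    by (induction x rule: H_induct_right)
      (use assms in \<open>simp_all add: dual_apply_simps dual_apply_shift\<close>)
qed

lemma shift_one_right:
  "dual_shift 1 hk eps = eps" "dual_shift 1 (hf j) eps = 0"
  "dual_shift 1 hk kappa = - kappa" "dual_shift 1 (hf j) kappa = 0"
  "dual_shift 1 hk (Gf i) = - Gf i" "dual_shift 1 (hf j) (Gf i) = (if i = j then eps else 0)"
  by (intro dual_eqI; simp add: dual_apply_shift dual_apply_simps eps_simps kappa_simps Gf_simps)+

lemma dual_mult_apply_one: "dual_apply (dm \<phi> \<psi>) 1 = dual_apply \<phi> 1 * dual_apply \<psi> 1"
  by (simp add: dual_mult_apply H_delta_simps contract_simps dual_apply_simps flip: pure_tensor_one)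

lemma dual_mult_apply_right:
  "dual_apply (dm \<phi> \<psi>) (x * hk) = dual_apply (dm (dual_shift 1 hk \<phi>) (dual_shift 1 hk \<psi>)) x"
  "dual_apply (dm \<phi> \<psi>) (x * hf i) =
    dual_apply (dm (dual_shift 1 (hf i) \<phi>) (dual_shift 1 hk \<psi>)) x +
    dual_apply (dm \<phi> (dual_shift 1 (hf i) \<psi>)) x"
  using dual_apply_shift[of 1 hk "dm \<phi> \<psi>" x] dual_apply_shift[of 1 "hf i" "dm \<phi> \<psi>" x]
  by (simp_all add: dual_mult_shift dual_apply_simps)

lemma dual_mult_eps: "dm eps \<phi> = \<phi>" "dm \<phi> eps = \<phi>"
proof -
  have "dual_apply (dm eps \<phi>) x = dual_apply \<phi> x \<and> dual_apply (dm \<phi> eps) x = dual_apply \<phi> x" for x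
    by (induction x arbitrary: \<phi> rule: H_induct_right)
      (simp_all add: dual_apply_simps dual_mult_apply_one dual_mult_apply_right eps_simps
        shift_one_right dual_mult_simps dual_apply_shift)
  then show "dm eps \<phi> = \<phi>" "dm \<phi> eps = \<phi>"
    by (auto intro: dual_eqI)
qed

text \<open>Coassociativity of \<open>H(N)\<close> in contracted form. The functionals are
  generalised in the induction because appending a generator to \<open>x\<close> replaces them by
  their shifts.\<close>

lemma contract_dual_mult:
  "contract (dm \<phi> \<psi>) (H_delta x) = contract \<psi> (H_delta (contract \<phi> (H_delta x)))"
proof (induction x arbitrary: \<phi> \<psi> rule: H_induct_right)
  case one
  then show ?case
    by (simp add: H_delta_simps contract_simps dual_mult_apply_one scaleC_scaleC
        flip: pure_tensor_one)
qed (simp_all add: H_delta_simps contract_simps distrib_left contract_mult_right dual_mult_shift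
      dual_shift_one clinearD[OF clinear_contract_left] algebra_simps)

lemma dual_mult_assoc: "dm (dm \<phi> \<psi>) \<chi> = dm \<phi> (dm \<psi> \<chi>)"
  by (rule dual_eqI) (simp add: dual_mult_apply contract_dual_mult)

lemma kappa_kappa: "dm kappa kappa = eps"
  by (rule dual_eqI_right)
    (simp_all add: dual_mult_apply_one dual_mult_shift shift_one_right dual_mult_simps
      dual_mult_uminus kappa_simps eps_simps)

lemma Gf_kappa: "dm (Gf i) kappa = - dm kappa (Gf i)"
proof -
  have "dm (Gf i) kappa + dm kappa (Gf i) = 0"
    by (rule dual_eqI_right)
      (simp_all add: dual_mult_apply_one dual_mult_shift shift_one_right dual_mult_simps
        clinearD[OF cbilinear_dual_shift(2)]
        dual_mult_uminus kappa_simps eps_simps Gf_simps dual_mult_eps dual_apply_simps)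
  then show ?thesis by (simp add: eq_neg_iff_add_eq_0)
qed

lemma Gf_Gf: "dm (Gf i) (Gf j) = - dm (Gf j) (Gf i)"
proof -
  have "dm (Gf i) (Gf j) + dm (Gf j) (Gf i) = 0"
    by (rule dual_eqI_right)
      (simp_all add: dual_mult_apply_one dual_mult_shift shift_one_right dual_mult_simps
        clinearD[OF cbilinear_dual_shift(2)]
        dual_mult_uminus kappa_simps eps_simps Gf_simps dual_mult_eps dual_apply_simps)
  then show ?thesis by (simp add: eq_neg_iff_add_eq_0)
qed

section \<open>The regular representation of the Drinfeld double\<close>

type_synonym 'n double = "('n H_algebra dual, 'n H_algebra) tensor"

definition dual_op :: "'n H_algebra dual \<Rightarrow> 'n double endo"
  where "dual_op \<phi> = Endo (tensor_map (dm \<phi>) (\<lambda>a. a))"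

text \<open>One Sweedler summand of left multiplication by \<epsilon> \<otimes> a in the double, as
  an operator; \<open>H_op\<close> sums these summands over the iterated coproduct of
  \<open>a\<close>.\<close>

definition sandwich_op :: "'n H_algebra \<Rightarrow> 'n H_algebra \<Rightarrow> 'n H_algebra \<Rightarrow> 'n double endo"
  where "sandwich_op a1 a2 a3 = Endo (tensor_map (dual_shift (antipode_inv a3) a1) ((*) a2))"

definition H_op :: "'n H_algebra \<Rightarrow> 'n double endo"
  where "H_op = sweedler3 H_hopf sandwich_op"

lemma dual_op_apply: "endo_apply (dual_op \<phi>) (\<psi> \<otimes>\<^sub>C a) = dm \<phi> \<psi> \<otimes>\<^sub>C a"
  by (simp add: dual_op_def endo_apply_Endo
      tensor_map[OF cbilinear_clinear(1)[OF cbilinear_dual_mult] clinear_id])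

lemma sandwich_op_apply: "endo_apply (sandwich_op a1 a2 a3) (\<psi> \<otimes>\<^sub>C a) = dual_shift (antipode_inv a3) a1 \<psi> \<otimes>\<^sub>C (a2 * a)"
  by (simp add: sandwich_op_def endo_apply_Endo
      tensor_map[OF cbilinear_dual_shift(2) cbilinear_clinear(1)[OF cbilinear_times]])

lemma clinear_dual_op: "clinear dual_op"
  by (intro clinearI endo_tensor_eqI)
    (simp_all add: dual_op_apply endo_apply_simps dual_mult_simps pure_tensor_simps)

lemma dual_op_mult: "dual_op (dm \<phi> \<psi>) = dual_op \<phi> * dual_op \<psi>"
  by (rule endo_tensor_eqI) (simp add: dual_op_apply endo_apply_simps dual_mult_assoc)

lemma dual_op_eps: "dual_op eps = 1"
  by (rule endo_tensor_eqI) (simp add: dual_op_apply endo_apply_simps dual_mult_eps)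

lemma sandwich_op_linear:
  "cbilinear (\<lambda>a1 a2. sandwich_op a1 a2 a3)" "clinear (sandwich_op a1 a2)"
  by (intro cbilinearI clinearI endo_tensor_eqI;
      simp add: sandwich_op_apply endo_apply_simps cbilinearD[OF cbilinear_dual_shift(1)]
      alg_antihomD[OF alg_antihom_antipode_inv] pure_tensor_simps distrib_right mult_scaleC_left)+

text \<open>Left shifts compose in reversed order and the inverse antipode reverses products; the
  two reversals cancel.\<close>

lemma sandwich_op_mult: "sandwich_op (a * c) (b * d) (u * w) = sandwich_op a b u * sandwich_op c d w"
  by (rule endo_tensor_eqI)
    (auto simp: sandwich_op_apply endo_apply_simps alg_antihomD[OF alg_antihom_antipode_inv] mult.assoc
      dual_apply_shift intro!: arg_cong2[where f = pure_tensor] dual_eqI)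

lemma tensor_lift_cbilinear_param:
  assumes "\<And>z. cbilinear (\<lambda>x y. M x y z)" "\<And>x y. clinear (M x y)"
  shows "cbilinear (\<lambda>s z. tensor_lift (\<lambda>x y. M x y z) s)"
proof -
  note l = tensor_lift[OF assms(1)]
  define T where "T s z = tensor_lift (\<lambda>x y. M x y z) s" for s z
  have T: "T (s + t) z = T s z + T t z" "T 0 z = 0" "T (c *\<^sub>C s) z = c *\<^sub>C T s z"
    "T (x \<otimes>\<^sub>C y) z = M x y z" for s t z c x y
    using clinearD[OF l(1)] l(2) by (simp_all add: T_def)
  have "T s (z + z') = T s z + T s z'" "T s (c *\<^sub>C z) = c *\<^sub>C T s z" for s z z' c
    by (induction s rule: tensor_induct; simp add: T clinearD[OF assms(2)] scaleC_add_right)+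
  then show ?thesis
    by (intro cbilinearI) (simp_all add: T flip: T_def)
qed

lemma sweedler3_post:
  fixes H :: "('a::complex_vector, 'm) hopf_structure_scheme"
  assumes "clinear (comult H)" "clinear f"
    and M: "\<And>z. cbilinear (\<lambda>x y. M x y z)" "\<And>x y. clinear (M x y)"
  shows "f (sweedler3 H M a) = sweedler3 H (\<lambda>x y z. f (M x y z)) a"
proof -
  have b: "cbilinear (\<lambda>x z. tensor_lift (\<lambda>a1 a2. M a1 a2 z) (comult H x))"
    by (rule cbilinear_compose[OF tensor_lift_cbilinear_param[OF M] assms(1) clinear_id])
  show ?thesis
    by (simp add: sweedler3_def sweedler2_def tensor_lift_post[OF assms(2) b]
        tensor_lift_post[OF assms(2) M(1)])
qed

lemma H_op_bilinear: "cbilinear (\<lambda>x z. tensor_lift (\<lambda>a1 a2. sandwich_op a1 a2 z) (H_delta x))"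
  by (rule cbilinear_compose[OF tensor_lift_cbilinear_param[OF sandwich_op_linear]
        alg_homD(1)[OF alg_hom_H_comult] clinear_id])

text \<open>\<open>H_op\<close> is a composite of multiplicative maps: the coproduct twice, then
  \<open>sandwich_op\<close> on the three legs. Associativity in the double is not involved.\<close>

lemma alg_hom_H_op: "alg_hom (H_op :: 'n H_algebra \<Rightarrow> _)"
proof -
  define U :: "'n H_algebra \<Rightarrow> 'n H_algebra \<Rightarrow> 'n double endo"
    where "U x z = tensor_lift (\<lambda>a1 a2. sandwich_op a1 a2 z) (H_delta x)" for x z
  have "cbilinear U"
    unfolding U_def by (rule H_op_bilinear)
  moreover have "U (x * y) (z * w) = U x z * U y w" for x y z w
    unfolding U_def alg_homD[OF alg_hom_H_comult]
    by (rule tensor_lift_mult[OF sandwich_op_linear(1) sandwich_op_linear(1) sandwich_op_linear(1) sandwich_op_mult])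
  moreover have "sandwich_op 1 1 1 = (1 :: 'n double endo)"
    by (rule endo_tensor_eqI)
      (simp add: sandwich_op_apply endo_apply_simps alg_antihomD[OF alg_antihom_antipode_inv] dual_shift_one)
  then have "U 1 1 = 1"
    by (simp add: U_def H_delta_simps tensor_lift(2)[OF sandwich_op_linear(1)] flip: pure_tensor_one)
  ultimately have "alg_hom (\<lambda>a. tensor_lift U (H_delta a))"
    by (intro alg_hom_compose[OF alg_hom_tensor_lift alg_hom_H_comult])
  moreover have "H_op = (\<lambda>a. tensor_lift U (H_delta a))"
    by (simp add: fun_eq_iff H_op_def sweedler3_def sweedler2_def U_def[abs_def])
  ultimately show ?thesis by simp
qed

lemma H_op_k: "H_op hk = sandwich_op hk hk hk"
  by (simp add: H_op_def sweedler3_def sweedler2_def H_delta_simps tensor_lift(2)[OF H_op_bilinear]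
      tensor_lift(2)[OF sandwich_op_linear(1)])

lemma H_op_f: "H_op (hf i) = sandwich_op (hf i) hk hk + sandwich_op 1 (hf i) hk + sandwich_op 1 1 (hf i)"
  by (simp add: H_op_def sweedler3_def sweedler2_def H_delta_simps tensor_lift(2)[OF H_op_bilinear]
      tensor_lift(2)[OF sandwich_op_linear(1)] clinearD[OF tensor_lift(1)[OF H_op_bilinear]]
      clinearD[OF tensor_lift(1)[OF sandwich_op_linear(1)]] flip: pure_tensor_one)

lemma H_op_k_apply: "endo_apply (H_op hk) (\<psi> \<otimes>\<^sub>C a) = dual_shift hk hk \<psi> \<otimes>\<^sub>C (hk * a)"
  by (simp add: H_op_k sandwich_op_apply antipode_inv_k)

lemma H_op_f_apply:
  "endo_apply (H_op (hf i)) (\<psi> \<otimes>\<^sub>C a) = dual_shift hk (hf i) \<psi> \<otimes>\<^sub>C (hk * a) +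
    dual_shift hk 1 \<psi> \<otimes>\<^sub>C (hf i * a) + dual_shift (hf i * hk) 1 \<psi> \<otimes>\<^sub>C a"
  by (simp add: H_op_f sandwich_op_apply antipode_inv_k antipode_inv_f endo_apply_simps)

lemma dual_shift_comp: "dual_shift a b \<phi> = dual_shift 1 b (dual_shift a 1 \<phi>)"
  "dual_shift (a * c) 1 \<phi> = dual_shift c 1 (dual_shift a 1 \<phi>)"
  by (rule dual_eqI; simp add: dual_apply_shift mult.assoc)+

lemma dual_shift_hk_hk: "dual_shift hk 1 (dual_shift hk 1 \<phi>) = \<phi>"
  by (rule dual_eqI) (simp add: dual_apply_shift left_assoc[OF hk_hk] mult.assoc)

lemma H_op_k_dual_op: "H_op hk * dual_op \<psi> = dual_op (dual_shift hk hk \<psi>) * H_op hk"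
  by (rule endo_tensor_eqI)
    (simp add: endo_apply_simps H_op_k_apply dual_op_apply dual_shift_comp(1)[of hk hk] dual_mult_shift)

text \<open>The straightening rule of the double for \<open>f_i\<close>. The summands come from f
  \<otimes> k \<otimes> k, 1 \<otimes> f \<otimes> k and 1 \<otimes> 1 \<otimes> f: the outer legs
  shift \<psi>, with \<open>f_i * k\<close> as the inverse antipode of \<open>f_i\<close>, and the
  middle leg passes to the right.\<close>

lemma H_op_f_dual_op:
  "H_op (hf i) * dual_op \<psi> = dual_op (dual_shift hk (hf i) \<psi>) * H_op hk +
    dual_op (dual_shift hk 1 \<psi>) * H_op (hf i) + dual_op (dual_shift (hf i * hk) 1 \<psi>)"
  by (rule endo_tensor_eqI)
    (simp add: endo_apply_simps H_op_k_apply H_op_f_apply dual_op_apply dual_shift_comp(1)[of hk hk]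
      dual_shift_comp(1)[of hk "hf i"] dual_shift_comp(2) dual_mult_shift dual_shift_hk_hk
      clinearD[OF cbilinear_dual_shift(2)] pure_tensor_simps clinearD[OF clinear_endo_apply] ac_simps)

lemma shift_left:
  "dual_shift hk 1 kappa = - kappa" "dual_shift (hf j) 1 kappa = 0"
  "dual_shift hk 1 (Gf i) = Gf i" "dual_shift (hf j) 1 (Gf i) = (if i = j then kappa else 0)"
  by (intro dual_eqI; simp add: dual_apply_shift dual_apply_simps eps_simps kappa_simps Gf_simps)+

lemma dual_shift_uminus: "dual_shift a b (- \<phi>) = - dual_shift a b \<phi>"
  by (rule dual_eqI) (simp add: dual_apply_shift dual_apply_simps)

lemma dual_op_uminus: "dual_op (- \<phi>) = - dual_op \<phi>"
  using clinearD(4)[OF clinear_dual_op, of 0 \<phi>] by (simp add: clinearD[OF clinear_dual_op])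

lemma double_endo_relations:
  "H_op hk * dual_op kappa = dual_op kappa * H_op hk"
  "H_op hk * dual_op (Gf i) = - (dual_op (Gf i) * H_op hk)"
  "H_op (hf j) * dual_op kappa = - (dual_op kappa * H_op (hf j))"
  "H_op (hf j) * dual_op (Gf i) = dual_op (Gf i) * H_op (hf j) + (if i = j then H_op hk - dual_op kappa else 0)"
  "H_op hk * H_op hk = (1 :: 'n double endo)"
  "H_op (hf i) * H_op hk = - (H_op hk * H_op (hf i))"
  "H_op (hf i) * H_op (hf j) = - (H_op (hf j) * H_op (hf i))"
  "dual_op kappa * dual_op kappa = (1 :: 'n double endo)"
  "dual_op (Gf i) * dual_op kappa = - (dual_op kappa * dual_op (Gf i))"
  "dual_op (Gf i) * dual_op (Gf j) = - (dual_op (Gf j) * dual_op (Gf i))"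
  "dual_op (Gf i) * H_op hk = - (H_op hk * dual_op (Gf i))"
proof -
  note s = dual_shift_comp(1)[of hk hk] dual_shift_comp(1)[of hk "hf j"]
    dual_shift_comp(2) shift_left shift_one_right dual_shift_uminus dual_op_uminus
    clinearD[OF clinear_dual_op] clinearD[OF cbilinear_dual_shift(2)]
  show "H_op hk * dual_op kappa = dual_op kappa * H_op hk" "H_op hk * dual_op (Gf i) = - (dual_op (Gf i) * H_op hk)"
    "dual_op (Gf i) * H_op hk = - (H_op hk * dual_op (Gf i))"
    unfolding H_op_k_dual_op by (simp_all add: s)
  show "H_op (hf j) * dual_op kappa = - (dual_op kappa * H_op (hf j))"
    "H_op (hf j) * dual_op (Gf i) = dual_op (Gf i) * H_op (hf j) + (if i = j then H_op hk - dual_op kappa else 0)"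
    unfolding H_op_f_dual_op by (simp_all add: s dual_op_eps)
  show "H_op hk * H_op hk = (1 :: 'n double endo)"
    "H_op (hf i) * H_op hk = - (H_op hk * H_op (hf i))"
    "H_op (hf i) * H_op (hf j) = - (H_op (hf j) * H_op (hf i))"
    unfolding alg_homD(3)[OF alg_hom_H_op, symmetric]
    by (simp_all add: hk_hk hf_hk hf_hf[of i j] alg_homD[OF alg_hom_H_op]
        alg_hom_uminus[OF alg_hom_H_op])
  show "dual_op kappa * dual_op kappa = (1 :: 'n double endo)"
    "dual_op (Gf i) * dual_op kappa = - (dual_op kappa * dual_op (Gf i))"
    "dual_op (Gf i) * dual_op (Gf j) = - (dual_op (Gf j) * dual_op (Gf i))"
    unfolding dual_op_mult[symmetric]
    by (simp_all add: kappa_kappa dual_op_eps Gf_kappa Gf_Gf[of i j] dual_op_uminus)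
qed

lemma double_mult_pure:
  "double_mult H_hopf s t = tensor_lift (\<lambda>\<phi> a. endo_apply (dual_op \<phi> * H_op a) t) s"
proof -
  have shift: "functional (\<lambda>x. dual_apply \<psi> (amult H_hopf (amult H_hopf (inv (antipode H_hopf) a3) x) a1))
      = dual_shift (antipode_inv a3) a1 \<psi>" for \<psi> and a1 a3 :: "'a H_algebra"
    by (simp add: dual_shift_def inv_antipode)
  have inner: "sweedler3 H_hopf (\<lambda>a1 a2 a3. dm \<phi> (dual_shift (antipode_inv a3) a1 \<psi>) \<otimes>\<^sub>C amult H_hopf a2 b) a
      = endo_apply (dual_op \<phi> * H_op a) (\<psi> \<otimes>\<^sub>C b)" for \<phi> \<psi> and a b :: "'a H_algebra"
  proof -
    have "clinear (\<lambda>e. endo_apply (dual_op \<phi>) (endo_apply e (\<psi> \<otimes>\<^sub>C b)))"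
      by (rule clinear_compose[OF clinear_endo_apply clinear_endo_eval])
    from sweedler3_post[OF alg_homD(1)[OF alg_hom_H_comult] this sandwich_op_linear]
    show ?thesis
      by (simp add: H_op_def endo_apply_simps sandwich_op_apply dual_op_apply)
  qed
  have "tensor_lift (\<lambda>\<psi> b. endo_apply e (\<psi> \<otimes>\<^sub>C b)) t = endo_apply e t" for e :: "'a double endo"
    by (rule clinear_tensor_eqI[OF tensor_lift(1) clinear_endo_apply])
      (simp_all add: cbilinear_post[OF clinear_endo_apply cbilinear_pure_tensor] tensor_lift(2))
  then show ?thesis
    unfolding double_mult_def shift inner by simp
qed

lemma cbilinear_dual_op_H_op: "cbilinear (\<lambda>\<phi> a. endo_apply (dual_op \<phi> * H_op a) t)"
  by (rule cbilinear_post[OF clinear_endo_eval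
        cbilinear_compose[OF cbilinear_times clinear_dual_op alg_homD(1)[OF alg_hom_H_op]]])

lemma double_mult_pure_left:
  "double_mult H_hopf (\<phi> \<otimes>\<^sub>C a) t = endo_apply (dual_op \<phi> * H_op a) t"
  unfolding double_mult_pure by (rule tensor_lift(2)[OF cbilinear_dual_op_H_op])

lemma clinear_double_mult: "clinear (\<lambda>s. double_mult H_hopf s t)"
  unfolding double_mult_pure by (rule tensor_lift(1)[OF cbilinear_dual_op_H_op])

section \<open>A presentation of \<open>Q(N, \<beta>)\<close> adapted to the double\<close>

text \<open>The coefficients in \<open>K = coeff_m \<omega>\<^sub>- + coeff_p \<omega>\<^sub>+\<close>.\<close>

definition coeff_m :: complex where "coeff_m = (1 + \<i>) / 2"
definition coeff_p :: complex where "coeff_p = (1 - \<i>) / 2"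

lemma pc_coeff_p: "coeff_m * coeff_m = \<i> / 2" "coeff_p * coeff_p = - \<i> / 2" "coeff_m * coeff_p = 1 / 2" "coeff_p * coeff_m = 1 / 2"
  "coeff_m + coeff_p = 1" "coeff_p + coeff_m = 1" "coeff_m - coeff_p = \<i>" "coeff_p - coeff_m = - \<i>"
  by (simp_all add: coeff_m_def coeff_p_def field_simps)

text \<open>The factor \<open>-2\<close> in \<open>Qg\<close> cancels the one half in
  \<open>e_1\<close>: the commutator of \<open>Qb i\<close> and \<open>Qg i\<close> is twice the
  anticommutator of \<open>f^+\<close> and \<open>f^-\<close> times \<open>omega_m\<close>, that is
  \<open>(1 - K^2) * omega_m\<close>, which equals \<open>omega_m - omega_p\<close>.\<close>

definition Qb :: "'n \<Rightarrow> 'n Q_algebra" where "Qb i = gen (Q_fm i) * omega_m"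
definition Qg :: "'n \<Rightarrow> 'n Q_algebra" where "Qg i = (- 2) *\<^sub>C gen (Q_fp i)"

lemma scaleC_half_twice: "x + x = (2 :: complex) *\<^sub>C (x :: 'a::complex_vector)"
  using scaleC_add_left[of 1 1 x] by simp

lemma Q_relations_raw:
  fixes i j :: 'n
  shows "gen (Q_fp i) * gen Q_K = - (gen Q_K * gen (Q_fp i))"
  "gen (Q_fm i) * gen Q_K = - (gen Q_K * gen (Q_fm i))"
  "gen (Q_fp i) * gen (Q_fp j) = - (gen (Q_fp j) * gen (Q_fp i))"
  "gen (Q_fm i) * gen (Q_fm j) = - (gen (Q_fm j) * gen (Q_fm i))"
  "gen (Q_fp i) * gen (Q_fm j) + gen (Q_fm j) * gen (Q_fp i) = (if i = j then Q_e 1 else 0)"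
  "gen Q_K * gen Q_K * gen Q_K * gen Q_K = (1 :: 'n Q_algebra)"
proof -
  note abs = gen.abs_eq times_presented_algebra.abs_eq eq_neg_iff_add_eq_0
  have "abs_presented_algebra (var (Q_fp i) * var Q_K + var Q_K * var (Q_fp i)) = 0"
    by (rule presented_relator) (auto simp: relators_Q_gen_def Let_def)
  then show "gen (Q_fp i) * gen Q_K = - (gen Q_K * gen (Q_fp i))"
    by (simp add: abs flip: plus_presented_algebra.abs_eq)
  have "abs_presented_algebra (var (Q_fm i) * var Q_K + var Q_K * var (Q_fm i)) = 0"
    by (rule presented_relator) (auto simp: relators_Q_gen_def Let_def)
  then show "gen (Q_fm i) * gen Q_K = - (gen Q_K * gen (Q_fm i))"
    by (simp add: abs flip: plus_presented_algebra.abs_eq)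
  have "abs_presented_algebra (var (Q_fp i) * var (Q_fp j) + var (Q_fp j) * var (Q_fp i)) = 0"
    by (rule presented_relator) (auto simp: relators_Q_gen_def Let_def)
  then show "gen (Q_fp i) * gen (Q_fp j) = - (gen (Q_fp j) * gen (Q_fp i))"
    by (simp add: abs flip: plus_presented_algebra.abs_eq)
  have "abs_presented_algebra (var (Q_fm i) * var (Q_fm j) + var (Q_fm j) * var (Q_fm i)) = 0"
    by (rule presented_relator) (auto simp: relators_Q_gen_def Let_def)
  then show "gen (Q_fm i) * gen (Q_fm j) = - (gen (Q_fm j) * gen (Q_fm i))"
    by (simp add: abs flip: plus_presented_algebra.abs_eq)
  have e: "Q_e 1 = abs_presented_algebra ((1/2) *\<^sub>C (1 - var Q_K ^ 2) :: 'n Q_gen free_algebra)"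
    by (simp add: Q_e_def power2_eq_square gen.abs_eq times_presented_algebra.abs_eq
        one_presented_algebra.abs_eq minus_presented_algebra.abs_eq scaleC_presented_algebra.abs_eq)
  have "abs_presented_algebra (var (Q_fp i) * var (Q_fm j) + var (Q_fm j) * var (Q_fp i) -
      (if i = j then (1/2) *\<^sub>C (1 - var Q_K ^ 2) else 0)) = 0"
    by (rule presented_relator) (unfold relators_Q_gen_def Let_def, blast)
  then show "gen (Q_fp i) * gen (Q_fm j) + gen (Q_fm j) * gen (Q_fp i) = (if i = j then Q_e 1 else 0)"
    by (auto simp: abs e[unfolded One_nat_def] simp flip: plus_presented_algebra.abs_eq
        minus_presented_algebra.abs_eq zero_presented_algebra.abs_eq)
  have "abs_presented_algebra (var Q_K ^ 4 - 1 :: 'n Q_gen free_algebra) = 0"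
    by (rule presented_relator) (simp add: relators_Q_gen_def Let_def)
  then show "gen Q_K * gen Q_K * gen Q_K * gen Q_K = (1 :: 'n Q_algebra)"
    by (simp add: gen.abs_eq times_presented_algebra.abs_eq one_presented_algebra.abs_eq
        power4_eq_xxxx flip: minus_presented_algebra.abs_eq)
qed

lemma Q_e_split: "Q_e 0 + Q_e 1 = (1 :: 'n Q_algebra)"
  by (simp add: Q_e_def algebra_simps scaleC_half_twice scaleC_scaleC)

lemma omega_p_K: "omega_p = coeff_m *\<^sub>C gen Q_K + coeff_p *\<^sub>C (gen Q_K * gen Q_K * gen Q_K)"
  and omega_m_K: "omega_m = coeff_p *\<^sub>C gen Q_K + coeff_m *\<^sub>C (gen Q_K * gen Q_K * gen Q_K)"
proof -
  have half: "coeff_m = 1/2 + \<i> * (1/2)" "coeff_p = 1/2 - \<i> * (1/2)"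
    by (simp_all add: coeff_m_def coeff_p_def field_simps)
  show "omega_p = coeff_m *\<^sub>C gen Q_K + coeff_p *\<^sub>C (gen Q_K * gen Q_K * gen Q_K)"
    "omega_m = coeff_p *\<^sub>C gen Q_K + coeff_m *\<^sub>C (gen Q_K * gen Q_K * gen Q_K)"
    unfolding half omega_p_def omega_m_def
    by (simp_all add: Q_e_def power2_eq_square algebra_simps scaleC_ring_simps scaleC_add_left
        cvec.scale_left_diff_distrib)
qed

lemma omega_relations:
  "omega_m * omega_m = (1 :: 'n Q_algebra)" "omega_p * omega_p = (1 :: 'n Q_algebra)"
  "omega_p * omega_m = gen Q_K * (gen Q_K :: 'n Q_algebra)"
  "omega_m * omega_p = gen Q_K * (gen Q_K :: 'n Q_algebra)"
proof -
  define K :: "'n Q_algebra" where "K = gen Q_K"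
  have K4: "K * (K * (K * K)) = 1"
    using Q_relations_raw(6) by (simp add: K_def mult.assoc)
  \<comment> \<open>Products of combinations of \<open>K\<close> and \<open>K^3\<close> involve only
    \<open>K^2\<close> and 1, since \<open>K^6 = K^2\<close>. One formula serves all four products
    below.\<close>
  have *: "(a *\<^sub>C K + b *\<^sub>C (K * K * K)) * (c *\<^sub>C K + d *\<^sub>C (K * K * K)) =
      (a * c + b * d) *\<^sub>C (K * K) + (a * d + b * c) *\<^sub>C 1" for a b c d
    by (simp add: distrib_left distrib_right scaleC_ring_simps mult.assoc K4
        left_assoc[OF K4] scaleC_add_left add_ac mult.commute)
  show "omega_m * omega_m = (1 :: 'n Q_algebra)" "omega_p * omega_p = (1 :: 'n Q_algebra)"
    "omega_p * omega_m = gen Q_K * (gen Q_K :: 'n Q_algebra)"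
    "omega_m * omega_p = gen Q_K * (gen Q_K :: 'n Q_algebra)"
    unfolding omega_p_K omega_m_K K_def[symmetric] * by (simp_all add: pc_coeff_p)
qed

lemma Q_K_omega: "gen Q_K = coeff_m *\<^sub>C omega_m + coeff_p *\<^sub>C omega_p"
  by (simp add: omega_p_K omega_m_K scaleC_add_right scaleC_scaleC pc_coeff_p add_ac
      flip: scaleC_add_left)

lemma fp_omega: "gen (Q_fp i) * omega_p = - (omega_p * gen (Q_fp i))"
  "gen (Q_fp i) * omega_m = - (omega_m * gen (Q_fp i))"
  "gen (Q_fm i) * omega_p = - (omega_p * gen (Q_fm i))"
  "gen (Q_fm i) * omega_m = - (omega_m * gen (Q_fm i))"
  by (simp_all add: omega_p_K omega_m_K distrib_left distrib_right scaleC_ring_simps mult.assoc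
      Q_relations_raw left_assoc[OF Q_relations_raw(1)] left_assoc[OF Q_relations_raw(2)])

lemma Q_relations:
  fixes i j :: 'n
  shows "omega_m * omega_p = omega_p * (omega_m :: 'n Q_algebra)"
  "Qb i * omega_m = - (omega_m * Qb i)" "Qb i * omega_p = - (omega_p * Qb i)"
  "Qg i * omega_m = - (omega_m * Qg i)" "Qg i * omega_p = - (omega_p * Qg i)"
  "Qb i * Qb j = - (Qb j * Qb i)" "Qg i * Qg j = - (Qg j * Qg i)"
  "Qb i * Qg j = Qg j * Qb i + (if i = j then omega_m - omega_p else 0)"
proof -
  note simps = Qb_def Qg_def fp_omega left_assoc[OF fp_omega(1)] left_assoc[OF fp_omega(2)]
    left_assoc[OF fp_omega(3)] left_assoc[OF fp_omega(4)] scaleC_ring_simps mult.assoc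
  show c: "omega_m * omega_p = omega_p * (omega_m :: 'n Q_algebra)" by (simp add: omega_relations)
  show "Qb i * omega_m = - (omega_m * Qb i)" "Qg i * omega_m = - (omega_m * Qg i)"
    "Qg i * omega_p = - (omega_p * Qg i)"
    by (simp_all add: simps)
  show "Qb i * omega_p = - (omega_p * Qb i)"
    by (simp add: simps c) (simp add: c flip: mult.assoc)
  show "Qb i * Qb j = - (Qb j * Qb i)"
    by (simp add: simps Q_relations_raw(4)[of i j])
  show "Qg i * Qg j = - (Qg j * Qg i)"
    by (simp add: simps Q_relations_raw(3)[of i j])
  have "Qb i * Qg j - Qg j * Qb i =
      2 *\<^sub>C ((gen (Q_fp j) * gen (Q_fm i) + gen (Q_fm i) * gen (Q_fp j)) * omega_m)"
  proof -
    have "gen (Q_fm i) * (omega_m * gen (Q_fp j)) = - (gen (Q_fm i) * (gen (Q_fp j) * omega_m))"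
      by (simp add: fp_omega(2))
    then show ?thesis
      by (simp add: Qb_def Qg_def scaleC_ring_simps mult.assoc distrib_right)
  qed
  also have "\<dots> = (if i = j then omega_m - omega_p else 0)"
    by (simp add: Q_relations_raw(5) Q_e_def power2_eq_square scaleC_ring_simps left_diff_distrib
        omega_relations(3)[symmetric] mult.assoc omega_relations(1))
  finally show "Qb i * Qg j = Qg j * Qb i + (if i = j then omega_m - omega_p else 0)"
    by (simp add: algebra_simps)
qed

lemma Q_fm_Qb: "gen (Q_fm i) = Qb i * omega_m"
  by (simp add: Qb_def mult.assoc omega_relations)

lemma Q_fp_Qg: "gen (Q_fp i) = (- 1/2) *\<^sub>C Qg i"
  by (simp add: Qg_def)

lemma Q_induct [case_names zero add scale one mult m p b g]:
  fixes x :: "'n Q_algebra"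
  assumes "P 0" "\<And>x y. P x \<Longrightarrow> P y \<Longrightarrow> P (x + y)" "\<And>c x. P x \<Longrightarrow> P (c *\<^sub>C x)" "P 1"
    "\<And>x y. P x \<Longrightarrow> P y \<Longrightarrow> P (x * y)" "P omega_m" "P omega_p" "\<And>i. P (Qb i)" "\<And>i. P (Qg i)"
  shows "P x"
proof (induction x rule: presented_induct_mult)
  case (gen g)
  show ?case
    by (cases g; simp only: Q_K_omega Q_fm_Qb Q_fp_Qg; intro assms)
qed (use assms in auto)

text \<open>The change of generators solved for the original ones; \<open>f^-\<close> is
  \<open>Qb * omega_m\<close> because \<open>omega_m\<close> is an involution.\<close>

definition Q_values :: "'b::complex_algebra_1 \<Rightarrow> 'b \<Rightarrow> ('n \<Rightarrow> 'b) \<Rightarrow> ('n \<Rightarrow> 'b) \<Rightarrow> 'n Q_gen \<Rightarrow> 'b" where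
  "Q_values V W B G =
    case_Q_gen (coeff_m *\<^sub>C V + coeff_p *\<^sub>C W) (\<lambda>i. (- 1/2) *\<^sub>C G i) (\<lambda>i. B i * V)"

lemma relators_Q_cases:
  assumes "r \<in> (relators :: 'n Q_gen free_algebra set)"
  obtains i where "r = var (Q_fp i) * var Q_K + var Q_K * var (Q_fp i)"
  | i where "r = var (Q_fm i) * var Q_K + var Q_K * var (Q_fm i)"
  | i j where "r = var (Q_fp i) * var (Q_fm j) + var (Q_fm j) * var (Q_fp i) -
      (if i = j then (1/2) *\<^sub>C (1 - var Q_K ^ 2) else 0)"
  | i j where "r = var (Q_fp i) * var (Q_fp j) + var (Q_fp j) * var (Q_fp i)"
  | i j where "r = var (Q_fm i) * var (Q_fm j) + var (Q_fm j) * var (Q_fm i)"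
  | "r = var Q_K ^ 4 - 1"
  using assms by (auto simp only: relators_Q_gen_def Let_def)

text \<open>The relations in which the double and \<open>Q\<close> agree. Proving once that they
  imply the relations of \<open>Q\<close> yields, by interpretation, the action on the double and
  the coproduct, counit and antipode of \<open>Q\<close>.\<close>

locale double_relations =
  fixes V W :: "'b::complex_algebra_1" and B G :: "'n \<Rightarrow> 'b"
  assumes VV: "V * V = 1" and WW: "W * W = 1" and VW: "V * W = W * V"
    and BV: "B i * V = - (V * B i)" and BW: "B i * W = - (W * B i)"
    and GV: "G i * V = - (V * G i)" and GW: "G i * W = - (W * G i)"
    and BB: "B i * B j = - (B j * B i)" and GG: "G i * G j = - (G j * G i)"
    and BG: "B i * G j = G j * B i + (if i = j then V - W else 0)"
begin

lemmas VW_simps = mult.assoc VV WW left_assoc[OF VV] left_assoc[OF WW]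
  VW[symmetric] left_assoc[OF VW[symmetric]]

text \<open>The squares of the two coefficients are \<i>/2 and -\<i>/2 and cancel; the two mixed
  terms each contribute one half.\<close>

lemma K_sq: "(coeff_m *\<^sub>C V + coeff_p *\<^sub>C W) * (coeff_m *\<^sub>C V + coeff_p *\<^sub>C W) = V * W"
proof -
  have "(coeff_m *\<^sub>C V + coeff_p *\<^sub>C W) * (coeff_m *\<^sub>C V + coeff_p *\<^sub>C W) =
      (coeff_m * coeff_m) *\<^sub>C 1 + (coeff_m * coeff_p) *\<^sub>C (V * W) + ((coeff_p * coeff_m) *\<^sub>C (V * W) + (coeff_p * coeff_p) *\<^sub>C 1)"
    by (simp add: distrib_left distrib_right scaleC_ring_simps VV WW VW add_ac)
  also have "\<dots> = (coeff_m * coeff_m + coeff_p * coeff_p) *\<^sub>C 1 + (coeff_m * coeff_p + coeff_p * coeff_m) *\<^sub>C (V * W)"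
    by (simp only: scaleC_add_left add_ac)
  finally have "(coeff_m *\<^sub>C V + coeff_p *\<^sub>C W) * (coeff_m *\<^sub>C V + coeff_p *\<^sub>C W) =
      (coeff_m * coeff_m + coeff_p * coeff_p) *\<^sub>C 1 + (coeff_m * coeff_p + coeff_p * coeff_m) *\<^sub>C (V * W)" .
  then show ?thesis by (simp add: pc_coeff_p)
qed

lemma values_kill: "r \<in> relators \<Longrightarrow> free_eval (Q_values V W B G) r = 0"
proof -
  let ?u = "Q_values V W B G"
  let ?K = "coeff_m *\<^sub>C V + coeff_p *\<^sub>C W"
  have u: "?u Q_K = ?K" "?u (Q_fp i) = (- 1/2) *\<^sub>C G i" "?u (Q_fm i) = B i * V" for i
    by (simp_all add: Q_values_def)
  have fm: "B i * V * ?K = - (?K * (B i * V))" for i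
    by (simp add: distrib_left distrib_right scaleC_ring_simps VW_simps
        BV BW left_assoc[OF BW] left_assoc[OF BV])
  have fp: "G i * ?K = - (?K * G i)" for i
    by (simp add: distrib_left distrib_right scaleC_ring_simps GV GW)
  have fmfm: "B i * V * (B j * V) = - (B j * V * (B i * V))" for i j
    by (simp add: mult.assoc BV left_assoc[OF BV] left_assoc[OF VV] BB[of i j])
  \<comment> \<open>Moving \<open>V\<close> to the right past \<open>G i\<close> changes a sign, so
    the anticommutator becomes minus the commutator of \<open>B j\<close> and \<open>G i\<close>,
    times \<open>V\<close>.\<close>
  have fpfm: "G i * (B j * V) + B j * V * G i = (if i = j then - (1 - V * W) else 0)" for i j
  proof -
    have "V * G i = - (G i * V)" by (simp add: GV)
    then have "B j * V * G i = - (B j * G i * V)" by (simp add: mult.assoc)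
    then show ?thesis
      by (simp add: BG distrib_right mult.assoc left_diff_distrib VV flip: VW)
  qed
  have K4: "?K ^ 4 = 1"
  proof -
    have "?K ^ 4 = (?K * ?K) * (?K * ?K)" by (simp only: power4_eq_xxxx mult.assoc)
    then show ?thesis unfolding K_sq by (simp add: VW_simps)
  qed
  have K2: "?K ^ 2 = V * W"
    by (simp add: power2_eq_square K_sq)
  have rel: "?u (Q_fp i) * ?u (Q_fp j) + ?u (Q_fp j) * ?u (Q_fp i) = 0"
    "?u (Q_fm i) * ?u (Q_fm j) + ?u (Q_fm j) * ?u (Q_fm i) = 0"
    "?u (Q_fp i) * ?u Q_K + ?u Q_K * ?u (Q_fp i) = 0"
    "?u (Q_fm i) * ?u Q_K + ?u Q_K * ?u (Q_fm i) = 0"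
    "?u (Q_fp i) * ?u (Q_fm j) + ?u (Q_fm j) * ?u (Q_fp i) =
      (if i = j then (1/2) *\<^sub>C (1 - V * W) else 0)" for i j
  proof -
    have "G i * (B j * V) + B j * V * G i = - (if i = j then 1 - V * W else 0)"
      using fpfm[of i j] by simp
    from arg_cong[OF this, of "\<lambda>x. (- 1/2) *\<^sub>C x"]
    show "?u (Q_fp i) * ?u (Q_fm j) + ?u (Q_fm j) * ?u (Q_fp i) =
        (if i = j then (1/2) *\<^sub>C (1 - V * W) else 0)"
      by (simp add: u scaleC_ring_simps)
  qed (simp_all add: u fm fmfm[of i j] fp GG[of i j] scaleC_ring_simps)
  assume "r \<in> relators"
  then show ?thesis
    by (cases rule: relators_Q_cases)
      (auto simp: free_eval_simps rel u(1)[symmetric] K4[folded u(1)] K2[folded u(1)])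
qed

abbreviation "ext \<equiv> hom_extension (Q_values V W B G)"

lemma alg_hom_ext: "alg_hom ext"
  by (rule hom_extension, erule values_kill)

lemma ext_gen: "ext (gen Q_K) = coeff_m *\<^sub>C V + coeff_p *\<^sub>C W" "ext (gen (Q_fp i)) = (- 1/2) *\<^sub>C G i"
  "ext (gen (Q_fm i)) = B i * V"
  by (subst hom_extension(2), erule values_kill, simp add: Q_values_def)+

lemma ext_simps: "ext omega_m = V" "ext omega_p = W" "ext (Qb i) = B i" "ext (Qg i) = G i"
proof -
  let ?K = "coeff_m *\<^sub>C V + coeff_p *\<^sub>C W"
  have K3: "?K * ?K * ?K = coeff_p *\<^sub>C V + coeff_m *\<^sub>C W"
    unfolding K_sq by (simp add: distrib_left scaleC_ring_simps VW_simps add.commute)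
  have *: "a *\<^sub>C ?K + b *\<^sub>C (?K * ?K * ?K) = (a * coeff_m + b * coeff_p) *\<^sub>C V + (a * coeff_p + b * coeff_m) *\<^sub>C W" for a b
    unfolding K3 by (simp add: scaleC_add_right scaleC_scaleC scaleC_add_left add_ac)
  show m: "ext omega_m = V" and "ext omega_p = W"
    unfolding omega_m_K omega_p_K alg_homD[OF alg_hom_ext] ext_gen *
    by (simp_all add: pc_coeff_p)
  show "ext (Qb i) = B i"
    by (simp add: Qb_def alg_homD[OF alg_hom_ext] ext_gen m mult.assoc VV)
  show "ext (Qg i) = G i"
    unfolding Qg_def alg_homD(5)[OF alg_hom_ext] ext_gen by (simp add: scaleC_scaleC)
qed

end

interpretation double_endo: double_relations "H_op hk" "dual_op kappa" "\<lambda>i. H_op (hf i)" "\<lambda>i. dual_op (Gf i)"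
  by unfold_locales (rule double_endo_relations | auto simp: double_endo_relations(4))+

section \<open>The canonical element\<close>

text \<open>\<open>theta\<close> represents \<open>\<Sum> b \<otimes> b\<^sup>*\<close>, as \<open>rho_contract_theta\<close> shows; its product form makes
  a basis of \<open>H\<close> unnecessary for the algebra isomorphism.\<close>

definition theta0 :: "('n H_algebra, 'n Q_algebra) tensor" where
  "theta0 = (1/2) *\<^sub>C (1 \<otimes>\<^sub>C 1 + 1 \<otimes>\<^sub>C omega_p + hk \<otimes>\<^sub>C 1 - hk \<otimes>\<^sub>C omega_p)"

definition theta1 :: "'n \<Rightarrow> ('n H_algebra, 'n Q_algebra) tensor" where
  "theta1 j = 1 + hf j \<otimes>\<^sub>C Qg j"

text \<open>Partial products, so that \<open>rho_contract_theta\<close> can proceed by adding one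
  factor at a time.\<close>

definition theta_list :: "'n list \<Rightarrow> ('n H_algebra, 'n Q_algebra) tensor" where
  "theta_list xs = theta0 * prod_list (map theta1 xs)"

definition theta :: "('n::{finite, linorder} H_algebra, 'n Q_algebra) tensor" where
  "theta = theta_list (sorted_list_of_set UNIV)"

lemma commute_prod_list:
  fixes x :: "'a::monoid_mult"
  assumes "\<And>j. j \<in> set xs \<Longrightarrow> x * r j = r j * x"
  shows "x * prod_list (map r xs) = prod_list (map r xs) * x"
  using assms
proof (induction xs)
  case (Cons j xs)
  have "x * (r j * prod_list (map r xs)) = r j * (x * prod_list (map r xs))"
    using Cons.prems[of j] by (simp flip: mult.assoc)
  with Cons show ?case by (simp add: mult.assoc)
qed simp

text \<open>The factor with index \<open>i\<close> converts \<open>x\<close> into \<open>y\<close>,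
  all other factors commute with both, and distinctness makes the conversion happen exactly
  once.\<close>

lemma intertwine_prod_list:
  fixes x y :: "'a::monoid_mult"
  assumes "distinct xs" "i \<in> set xs" "x * r i = r i * y"
    and "\<And>j. j \<noteq> i \<Longrightarrow> x * r j = r j * x" "\<And>j. j \<noteq> i \<Longrightarrow> y * r j = r j * y"
  shows "x * prod_list (map r xs) = prod_list (map r xs) * y"
  using assms(1,2)
proof (induction xs)
  case (Cons j xs)
  show ?case
  proof (cases "j = i")
    case True
    then have "y * prod_list (map r xs) = prod_list (map r xs) * y"
      using Cons.prems by (intro commute_prod_list assms(5)) auto
    then show ?thesis using True by (simp add: left_assoc[OF assms(3)] mult.assoc)
  next
    case False
    then show ?thesis using Cons by (simp add: left_assoc[OF assms(4)] mult.assoc)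
  qed
qed simp

lemmas tensor_ring_simps = distrib_left distrib_right left_diff_distrib right_diff_distrib
  times_pure_tensor scaleC_ring_simps cvec.scale_right_diff_distrib cvec.scale_minus_right pure_tensor_uminus_left pure_tensor_uminus_right

text \<open>\<open>theta0\<close> is (1+k)/2 \<otimes> 1 + (1-k)/2 \<otimes> \<omega>, where
  \<omega> is \<open>omega_p\<close>. Moving \<open>x\<close> past \<omega> negates the second
  summand, and so does multiplying the first leg by \<open>k\<close>.\<close>

lemma theta0_right:
  assumes "x * omega_p = - (omega_p * x)"
  shows "theta0 * (1 \<otimes>\<^sub>C x) = (hk \<otimes>\<^sub>C x) * theta0"
  by (simp add: theta0_def tensor_ring_simps assms hk_hk)

text \<open>Moving \<open>f_i\<close> past \<open>k\<close> exchanges the idempotents (1+k)/2 and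
  (1-k)/2; a factor \<open>omega_p\<close> on the second leg exchanges them back.\<close>

lemma theta0_f:
  assumes "x * omega_p = omega_p * x"
  shows "(hf i \<otimes>\<^sub>C x) * theta0 = theta0 * (hf i \<otimes>\<^sub>C (omega_p * x))"
  by (simp add: theta0_def tensor_ring_simps assms hf_hk omega_relations
      left_assoc[OF omega_relations(2)])

lemma theta0_k:
  assumes "x * omega_p = omega_p * x"
  shows "(hk \<otimes>\<^sub>C x) * theta0 = theta0 * (hk \<otimes>\<^sub>C x)"
  by (simp add: theta0_def tensor_ring_simps assms)

lemma theta_m: "(hk \<otimes>\<^sub>C omega_m) * theta_list xs = theta_list xs * (hk \<otimes>\<^sub>C omega_m)"
proof -
  have "(hk \<otimes>\<^sub>C omega_m) * prod_list (map theta1 xs) = prod_list (map theta1 xs) * (hk \<otimes>\<^sub>C omega_m)"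
    by (rule commute_prod_list) (simp add: theta1_def tensor_ring_simps hf_hk Q_relations)
  then show ?thesis
    by (simp add: theta_list_def left_assoc[OF theta0_k[OF Q_relations(1)]] mult.assoc)
qed

text \<open>This is \<open>R \<Delta>(f\<^sub>i) = \<Delta>\<^sup>o\<^sup>p(f\<^sub>i) R\<close>. Passing \<open>theta0\<close> leaves \<open>\<omega>\<^sub>+\<close> in the place of \<open>\<omega>\<^sub>-\<close>; the factor with index
  \<open>i\<close> exchanges the two.\<close>

lemma theta_b:
  assumes "distinct xs" "i \<in> set xs"
  shows "(hk \<otimes>\<^sub>C Qb i + hf i \<otimes>\<^sub>C 1) * theta_list xs =
    theta_list xs * (hf i \<otimes>\<^sub>C omega_m + 1 \<otimes>\<^sub>C Qb i)"
proof -
  have theta0: "(hk \<otimes>\<^sub>C Qb i + hf i \<otimes>\<^sub>C 1) * theta0 = theta0 * (1 \<otimes>\<^sub>C Qb i + hf i \<otimes>\<^sub>C omega_p)"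
    using theta0_right[OF Q_relations(3)[of i]] theta0_f[of 1 i]
    by (simp add: distrib_left distrib_right)
  have "(1 \<otimes>\<^sub>C Qb i + hf i \<otimes>\<^sub>C omega_p) * prod_list (map theta1 xs) =
      prod_list (map theta1 xs) * (hf i \<otimes>\<^sub>C omega_m + 1 \<otimes>\<^sub>C Qb i)"
  proof (rule intertwine_prod_list[OF assms])
    show "(1 \<otimes>\<^sub>C Qb i + hf i \<otimes>\<^sub>C omega_p) * theta1 i = theta1 i * (hf i \<otimes>\<^sub>C omega_m + 1 \<otimes>\<^sub>C Qb i)"
      by (simp add: theta1_def tensor_ring_simps hf_sq Q_relations(8) pure_tensor_add_right
          pure_tensor_diff_right algebra_simps)
    show "(1 \<otimes>\<^sub>C Qb i + hf i \<otimes>\<^sub>C omega_p) * theta1 j = theta1 j * (1 \<otimes>\<^sub>C Qb i + hf i \<otimes>\<^sub>C omega_p)"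
      "(hf i \<otimes>\<^sub>C omega_m + 1 \<otimes>\<^sub>C Qb i) * theta1 j = theta1 j * (hf i \<otimes>\<^sub>C omega_m + 1 \<otimes>\<^sub>C Qb i)"
      if "j \<noteq> i" for j
      using that by (simp_all add: theta1_def tensor_ring_simps hf_hf[of i j] Q_relations(8)
          Q_relations(4,5) algebra_simps)
  qed
  then show ?thesis
    by (simp add: theta_list_def left_assoc[OF theta0] mult.assoc)
qed

text \<open>The transpose of left convolution by \<kappa>; \<open>G_deriv\<close> is the
  corresponding operator for \<open>G_i\<close>. Through \<open>contract_pull\<close> they describe
  how left multiplication in the dual acts on the first leg of \<open>theta\<close>.\<close>

definition kappa_twist :: "'n H_algebra \<Rightarrow> 'n H_algebra" where
  "kappa_twist x = contract kappa (H_delta x)"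

definition G_deriv :: "'n \<Rightarrow> 'n H_algebra \<Rightarrow> 'n H_algebra" where
  "G_deriv i x = contract (Gf i) (H_delta x)"

lemma alg_hom_kappa_twist: "alg_hom kappa_twist"
  unfolding kappa_twist_def
  by (rule alg_hom_compose[OF alg_hom_contract[OF alg_hom_kappa] alg_hom_H_comult])

lemma kappa_twist_simps: "kappa_twist hk = - hk" "kappa_twist (hf j) = hf j"
  by (simp_all add: kappa_twist_def H_comult_k H_comult_f contract_simps kappa_simps)

lemma contract_eps_delta: "contract eps (H_delta x) = x"
  by (rule H_alg_hom_eqI[OF alg_hom_compose[OF alg_hom_contract[OF alg_hom_eps] alg_hom_H_comult]
        alg_hom_id])
    (simp_all add: H_comult_k H_comult_f contract_simps eps_simps)

lemma contract_Gf_mult: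
  "contract (Gf i) (s * t) = contract eps s * contract (Gf i) t + contract (Gf i) s * contract kappa t"
proof (induction s rule: tensor_induct)
  case (add s a b)
  have "contract (Gf i) ((a \<otimes>\<^sub>C b) * t) = contract eps (a \<otimes>\<^sub>C b) * contract (Gf i) t +
      contract (Gf i) (a \<otimes>\<^sub>C b) * contract kappa t"
    by (induction t rule: tensor_induct)
      (simp_all add: contract_simps times_pure_tensor distrib_left Gf_simps scaleC_add_left
        scaleC_ring_simps mult.commute)
  with add show ?case by (simp add: distrib_right contract_simps)
qed (simp add: contract_simps)

lemma clinear_G_deriv: "clinear (G_deriv i)"
  unfolding G_deriv_def
  by (rule clinear_compose[OF clinear_contract alg_homD(1)[OF alg_hom_H_comult]])

text \<open>The product rule of \<open>G_i\<close>, transposed: its left character \<epsilon> leaves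
  \<open>x\<close> alone and its right character \<kappa> twists \<open>y\<close>.\<close>

lemma G_deriv_mult: "G_deriv i (x * y) = x * G_deriv i y + G_deriv i x * kappa_twist y"
  by (simp add: G_deriv_def kappa_twist_def H_delta_simps contract_Gf_mult contract_eps_delta)

lemma G_deriv_simps: "G_deriv i 1 = 0" "G_deriv i hk = 0" "G_deriv i (hf j) = (if i = j then hk else 0)"
  by (simp_all add: G_deriv_def H_delta_simps contract_simps Gf_simps flip: pure_tensor_one)

lemma tensor_map_G_deriv_mult:
  "tensor_map (G_deriv i) (\<lambda>q. q) (s * t) = s * tensor_map (G_deriv i) (\<lambda>q. q) t +
    tensor_map (G_deriv i) (\<lambda>q. q) s * tensor_map kappa_twist (\<lambda>q. q) t"
proof (induction s rule: tensor_induct)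
  note l = tensor_map[OF clinear_G_deriv clinear_id] tensor_map[OF alg_homD(1)[OF alg_hom_kappa_twist] clinear_id]
  note l = l clinearD[OF l(1)] clinearD[OF l(3)]
  case zero
  show ?case by (simp add: l)
  case (add s a b)
  have "tensor_map (G_deriv i) (\<lambda>q. q) ((a \<otimes>\<^sub>C b) * t) =
      (a \<otimes>\<^sub>C b) * tensor_map (G_deriv i) (\<lambda>q. q) t +
      tensor_map (G_deriv i) (\<lambda>q. q) (a \<otimes>\<^sub>C b) * tensor_map kappa_twist (\<lambda>q. q) t"
    by (induction t rule: tensor_induct)
      (simp_all add: l times_pure_tensor distrib_left G_deriv_mult pure_tensor_simps)
  with add show ?case by (simp add: l distrib_right)
qed

lemma alg_hom_kappa_twist_map: "alg_hom (tensor_map kappa_twist (\<lambda>q :: 'a::complex_algebra_1. q))"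
  by (rule alg_hom_tensor_map[OF alg_hom_kappa_twist alg_hom_id])

lemmas kappa_twist_map = alg_homD[OF alg_hom_kappa_twist_map]
  tensor_map(2)[OF alg_homD(1)[OF alg_hom_kappa_twist] clinear_id]

lemma kappa_twist_theta1: "tensor_map kappa_twist (\<lambda>q. q) (theta1 j) = theta1 j"
  by (simp add: theta1_def kappa_twist_map kappa_twist_simps)

lemma kappa_twist_theta1_prod:
  "tensor_map kappa_twist (\<lambda>q. q) (prod_list (map theta1 xs)) = prod_list (map theta1 xs)"
  by (induction xs) (simp_all add: kappa_twist_map kappa_twist_theta1)

text \<open>The twist fixes every \<open>f_j\<close>, hence every \<open>theta1\<close>. On
  \<open>theta0\<close> it sends \<open>k\<close> to \<open>-k\<close> and exchanges the two
  idempotents, which is also the effect of \<open>omega_p\<close> on the second leg.\<close>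

lemma theta_p:
  fixes xs :: "'n list"
  shows "tensor_map kappa_twist (\<lambda>q. q) (theta_list xs) = (1 \<otimes>\<^sub>C omega_p) * theta_list xs"
proof -
  have "tensor_map kappa_twist (\<lambda>q. q) (theta0 :: ('n H_algebra, 'n Q_algebra) tensor) =
      (1 \<otimes>\<^sub>C omega_p) * theta0"
    by (simp add: theta0_def kappa_twist_map kappa_twist_simps alg_homD[OF alg_hom_kappa_twist]
        tensor_ring_simps omega_relations algebra_simps)
  then show ?thesis
    by (simp add: theta_list_def kappa_twist_map kappa_twist_theta1_prod mult.assoc)
qed

text \<open>Only the factor with index \<open>i\<close> has a nonzero derivative, k \<otimes> g,
  where g is \<open>Qg i\<close>. As \<open>g^2 = 0\<close>, the lost factor can be put back beside
  k \<otimes> g without any change, and the full product reappears.\<close>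

lemma theta_g:
  assumes "distinct xs" "i \<in> set xs"
  shows "tensor_map (G_deriv i) (\<lambda>q. q) (theta_list xs) = (1 \<otimes>\<^sub>C Qg i) * theta_list xs"
proof -
  let ?D = "tensor_map (G_deriv i) (\<lambda>q :: 'a Q_algebra. q)"
  note D = clinearD[OF tensor_map(1)[OF clinear_G_deriv clinear_id]]
    tensor_map(2)[OF clinear_G_deriv clinear_id]
  have D1: "?D 1 = 0"
    by (simp add: D G_deriv_simps flip: pure_tensor_one)
  have D0: "?D theta0 = 0"
    by (simp add: theta0_def D G_deriv_simps)
  have step: "?D (theta1 j) = (if i = j then hk \<otimes>\<^sub>C Qg i else 0)" for j
    by (simp add: theta1_def D G_deriv_simps D1)
  have "?D (prod_list (map theta1 xs)) =
      (if i \<in> set xs then (hk \<otimes>\<^sub>C Qg i) * prod_list (map theta1 xs) else 0)"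
    using assms(1)
  proof (induction xs)
    case (Cons j xs)
    show ?case
    proof (cases "i = j")
      case True
      have g: "(hk \<otimes>\<^sub>C Qg i) * theta1 i = hk \<otimes>\<^sub>C Qg i"
        using Q_relations(7)[of i i]
        by (simp add: theta1_def tensor_ring_simps self_eq_uminus)
      with Cons show ?thesis
        by (simp add: tensor_map_G_deriv_mult kappa_twist_theta1_prod step left_assoc[OF g] flip: True)
    next
      case False
      have g: "(hk \<otimes>\<^sub>C Qg i) * theta1 j = theta1 j * (hk \<otimes>\<^sub>C Qg i)"
        by (simp add: theta1_def tensor_ring_simps hf_hk Q_relations(7)[of i j])
      with False Cons show ?thesis
        by (simp add: tensor_map_G_deriv_mult kappa_twist_theta1_prod step left_assoc[OF g] mult.assoc)
    qed
  qed (simp add: D1)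
  \<comment> \<open>Moving \<open>Qg i\<close> through \<open>theta0\<close> creates a
    \<open>k\<close> on the first leg, which cancels the one present.\<close>
  moreover have g: "theta0 * (hk \<otimes>\<^sub>C Qg i) = (1 \<otimes>\<^sub>C Qg i) * theta0"
  proof -
    have "theta0 * (hk \<otimes>\<^sub>C Qg i) = theta0 * (1 \<otimes>\<^sub>C Qg i) * (hk \<otimes>\<^sub>C 1)"
      by (simp add: mult.assoc times_pure_tensor)
    also have "\<dots> = (hk \<otimes>\<^sub>C Qg i) * ((hk \<otimes>\<^sub>C 1) * theta0)"
      by (simp add: theta0_right[OF Q_relations(5)] theta0_k mult.assoc)
    also have "\<dots> = (1 \<otimes>\<^sub>C Qg i) * theta0"
      by (simp add: times_pure_tensor hk_hk flip: mult.assoc)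
    finally show ?thesis .
  qed
  ultimately show ?thesis
    using assms(2) by (simp add: theta_list_def tensor_map_G_deriv_mult D0 left_assoc[OF g] mult.assoc)
qed

section \<open>The isomorphism\<close>

definition dual_to_Q :: "'n::{finite, linorder} H_algebra dual \<Rightarrow> 'n Q_algebra" where
  "dual_to_Q \<phi> = contract \<phi> theta"

definition H_to_Q :: "'n H_algebra \<Rightarrow> 'n Q_algebra" where
  "H_to_Q = hom_extension (case_H_gen omega_m Qb)"

definition double_to_Q :: "'n::{finite, linorder} double \<Rightarrow> 'n Q_algebra" where
  "double_to_Q = tensor_lift (\<lambda>\<phi> a. dual_to_Q \<phi> * H_to_Q a)"

lemma H_to_Q:
  shows alg_hom_H_to_Q: "alg_hom (H_to_Q :: 'n H_algebra \<Rightarrow> _)"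
    and H_to_Q_k: "H_to_Q (hk :: 'n H_algebra) = omega_m"
    and H_to_Q_f: "H_to_Q (hf (i :: 'n)) = Qb i"
proof -
  define v :: "'n H_gen \<Rightarrow> 'n Q_algebra" where "v = case_H_gen omega_m Qb"
  have v: "v H_k = omega_m" "v (H_f i) = Qb i" for i by (simp_all add: v_def)
  have "alg_hom (hom_extension v)" "hom_extension v (gen g) = v g" for g
    by (rule H_hom; unfold v; rule Q_relations omega_relations)+
  then show "alg_hom (H_to_Q :: 'n H_algebra \<Rightarrow> _)"
    "H_to_Q (hk :: 'n H_algebra) = omega_m" "H_to_Q (hf i) = Qb i"
    by (simp_all add: H_to_Q_def v_def)
qed

lemma clinear_dual_to_Q: "clinear dual_to_Q"
  using clinear_contract_left[of theta] by (simp add: dual_to_Q_def[abs_def])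

lemma cbilinear_double_to_Q: "cbilinear (\<lambda>\<phi> a. dual_to_Q \<phi> * H_to_Q a)"
  by (rule cbilinear_compose[OF cbilinear_times clinear_dual_to_Q alg_homD(1)[OF alg_hom_H_to_Q]])

lemma clinear_double_to_Q: "clinear double_to_Q"
  unfolding double_to_Q_def by (rule tensor_lift(1)[OF cbilinear_double_to_Q])

lemma double_to_Q_pure: "double_to_Q (\<phi> \<otimes>\<^sub>C a) = dual_to_Q \<phi> * H_to_Q a"
  unfolding double_to_Q_def by (rule tensor_lift(2)[OF cbilinear_double_to_Q])

lemma distinct_all: "distinct (sorted_list_of_set (UNIV :: 'n::{finite, linorder} set))"
  "i \<in> set (sorted_list_of_set (UNIV :: 'n::{finite, linorder} set))"
  by simp_all

section \<open>Straightening rules of the double, transported to \<open>Q\<close>\<close>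

lemma dual_to_Q_kappa: "dual_to_Q (dm kappa \<phi>) = omega_p * dual_to_Q \<phi>"
proof -
  have "dm kappa \<phi> = dual_pull kappa_twist \<phi>"
    by (rule dual_eqI) (simp add: dual_apply_pull alg_homD[OF alg_hom_kappa_twist]
        dual_mult_apply kappa_twist_def)
  then show ?thesis
    by (simp add: dual_to_Q_def theta_def theta_p contract_mult_left dual_shift_one
        alg_homD(1)[OF alg_hom_kappa_twist] flip: contract_pull)
qed

lemma dual_to_Q_Gf: "dual_to_Q (dm (Gf i) \<phi>) = Qg i * dual_to_Q \<phi>"
proof -
  have "dm (Gf i) \<phi> = dual_pull (G_deriv i) \<phi>"
    by (rule dual_eqI) (simp add: dual_apply_pull clinear_G_deriv dual_mult_apply G_deriv_def)
  then show ?thesis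
    by (simp add: dual_to_Q_def theta_def theta_g[OF distinct_all] contract_mult_left dual_shift_one
        clinear_G_deriv flip: contract_pull)
qed

text \<open>The image in \<open>Q\<close> of the rule \<open>H_op_k_dual_op\<close>. It is
  \<open>theta_m\<close> with \<open>k\<close> moved from the first leg to the other side, then
  contracted with \<phi>.\<close>

lemma omega_m_dual_to_Q:
  fixes \<phi> :: "'n::{finite, linorder} H_algebra dual"
  shows "omega_m * dual_to_Q \<phi> = dual_to_Q (dual_shift hk hk \<phi>) * omega_m"
proof -
  have "(1 \<otimes>\<^sub>C omega_m) * (theta :: ('n H_algebra, 'n Q_algebra) tensor) =
      (hk \<otimes>\<^sub>C 1) * ((hk \<otimes>\<^sub>C omega_m) * theta)"
    by (simp add: times_pure_tensor hk_hk flip: mult.assoc)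
  also have "\<dots> = (hk \<otimes>\<^sub>C 1) * theta * (hk \<otimes>\<^sub>C omega_m)"
    by (simp add: theta_def theta_m mult.assoc)
  finally have "contract \<phi> ((1 \<otimes>\<^sub>C omega_m) * theta) =
    contract \<phi> ((hk \<otimes>\<^sub>C 1) * theta * (hk \<otimes>\<^sub>C omega_m))" by simp
  then show ?thesis
    by (simp add: contract_mult contract_mult_left dual_shift_one dual_to_Q_def)
qed

lemma Qb_dual_to_Q:
  "Qb i * dual_to_Q \<phi> = dual_to_Q (dual_shift hk (hf i) \<phi>) * omega_m +
    dual_to_Q (dual_shift hk 1 \<phi>) * Qb i + dual_to_Q (dual_shift (hf i * hk) 1 \<phi>)"
proof -
  \<comment> \<open>The first summand brings \<open>theta_b\<close> into play but adds
    \<open>k * f_i\<close> on the first leg; since this is \<open>- (f_i * k)\<close>, the last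
    summand cancels it.\<close>
  have "(1 \<otimes>\<^sub>C Qb i) * theta = (hk \<otimes>\<^sub>C 1) * ((hk \<otimes>\<^sub>C Qb i + hf i \<otimes>\<^sub>C 1) * theta) + ((hf i * hk) \<otimes>\<^sub>C 1) * theta"
    by (simp add: distrib_left distrib_right times_pure_tensor hk_hk hf_hk pure_tensor_uminus_left
        flip: mult.assoc)
  also have "\<dots> = (hk \<otimes>\<^sub>C 1) * theta * (hf i \<otimes>\<^sub>C omega_m) + (hk \<otimes>\<^sub>C 1) * theta * (1 \<otimes>\<^sub>C Qb i) +
      ((hf i * hk) \<otimes>\<^sub>C 1) * theta"
    by (simp add: theta_def theta_b[OF distinct_all] mult.assoc distrib_left)
  finally have "contract \<phi> ((1 \<otimes>\<^sub>C Qb i) * theta) = contract \<phi> \<dots>" by (rule arg_cong)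
  then show ?thesis
    by (simp add: contract_simps contract_mult contract_mult_left dual_shift_one dual_to_Q_def)
qed

abbreviation rho :: "'n Q_algebra \<Rightarrow> 'n double endo" where
  "rho \<equiv> hom_extension (Q_values (H_op hk) (dual_op kappa) (\<lambda>i. H_op (hf i)) (\<lambda>i. dual_op (Gf i)))"

lemma alg_hom_rho: "alg_hom rho" by (rule double_endo.alg_hom_ext)

lemmas rho_simps = alg_homD[OF alg_hom_rho] double_endo.ext_simps

text \<open>The elements \<open>q\<close> that satisfy this for all \<open>t\<close> form a
  subalgebra, so the four families of generators suffice. For them it is the straightening rules or
  left multiplication by \<kappa> and \<open>G_i\<close>.\<close>

lemma double_to_Q_rho: "double_to_Q (endo_apply (rho q) t) = q * double_to_Q t"
proof (induction q arbitrary: t rule: Q_induct)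
  case m
  show ?case
    by (rule clinear_tensor_eqI[where f = "\<lambda>t. double_to_Q (endo_apply (rho omega_m) t)"
          and g = "\<lambda>t. omega_m * double_to_Q t"])
      (simp_all add: clinear_compose[OF clinear_double_to_Q clinear_endo_apply]
        clinear_compose[OF cbilinear_clinear(1)[OF cbilinear_times] clinear_double_to_Q]
        rho_simps H_op_k_apply double_to_Q_pure omega_m_dual_to_Q alg_homD[OF alg_hom_H_to_Q]
        H_to_Q_k left_assoc[OF omega_m_dual_to_Q] mult.assoc)
next
  case p
  show ?case
    by (rule clinear_tensor_eqI[where f = "\<lambda>t. double_to_Q (endo_apply (rho omega_p) t)"
          and g = "\<lambda>t. omega_p * double_to_Q t"])
      (simp_all add: clinear_compose[OF clinear_double_to_Q clinear_endo_apply]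
        clinear_compose[OF cbilinear_clinear(1)[OF cbilinear_times] clinear_double_to_Q]
        rho_simps dual_op_apply double_to_Q_pure dual_to_Q_kappa mult.assoc)
next
  case (b i)
  show ?case
    by (rule clinear_tensor_eqI[where f = "\<lambda>t. double_to_Q (endo_apply (rho (Qb i)) t)"
          and g = "\<lambda>t. Qb i * double_to_Q t"])
      (simp_all add: clinear_compose[OF clinear_double_to_Q clinear_endo_apply]
        clinear_compose[OF cbilinear_clinear(1)[OF cbilinear_times] clinear_double_to_Q]
        rho_simps H_op_f_apply double_to_Q_pure left_assoc[OF Qb_dual_to_Q] mult.assoc distrib_right
        clinearD[OF clinear_double_to_Q] alg_homD[OF alg_hom_H_to_Q] H_to_Q_k H_to_Q_f)
next
  case (g i)
  show ?case
    by (rule clinear_tensor_eqI[where f = "\<lambda>t. double_to_Q (endo_apply (rho (Qg i)) t)"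
          and g = "\<lambda>t. Qg i * double_to_Q t"])
      (simp_all add: clinear_compose[OF clinear_double_to_Q clinear_endo_apply]
        clinear_compose[OF cbilinear_clinear(1)[OF cbilinear_times] clinear_double_to_Q]
        rho_simps dual_op_apply double_to_Q_pure dual_to_Q_Gf mult.assoc)
qed (simp_all add: rho_simps endo_apply_simps clinearD[OF clinear_double_to_Q] distrib_right
      mult_scaleC_left mult.assoc)

text \<open>Contracting with the partial product \<open>theta_list xs\<close> sees a functional only
  through this endomorphism; for the full list it is the identity.\<close>

definition proj :: "'n list \<Rightarrow> 'n H_algebra \<Rightarrow> 'n H_algebra" where
  "proj xs = hom_extension (case_H_gen hk (\<lambda>i. if i \<in> set xs then hf i else 0))"

lemma proj:
  shows alg_hom_proj: "alg_hom (proj xs :: 'n H_algebra \<Rightarrow> 'n H_algebra)"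
    and proj_k: "proj xs hk = (hk :: 'n H_algebra)"
    and proj_f: "proj xs (hf (i :: 'n)) = (if i \<in> set xs then hf i else 0)"
proof -
  define v :: "'n H_gen \<Rightarrow> 'n H_algebra"
    where "v = case_H_gen hk (\<lambda>i. if i \<in> set xs then hf i else 0)"
  have v: "v H_k = hk" "v (H_f i) = (if i \<in> set xs then hf i else 0)" for i
    by (simp_all add: v_def)
  have ff: "v (H_f i) * v (H_f j) = - (v (H_f j) * v (H_f i))" for i j
    by (simp add: v hf_hf[of i j])
  have "alg_hom (hom_extension v)" "hom_extension v (gen g) = v g" for g
    by (rule H_hom[where v = v, OF _ _ ff]; simp add: v hk_hk hf_hk)+
  then show "alg_hom (proj xs :: 'n H_algebra \<Rightarrow> 'n H_algebra)" "proj xs hk = (hk :: 'n H_algebra)"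
    "proj xs (hf i) = (if i \<in> set xs then hf i else 0)"
    by (simp_all add: proj_def v_def)
qed

lemmas proj_simps = alg_homD[OF alg_hom_proj] proj_k proj_f

lemma dual_apply_proj: "dual_apply (dual_pull (proj xs) \<phi>) x = dual_apply \<phi> (proj xs x)"
  by (simp add: dual_apply_pull proj_simps)

lemma dual_shift_proj:
  "dual_shift 1 b (dual_pull (proj xs) \<phi>) = dual_pull (proj xs) (dual_shift 1 (proj xs b) \<phi>)"
  by (rule dual_eqI) (simp add: dual_apply_shift dual_apply_proj proj_simps)

text \<open>The two functionals are dual to the basis 1, \<open>k\<close> of the subalgebra that
  remains when all \<open>f_i\<close> are killed.\<close>

lemma proj_Nil:
  "proj [] x = dual_apply ((1/2) *\<^sub>C (eps + kappa)) x *\<^sub>C 1 + dual_apply ((1/2) *\<^sub>C (eps - kappa)) x *\<^sub>C hk"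
proof -
  define \<alpha> \<beta> :: "'a H_algebra dual"
    where "\<alpha> = (1/2) *\<^sub>C (eps + kappa)" and "\<beta> = (1/2) *\<^sub>C (eps - kappa)"
  have vals: "dual_apply \<alpha> 1 = 1" "dual_apply \<beta> 1 = 0"
    "dual_apply \<alpha> (y * hk) = dual_apply \<beta> y" "dual_apply \<beta> (y * hk) = dual_apply \<alpha> y"
    "dual_apply \<alpha> (y * hf i) = 0" "dual_apply \<beta> (y * hf i) = 0" for y i
    by (simp_all add: \<alpha>_def \<beta>_def dual_apply_simps eps_simps kappa_simps)
  have "proj [] x = dual_apply \<alpha> x *\<^sub>C 1 + dual_apply \<beta> x *\<^sub>C hk"
    by (induction x rule: H_induct_right)
      (simp_all add: proj_simps vals dual_apply_simps(1-3) distrib_right scaleC_ring_simps hk_hk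
        scaleC_add_left add_ac)
  then show ?thesis by (simp add: \<alpha>_def \<beta>_def)
qed

text \<open>In Sweedler notation, \<open>proj (xs @ [j]) a = \<Sum> proj xs a' (\<epsilon>(a'') + G\<^sub>j(a'') f\<^sub>j)\<close>: this is how each new factor of
  \<open>theta\<close> enlarges the set of generators that the contraction reproduces.\<close>

lemma proj_snoc:
  assumes "j \<notin> set xs"
  shows "dual_pull (proj (xs @ [j])) \<phi> =
    dual_pull (proj xs) \<phi> + dm (dual_pull (proj xs) (dual_shift 1 (hf j) \<phi>)) (Gf j)"
proof (rule dual_eqI)
  fix a :: "'a H_algebra"
  have comm: "dual_shift 1 (hf j) (dual_shift 1 hk \<phi>) = - dual_shift 1 hk (dual_shift 1 (hf j) \<phi>)"
    "dual_shift 1 (hf j) (dual_shift 1 (hf i) \<phi>) = - dual_shift 1 (hf i) (dual_shift 1 (hf j) \<phi>)"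
    "dual_shift 1 (hf j) (dual_shift 1 (hf j) \<phi>) = 0"
    "dual_shift 1 0 \<phi> = 0" "dual_pull (proj xs) 0 = 0"
    "dual_pull (proj xs) (- \<phi>) = - dual_pull (proj xs) \<phi>" for \<phi> and i
    by (rule dual_eqI; simp add: dual_apply_shift dual_apply_simps dual_apply_uminus
        dual_apply_proj mult.assoc hf_hk hf_sq hf_hf[of j i])+
  have "dual_apply \<phi> (proj (xs @ [j]) a) = dual_apply \<phi> (proj xs a) +
      dual_apply (dm (dual_pull (proj xs) (dual_shift 1 (hf j) \<phi>)) (Gf j)) a"
  proof (induction a arbitrary: \<phi> rule: H_induct_right)
    case (k x)
    have "dual_apply \<phi> (y * hk) = dual_apply (dual_shift 1 hk \<phi>) y" for y
      by (simp add: dual_apply_shift)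
    then show ?case
      by (simp add: proj_simps k dual_mult_apply_right dual_shift_proj shift_one_right comm
          dual_mult_uminus)
  next
    case (f i x)
    have app: "dual_apply \<phi> (y * hf i) = dual_apply (dual_shift 1 (hf i) \<phi>) y" for y
      by (simp add: dual_apply_shift)
    note simps = proj_simps f dual_mult_apply_right dual_shift_proj shift_one_right
      comm(1,3-6) dual_mult_uminus dual_mult_simps dual_mult_eps dual_apply_proj dual_apply_simps
    show ?case
    proof (cases "i = j")
      case True
      then show ?thesis using assms by (simp add: simps app[unfolded True])
    next
      case False
      then show ?thesis by (simp add: simps app comm(2)[where i = i])
    qed
  qed (simp_all add: proj_simps dual_apply_simps dual_mult_apply_one Gf_simps algebra_simps)
  then show "dual_apply (dual_pull (proj (xs @ [j])) \<phi>) a = dual_apply (dual_pull (proj xs) \<phi> +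
      dm (dual_pull (proj xs) (dual_shift 1 (hf j) \<phi>)) (Gf j)) a"
    by (simp add: dual_apply_simps dual_apply_proj)
qed

text \<open>A factor added at the right end shifts \<phi> by \<open>f_j\<close> and contributes
  \<open>Qg j\<close> on the right, which acts as \<open>G_j\<close>; hence induction from the end
  of the list, for all \<phi>. The sum that arises is the one in \<open>proj_snoc\<close>.\<close>

lemma rho_contract_theta:
  "distinct xs \<Longrightarrow> rho (contract \<phi> (theta_list xs)) = dual_op (dual_pull (proj xs) \<phi>)"
proof (induction xs arbitrary: \<phi> rule: rev_induct)
  case Nil
  have eq: "dual_pull (proj []) \<phi> = (1/2) *\<^sub>C ((dual_apply \<phi> 1 + dual_apply \<phi> hk) *\<^sub>C eps +
      (dual_apply \<phi> 1 - dual_apply \<phi> hk) *\<^sub>C kappa)"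
    by (rule dual_eqI) (simp add: dual_apply_proj proj_Nil dual_apply_simps algebra_simps)
  show ?case
    unfolding eq by (simp add: theta_list_def theta0_def contract_simps rho_simps clinearD[OF clinear_dual_op] dual_op_eps
        scaleC_add_left cvec.scale_left_diff_distrib algebra_simps)
next
  case (snoc j xs)
  have "theta_list (xs @ [j]) = theta_list xs + theta_list xs * (hf j \<otimes>\<^sub>C Qg j)"
    by (simp add: theta_list_def theta1_def distrib_left mult.assoc)
  then show ?case using snoc
    by (simp add: contract_simps contract_mult_right rho_simps proj_snoc clinearD[OF clinear_dual_op] dual_op_mult)
qed

lemma rho_dual_to_Q: "rho (dual_to_Q \<phi>) = dual_op \<phi>"
proof -
  have "proj (sorted_list_of_set UNIV) x = x" for x :: "'a H_algebra"
    by (rule H_alg_hom_eqI[OF alg_hom_proj alg_hom_id]) (simp_all add: proj_simps)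
  then have "dual_pull (proj (sorted_list_of_set UNIV)) \<phi> = \<phi>"
    by (intro dual_eqI) (simp add: dual_apply_proj)
  then show ?thesis
    by (simp add: dual_to_Q_def theta_def rho_contract_theta)
qed

lemma rho_H_to_Q: "rho (H_to_Q a) = H_op a"
  by (rule H_alg_hom_eqI[OF alg_hom_compose[OF alg_hom_rho alg_hom_H_to_Q] alg_hom_H_op])
    (simp_all add: H_to_Q_k H_to_Q_f rho_simps)

section \<open>The unit of the double and the inverse map\<close>

lemma dual_shift_eps:
  fixes i :: 'n
  shows "dual_shift hk hk eps = (eps :: 'n H_algebra dual)"
    "dual_shift hk 1 eps = (eps :: 'n H_algebra dual)"
    "dual_shift hk (hf i) eps = 0" "dual_shift (hf i * hk) 1 eps = 0"
  by (rule dual_eqI; simp add: dual_apply_shift dual_apply_simps eps_simps)+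

text \<open>The character \<epsilon> absorbs the outer legs of the iterated coproduct, so only the
  middle leg acts: \<open>H\<close> sits in the double as a subalgebra.\<close>

lemma H_op_eps: "endo_apply (H_op a) (eps \<otimes>\<^sub>C x) = eps \<otimes>\<^sub>C (a * x)"
proof (induction a arbitrary: x rule: presented_induct_left)
  case (gen g a)
  show ?case
    by (cases g) (simp_all add: dual_shift_eps alg_homD[OF alg_hom_H_op] endo_apply_simps gen H_op_k_apply
        H_op_f_apply mult.assoc)
qed (simp_all add: alg_homD[OF alg_hom_H_op] endo_apply_simps distrib_right mult_scaleC_left
      pure_tensor_simps)

lemma contract_eps_theta: "contract eps (theta_list xs) = 1"
proof -
  note hom = alg_homD[OF alg_hom_contract[OF alg_hom_eps]]
  have "contract eps (theta0 :: ('a H_algebra, 'a Q_algebra) tensor) = 1"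
    by (simp add: theta0_def contract_simps eps_simps scaleC_half_twice scaleC_scaleC)
  moreover have "contract eps (prod_list (map theta1 xs)) = 1"
    by (induction xs) (simp_all add: hom theta1_def contract_simps eps_simps)
  ultimately show ?thesis by (simp add: theta_list_def hom)
qed

lemma double_to_Q_unit: "double_to_Q (eps \<otimes>\<^sub>C 1) = 1"
  by (simp add: double_to_Q_pure dual_to_Q_def theta_def contract_eps_theta
      alg_homD[OF alg_hom_H_to_Q])

definition Q_to_double :: "'n Q_algebra \<Rightarrow> 'n double" where
  "Q_to_double q = endo_apply (rho q) (eps \<otimes>\<^sub>C 1)"

lemma Q_to_double_to_Q: "double_to_Q (Q_to_double q) = q"
  by (simp add: Q_to_double_def double_to_Q_rho double_to_Q_unit)

lemma double_to_Q_to_double: "Q_to_double (double_to_Q t) = t"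
proof (rule clinear_tensor_eqI[where f = "\<lambda>t. Q_to_double (double_to_Q t)" and g = "\<lambda>t. t"])
  show "clinear (\<lambda>t. Q_to_double (double_to_Q t))"
    unfolding Q_to_double_def
    by (rule clinear_compose[OF clinear_endo_eval
          clinear_compose[OF alg_homD(1)[OF alg_hom_rho] clinear_double_to_Q]])
  show "Q_to_double (double_to_Q (\<phi> \<otimes>\<^sub>C a)) = \<phi> \<otimes>\<^sub>C a" for \<phi> a
    by (simp add: Q_to_double_def double_to_Q_pure rho_simps rho_dual_to_Q rho_H_to_Q
        endo_apply_simps H_op_eps dual_op_apply dual_mult_eps)
qed (rule clinear_id)

lemma bij_double_to_Q: "bij double_to_Q"
  by (rule bij_betw_byWitness[where f' = Q_to_double])
    (simp_all add: Q_to_double_to_Q double_to_Q_to_double)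

text \<open>Left multiplication in the double is the action of the image in \<open>Q\<close>. With
  \<open>double_to_Q_rho\<close> this makes \<open>double_to_Q\<close> multiplicative, and
  associativity of the double is inherited from \<open>Q\<close>.\<close>

lemma double_mult_rho: "double_mult H_hopf s t = endo_apply (rho (double_to_Q s)) t"
proof (rule clinear_tensor_eqI[where f = "\<lambda>s. double_mult H_hopf s t"
      and g = "\<lambda>s. endo_apply (rho (double_to_Q s)) t"])
  show "clinear (\<lambda>s. endo_apply (rho (double_to_Q s)) t)"
    by (rule clinear_compose[OF clinear_endo_eval
          clinear_compose[OF alg_homD(1)[OF alg_hom_rho] clinear_double_to_Q]])
qed (simp_all add: clinear_double_mult double_mult_pure_left double_to_Q_pure rho_simps
    rho_dual_to_Q rho_H_to_Q)

lemma double_to_Q_mult: "double_to_Q (double_mult H_hopf s t) = double_to_Q s * double_to_Q t"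
  by (simp add: double_mult_rho double_to_Q_rho)

lemma algebra_iso_double_to_Q:
  "algebra_iso (drinfeld_double H_hopf) (Q_quasi_hopf \<beta>) double_to_Q"
  unfolding algebra_iso_def
  by (simp add: clinear_double_to_Q bij_double_to_Q drinfeld_double_def Q_quasi_hopf_def Let_def
      double_to_Q_mult double_to_Q_unit flip: eps_def)

section \<open>The coproduct, counit and antipode of \<open>Q(N, \<beta>)\<close> for even \<open>N\<close>\<close>

text \<open>The structure maps of \<open>Q\<close> are defined by values on \<open>K\<close> and the
  \<open>f_i\<close>. Exhibiting a homomorphism with these values resolves the \<open>THE\<close>
  without checking relators a second time.\<close>

lemma hom_extension_eqI:
  assumes "alg_hom f" "\<And>g. f (gen g) = v g"
  shows "hom_extension v = f"
  unfolding hom_extension_def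
proof (rule the_equality)
  fix f' assume "alg_hom f' \<and> (\<forall>g. f' (gen g) = v g)"
  then have "f' x = f x" for x
    by (rule_tac alg_hom_eqI[of f' f]) (simp_all add: assms)
  then show "f' = f" by (rule ext)
qed (use assms in simp)

lemma antihom_extension_eqI:
  assumes "alg_antihom f" "\<And>g. f (gen g) = v g"
  shows "antihom_extension v = f"
  unfolding antihom_extension_def
proof (rule the_equality)
  fix f' assume "alg_antihom f' \<and> (\<forall>g. f' (gen g) = v g)"
  then have "f' x = f x" for x
    by (rule_tac alg_antihom_eqI[of f' f]) (simp_all add: assms)
  then show "f' = f" by (rule ext)
qed (use assms in simp)

text \<open>Split \<open>K\<close> into \<open>x\<close> and \<open>y\<close> by the idempotents;
  the two involutions are \<open>x\<close> plus or minus \<open>\<i> y\<close>. The mixed terms get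
  coefficient 1 and y \<otimes> y gets -1, as in the coproduct of \<open>K\<close> when 1 + (-1)^N =
  2.\<close>

lemma Q_comult_K:
  "coeff_m *\<^sub>C (omega_m \<otimes>\<^sub>C omega_m) + coeff_p *\<^sub>C (omega_p \<otimes>\<^sub>C omega_p) =
    gen Q_K \<otimes>\<^sub>C gen Q_K - 2 *\<^sub>C ((Q_e 1 \<otimes>\<^sub>C Q_e 1) * (gen Q_K \<otimes>\<^sub>C gen Q_K :: ('n Q_algebra, 'n Q_algebra) tensor))"
proof -
  define x y :: "'n Q_algebra" where "x = Q_e 0 * gen Q_K" and "y = Q_e 1 * gen Q_K"
  have K: "gen Q_K = x + y"
    unfolding x_def y_def distrib_right[symmetric] Q_e_split by simp
  have om: "omega_m = x - \<i> *\<^sub>C y" "omega_p = x + \<i> *\<^sub>C y"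
    by (simp_all add: omega_m_def omega_p_def x_def y_def algebra_simps mult_scaleC_left)
  have "coeff_m *\<^sub>C ((x - \<i> *\<^sub>C y) \<otimes>\<^sub>C (x - \<i> *\<^sub>C y)) + coeff_p *\<^sub>C ((x + \<i> *\<^sub>C y) \<otimes>\<^sub>C (x + \<i> *\<^sub>C y)) =
      (coeff_m + coeff_p) *\<^sub>C (x \<otimes>\<^sub>C x) + (\<i> * (coeff_p - coeff_m)) *\<^sub>C (x \<otimes>\<^sub>C y + y \<otimes>\<^sub>C x) - (coeff_m + coeff_p) *\<^sub>C (y \<otimes>\<^sub>C y)"
    by (simp add: pure_tensor_simps pure_tensor_diff_left pure_tensor_diff_right scaleC_scaleC
        algebra_simps)
  also have "\<dots> = x \<otimes>\<^sub>C x + (x \<otimes>\<^sub>C y + y \<otimes>\<^sub>C x) - y \<otimes>\<^sub>C y"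
    by (simp add: pc_coeff_p)
  also have "\<dots> = (x + y) \<otimes>\<^sub>C (x + y) - 2 *\<^sub>C (y \<otimes>\<^sub>C y)"
    by (simp add: pure_tensor_simps flip: scaleC_half_twice)
  finally show ?thesis
    by (simp add: om K[symmetric] times_pure_tensor y_def[symmetric] flip: One_nat_def)
qed

lemma Q_comult_even:
  assumes "even CARD('n::finite)"
  shows alg_hom_Q_comult: "alg_hom (Q_comult :: 'n Q_algebra \<Rightarrow> _)"
    and Q_comult_m: "Q_comult (omega_m :: 'n Q_algebra) = omega_m \<otimes>\<^sub>C omega_m"
    and Q_comult_p: "Q_comult (omega_p :: 'n Q_algebra) = omega_p \<otimes>\<^sub>C omega_p"
    and Q_comult_b: "Q_comult (Qb (i :: 'n)) = Qb i \<otimes>\<^sub>C omega_m + 1 \<otimes>\<^sub>C Qb i"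
    and Q_comult_g: "Q_comult (Qg (i :: 'n)) = Qg i \<otimes>\<^sub>C 1 + omega_p \<otimes>\<^sub>C Qg i"
proof -
  interpret C: double_relations "omega_m \<otimes>\<^sub>C omega_m :: ('n Q_algebra, 'n Q_algebra) tensor"
    "omega_p \<otimes>\<^sub>C omega_p" "\<lambda>i. Qb i \<otimes>\<^sub>C omega_m + 1 \<otimes>\<^sub>C Qb i" "\<lambda>i. Qg i \<otimes>\<^sub>C 1 + omega_p \<otimes>\<^sub>C Qg i"
  proof
    fix i j :: 'n
    note simps = times_pure_tensor omega_relations(1,2) pure_tensor_one distrib_left distrib_right
      Q_relations(1-5) pure_tensor_uminus_left pure_tensor_uminus_right
    show "(Qb i \<otimes>\<^sub>C omega_m + 1 \<otimes>\<^sub>C Qb i) * (Qb j \<otimes>\<^sub>C omega_m + 1 \<otimes>\<^sub>C Qb j) =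
        - ((Qb j \<otimes>\<^sub>C omega_m + 1 \<otimes>\<^sub>C Qb j) * (Qb i \<otimes>\<^sub>C omega_m + 1 \<otimes>\<^sub>C Qb i))"
      by (simp add: simps Q_relations(6)[of i j])
    show "(Qg i \<otimes>\<^sub>C 1 + omega_p \<otimes>\<^sub>C Qg i) * (Qg j \<otimes>\<^sub>C 1 + omega_p \<otimes>\<^sub>C Qg j) =
        - ((Qg j \<otimes>\<^sub>C 1 + omega_p \<otimes>\<^sub>C Qg j) * (Qg i \<otimes>\<^sub>C 1 + omega_p \<otimes>\<^sub>C Qg i))"
      by (simp add: simps Q_relations(7)[of i j])
    show "(Qb i \<otimes>\<^sub>C omega_m + 1 \<otimes>\<^sub>C Qb i) * (Qg j \<otimes>\<^sub>C 1 + omega_p \<otimes>\<^sub>C Qg j) =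
        (Qg j \<otimes>\<^sub>C 1 + omega_p \<otimes>\<^sub>C Qg j) * (Qb i \<otimes>\<^sub>C omega_m + 1 \<otimes>\<^sub>C Qb i) +
        (if i = j then omega_m \<otimes>\<^sub>C omega_m - omega_p \<otimes>\<^sub>C omega_p else 0)"
      by (simp add: simps Q_relations(8) pure_tensor_simps pure_tensor_diff_left
          pure_tensor_diff_right algebra_simps)
  qed (simp_all add: times_pure_tensor omega_relations(1,2) pure_tensor_one distrib_left
      distrib_right Q_relations(1-5) pure_tensor_uminus_left pure_tensor_uminus_right)
  have "Q_comult = C.ext"
    unfolding Q_comult_def
  proof (rule hom_extension_eqI[OF C.alg_hom_ext])
    show "C.ext (gen g) = (case g of Q_K \<Rightarrow> gen Q_K \<otimes>\<^sub>C gen Q_K -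
        (1 + (-1) ^ CARD('n)) *\<^sub>C ((Q_e 1 \<otimes>\<^sub>C Q_e 1) * (gen Q_K \<otimes>\<^sub>C gen Q_K))
      | Q_fp i \<Rightarrow> gen (Q_fp i) \<otimes>\<^sub>C 1 + omega_p \<otimes>\<^sub>C gen (Q_fp i)
      | Q_fm i \<Rightarrow> gen (Q_fm i) \<otimes>\<^sub>C 1 + omega_m \<otimes>\<^sub>C gen (Q_fm i))" for g
    proof (cases g)
      case Q_K
      then show ?thesis using assms by (simp add: C.ext_gen Q_comult_K[unfolded One_nat_def])
    next
      case (Q_fp i)
      have "gen (Q_fp i) \<otimes>\<^sub>C 1 + omega_p \<otimes>\<^sub>C gen (Q_fp i) =
          (- 1/2) *\<^sub>C (Qg i \<otimes>\<^sub>C 1 + omega_p \<otimes>\<^sub>C Qg i)"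
        by (simp only: Q_fp_Qg pure_tensor_scale_left pure_tensor_scale_right scaleC_add_right)
      then show ?thesis by (simp only: Q_fp Q_gen.case C.ext_gen)
    next
      case (Q_fm i)
      have "gen (Q_fm i) \<otimes>\<^sub>C 1 + omega_m \<otimes>\<^sub>C gen (Q_fm i) =
          (Qb i \<otimes>\<^sub>C omega_m + 1 \<otimes>\<^sub>C Qb i) * (omega_m \<otimes>\<^sub>C omega_m)"
        by (simp add: Q_fm_Qb distrib_right times_pure_tensor omega_relations)
      then show ?thesis by (simp only: Q_fm Q_gen.case C.ext_gen)
    qed
  qed
  with C.alg_hom_ext C.ext_simps show "alg_hom (Q_comult :: 'n Q_algebra \<Rightarrow> _)"
    "Q_comult (omega_m :: 'n Q_algebra) = omega_m \<otimes>\<^sub>C omega_m"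
    "Q_comult (omega_p :: 'n Q_algebra) = omega_p \<otimes>\<^sub>C omega_p"
    "Q_comult (Qb i) = Qb i \<otimes>\<^sub>C omega_m + 1 \<otimes>\<^sub>C Qb i"
    "Q_comult (Qg i) = Qg i \<otimes>\<^sub>C 1 + omega_p \<otimes>\<^sub>C Qg i" by simp_all
qed

definition Q_counit :: "'n Q_algebra \<Rightarrow> complex" where
  "Q_counit = hom_extension (case_Q_gen 1 (\<lambda>i. 0) (\<lambda>i. 0))"

lemma Q_counit:
  shows alg_hom_Q_counit: "alg_hom (Q_counit :: 'n Q_algebra \<Rightarrow> _)"
    and Q_counit_m: "Q_counit (omega_m :: 'n Q_algebra) = 1"
    and Q_counit_p: "Q_counit (omega_p :: 'n Q_algebra) = 1"
    and Q_counit_b: "Q_counit (Qb (i :: 'n)) = 0"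
    and Q_counit_g: "Q_counit (Qg (i :: 'n)) = 0"
proof -
  interpret C: double_relations "1 :: complex" 1 "\<lambda>i :: 'n. 0" "\<lambda>i. 0"
    by unfold_locales simp_all
  have "Q_counit = C.ext"
    unfolding Q_counit_def
  proof (rule hom_extension_eqI[OF C.alg_hom_ext])
    show "C.ext (gen g) = case_Q_gen 1 (\<lambda>i. 0) (\<lambda>i. 0) g" for g
      by (cases g) (simp_all add: C.ext_gen scaleC_complex_def pc_coeff_p)
  qed
  with C.alg_hom_ext C.ext_simps show "alg_hom (Q_counit :: 'n Q_algebra \<Rightarrow> _)"
    "Q_counit (omega_m :: 'n Q_algebra) = 1" "Q_counit (omega_p :: 'n Q_algebra) = 1"
    "Q_counit (Qb i) = 0" "Q_counit (Qg i) = 0" by simp_all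
qed

lemma Q_antipode_even:
  assumes "even CARD('n::finite)"
  shows alg_antihom_Q_antipode: "alg_antihom (Q_antipode :: 'n Q_algebra \<Rightarrow> _)"
    and Q_antipode_m: "Q_antipode (omega_m :: 'n Q_algebra) = omega_m"
    and Q_antipode_p: "Q_antipode (omega_p :: 'n Q_algebra) = omega_p"
    and Q_antipode_b: "Q_antipode (Qb (i :: 'n)) = - (Qb i * omega_m)"
    and Q_antipode_g: "Q_antipode (Qg (i :: 'n)) = Qg i * omega_p"
proof -
  note op = times_opposite_def one_opposite_def uminus_opposite_def plus_opposite_def
    minus_opposite_def zero_opposite_def scaleC_opposite_def
  note assoc = mult.assoc omega_relations(1,2) left_assoc[OF omega_relations(1)]
    left_assoc[OF omega_relations(2)]
  interpret C: double_relations "Opposite (omega_m :: 'n Q_algebra)" "Opposite omega_p"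
    "\<lambda>i. Opposite (- (Qb i * omega_m))" "\<lambda>i. Opposite (Qg i * omega_p)"
  proof
    fix i j :: 'n
    note simps = op assoc Q_relations(1-5) left_assoc[OF Q_relations(1)]
      left_assoc[OF Q_relations(2)] left_assoc[OF Q_relations(3)] left_assoc[OF Q_relations(4)]
      left_assoc[OF Q_relations(5)]
    show "Opposite (- (Qb i * omega_m)) * Opposite omega_m =
        - (Opposite omega_m * Opposite (- (Qb i * omega_m)))"
      "Opposite (- (Qb i * omega_m)) * Opposite omega_p =
        - (Opposite omega_p * Opposite (- (Qb i * omega_m)))"
      "Opposite (Qg i * omega_p) * Opposite omega_m = - (Opposite omega_m * Opposite (Qg i * omega_p))"
      "Opposite (Qg i * omega_p) * Opposite omega_p = - (Opposite omega_p * Opposite (Qg i * omega_p))"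
      by (simp_all add: simps)
    show "Opposite (- (Qb i * omega_m)) * Opposite (- (Qb j * omega_m)) =
        - (Opposite (- (Qb j * omega_m)) * Opposite (- (Qb i * omega_m)))"
      by (simp add: simps Q_relations(6)[of i j])
    show "Opposite (Qg i * omega_p) * Opposite (Qg j * omega_p) =
        - (Opposite (Qg j * omega_p) * Opposite (Qg i * omega_p))"
      by (simp add: simps Q_relations(7)[of i j])
    show "Opposite (- (Qb i * omega_m)) * Opposite (Qg j * omega_p) =
        Opposite (Qg j * omega_p) * Opposite (- (Qb i * omega_m)) +
        (if i = j then Opposite omega_m - Opposite omega_p else 0)"
      by (simp add: simps Q_relations(8) distrib_left distrib_right left_diff_distrib
          right_diff_distrib algebra_simps)
  qed (simp_all add: op omega_relations Q_relations(1))
  have anti: "alg_antihom (\<lambda>x. unopposite (C.ext x))"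
    by (intro alg_antihomI clinearI) (simp_all add: alg_homD[OF C.alg_hom_ext] op)
  have eq: "Q_antipode = (\<lambda>x. unopposite (C.ext x))"
    unfolding Q_antipode_def
  proof (rule antihom_extension_eqI[OF anti])
    show "unopposite (C.ext (gen g)) = (case g of
      Q_K \<Rightarrow> (if even CARD('n) then gen Q_K else gen Q_K ^ 3)
    | Q_fp i \<Rightarrow> gen (Q_fp i) * (Q_e 0 + ((-1) ^ CARD('n) * \<i>) *\<^sub>C Q_e 1) * gen Q_K
    | Q_fm i \<Rightarrow> gen (Q_fm i) * (Q_e 0 - ((-1) ^ CARD('n) * \<i>) *\<^sub>C Q_e 1) * gen Q_K)" for g
    proof (cases g)
      case Q_K
      then show ?thesis using assms by (simp add: C.ext_gen op flip: Q_K_omega)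
    next
      case (Q_fp i)
      have "gen (Q_fp i) * (Q_e 0 + ((-1) ^ CARD('n) * \<i>) *\<^sub>C Q_e 1) * gen Q_K =
          (- 1/2) *\<^sub>C (Qg i * omega_p)"
        using assms by (simp add: mult.assoc flip: omega_p_def[unfolded One_nat_def]) (simp add: Qg_def mult_scaleC_left)
      then show ?thesis by (simp add: C.ext_gen op Q_fp)
    next
      case (Q_fm i)
      have eq: "gen (Q_fm i) * (Q_e 0 - ((-1) ^ CARD('n) * \<i>) *\<^sub>C Q_e 1) * gen Q_K = Qb i"
        using assms by (simp add: mult.assoc flip: omega_m_def[unfolded One_nat_def]) (simp add: Qb_def)
      \<comment> \<open>The prescribed value \<open>f^- * omega_m\<close> is \<open>Qb i\<close>; it
        has to agree with the reversed product of the images of \<open>Qb i\<close> and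
        \<open>omega_m\<close>.\<close>
      have "unopposite (C.ext (gen g)) = omega_m * - (Qb i * omega_m)"
        unfolding Q_fm C.ext_gen by (simp add: op)
      also have "\<dots> = Qb i"
        by (simp add: Q_relations assoc)
      finally show ?thesis by (simp only: Q_fm Q_gen.case eq)
    qed
  qed
  show "alg_antihom (Q_antipode :: 'n Q_algebra \<Rightarrow> _)"
    unfolding eq by (rule anti)
  show "Q_antipode (omega_m :: 'n Q_algebra) = omega_m" "Q_antipode (omega_p :: 'n Q_algebra) = omega_p"
    "Q_antipode (Qb i) = - (Qb i * omega_m)" "Q_antipode (Qg i) = Qg i * omega_p"
    by (simp_all only: eq C.ext_simps opposite.sel)
qed

section \<open>The canonical element and the Hopf structures\<close>

lemma prod_list_exchange:
  fixes t :: "'a::monoid_mult"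
  assumes "\<And>j. r j * t = t * u j"
  shows "prod_list (map r xs) * t = t * prod_list (map u xs)"
  by (induction xs) (simp_all add: mult.assoc left_assoc[OF assms])

lemma prod_list_mult_commuting:
  fixes u v :: "'i \<Rightarrow> 'a::monoid_mult"
  assumes "distinct xs" "\<And>i j. i \<noteq> j \<Longrightarrow> v i * u j = u j * v i"
  shows "prod_list (map (\<lambda>j. u j * v j) xs) = prod_list (map u xs) * prod_list (map v xs)"
  using assms(1)
proof (induction xs)
  case (Cons j xs)
  have vu: "v j * prod_list (map u xs) = prod_list (map u xs) * v j"
    using Cons.prems by (intro commute_prod_list assms(2)) auto
  show ?case using Cons by (simp add: mult.assoc left_assoc[OF vu])
qed simp

definition leg13 ::
  "('a::complex_algebra_1, 'b::complex_algebra_1) tensor \<Rightarrow> ('a, ('b, 'b) tensor) tensor" where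
  "leg13 = tensor_map (\<lambda>x. x) (\<lambda>q. 1 \<otimes>\<^sub>C q)"

definition leg12 ::
  "('a::complex_algebra_1, 'b::complex_algebra_1) tensor \<Rightarrow> ('a, ('b, 'b) tensor) tensor" where
  "leg12 = tensor_map (\<lambda>x. x) (\<lambda>q. q \<otimes>\<^sub>C 1)"

lemma
  fixes a :: "'a::complex_algebra_1" and q :: "'b::complex_algebra_1"
  shows alg_hom_leg: "alg_hom (leg13 :: ('a, 'b) tensor \<Rightarrow> _)" "alg_hom (leg12 :: ('a, 'b) tensor \<Rightarrow> _)"
    and leg_pure: "leg13 (a \<otimes>\<^sub>C q) = a \<otimes>\<^sub>C (1 \<otimes>\<^sub>C q)" "leg12 (a \<otimes>\<^sub>C q) = a \<otimes>\<^sub>C (q \<otimes>\<^sub>C 1)"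
proof -
  have h: "alg_hom (\<lambda>q :: 'b. (1 :: 'b) \<otimes>\<^sub>C q)" "alg_hom (\<lambda>q :: 'b. q \<otimes>\<^sub>C (1 :: 'b))"
    by (intro alg_homI clinearI; simp add: pure_tensor_simps pure_tensor_one times_pure_tensor)+
  show "alg_hom (leg13 :: ('a, 'b) tensor \<Rightarrow> _)" "alg_hom (leg12 :: ('a, 'b) tensor \<Rightarrow> _)"
    unfolding leg13_def leg12_def by (rule alg_hom_tensor_map[OF alg_hom_id] h)+
  show "leg13 (a \<otimes>\<^sub>C q) = a \<otimes>\<^sub>C (1 \<otimes>\<^sub>C q)" "leg12 (a \<otimes>\<^sub>C q) = a \<otimes>\<^sub>C (q \<otimes>\<^sub>C 1)"
    by (simp_all add: leg13_def leg12_def tensor_map(2)[OF clinear_id alg_homD(1)[OF h(1)]]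
        tensor_map(2)[OF clinear_id alg_homD(1)[OF h(2)]])
qed

lemmas leg_simps = alg_homD[OF alg_hom_leg(1)] alg_homD[OF alg_hom_leg(2)] leg_pure

text \<open>This is (id \<otimes> \<Delta>)(R) = R_13 R_12. Each image of \<open>theta1 j\<close>
  splits as \<open>u j * v j\<close> because \<open>f_j\<close> squares to zero, and moving the
  factors of leg 13 past \<open>theta0\<close> in leg 12 creates the \<open>omega_p\<close> in the
  coproduct of \<open>Qg j\<close>.\<close>

lemma theta_comult:
  fixes xs :: "'n::finite list"
  assumes "even CARD('n)" "distinct xs"
  shows "tensor_map (\<lambda>x. x) Q_comult (theta_list xs) = leg13 (theta_list xs) * leg12 (theta_list xs)"
proof -
  let ?\<Theta>0 = "theta0 :: ('n H_algebra, 'n Q_algebra) tensor"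
  let ?d = "tensor_map (\<lambda>x :: 'n H_algebra. x) (Q_comult :: 'n Q_algebra \<Rightarrow> _)"
  define u v :: "'n \<Rightarrow> ('n H_algebra, ('n Q_algebra, 'n Q_algebra) tensor) tensor"
    where "u j = 1 + hf j \<otimes>\<^sub>C (omega_p \<otimes>\<^sub>C Qg j)" and "v j = 1 + hf j \<otimes>\<^sub>C (Qg j \<otimes>\<^sub>C 1)" for j
  note Q = Q_comult_even[OF assms(1)]
  note hom_d = alg_hom_tensor_map[OF alg_hom_id Q(1)]
  note d = alg_homD[OF hom_d] tensor_map(2)[OF clinear_id alg_homD(1)[OF Q(1)]] alg_homD(2)[OF Q(1)]
  have d0: "?d ?\<Theta>0 = leg13 ?\<Theta>0 * leg12 ?\<Theta>0"
  proof -
    define Y :: "('n H_algebra, ('n Q_algebra, 'n Q_algebra) tensor) tensor" where "Y = 1 \<otimes>\<^sub>C (1 \<otimes>\<^sub>C 1) + 1 \<otimes>\<^sub>C (omega_p \<otimes>\<^sub>C omega_p) + hk \<otimes>\<^sub>C (1 \<otimes>\<^sub>C 1) -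
      (hk :: 'n H_algebra) \<otimes>\<^sub>C (omega_p \<otimes>\<^sub>C (omega_p :: 'n Q_algebra))"
    have "leg13 ?\<Theta>0 * leg12 ?\<Theta>0 = (1/4) *\<^sub>C
      ((1 \<otimes>\<^sub>C (1 \<otimes>\<^sub>C 1) + 1 \<otimes>\<^sub>C (1 \<otimes>\<^sub>C omega_p) + hk \<otimes>\<^sub>C (1 \<otimes>\<^sub>C 1) - hk \<otimes>\<^sub>C (1 \<otimes>\<^sub>C omega_p)) *
       (1 \<otimes>\<^sub>C (1 \<otimes>\<^sub>C 1) + 1 \<otimes>\<^sub>C (omega_p \<otimes>\<^sub>C 1) + hk \<otimes>\<^sub>C (1 \<otimes>\<^sub>C 1) - hk \<otimes>\<^sub>C (omega_p \<otimes>\<^sub>C 1)))"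
      by (simp add: theta0_def leg_simps mult_scaleC_left mult_scaleC_right scaleC_scaleC)
    also have "\<dots> = (1/4) *\<^sub>C (Y + Y)"
      by (rule arg_cong[where f = "scaleC (1/4)"])
        (simp add: Y_def distrib_left distrib_right left_diff_distrib right_diff_distrib
          times_pure_tensor hk_hk omega_relations)
    also have "\<dots> = (1/2) *\<^sub>C Y"
      by (simp add: scaleC_half_twice scaleC_scaleC)
    also have "\<dots> = ?d ?\<Theta>0"
      by (simp add: theta0_def d Q Y_def pure_tensor_one)
    finally show ?thesis ..
  qed
  have "leg13 (theta1 j) * leg12 ?\<Theta>0 = leg12 ?\<Theta>0 * u j" for j
  proof -
    have "(hf j \<otimes>\<^sub>C (1 \<otimes>\<^sub>C Qg j)) * leg12 ?\<Theta>0 = leg12 ?\<Theta>0 * (hf j \<otimes>\<^sub>C (omega_p \<otimes>\<^sub>C Qg j))"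
      by (simp add: theta0_def leg_simps tensor_ring_simps hf_hk omega_relations)
    then show ?thesis
      by (simp add: theta1_def leg_simps u_def distrib_left distrib_right)
  qed
  then have swap: "prod_list (map (\<lambda>j. leg13 (theta1 j)) xs) * leg12 ?\<Theta>0 = leg12 ?\<Theta>0 * prod_list (map u xs)"
    by (rule prod_list_exchange)
  have leg_prod: "leg13 (prod_list (map theta1 xs)) = prod_list (map (\<lambda>j. leg13 (theta1 j)) xs)"
    "leg12 (prod_list (map theta1 xs)) = prod_list (map v xs)" for xs :: "'n list"
    by (induction xs) (simp_all add: leg_simps v_def theta1_def)
  have "prod_list (map (\<lambda>j. u j * v j) xs) = prod_list (map u xs) * prod_list (map v xs)"
  proof (rule prod_list_mult_commuting[OF assms(2)])
    show "v i * u j = u j * v i" for i j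
      by (simp add: u_def v_def tensor_ring_simps Q_relations(5) hf_hf[of i j]
          Q_relations(7)[of i j] algebra_simps)
  qed
  moreover have "u j * v j = ?d (theta1 j)" for j
    by (simp add: u_def v_def theta1_def d Q distrib_left distrib_right times_pure_tensor hf_sq
        pure_tensor_add_right algebra_simps)
  then have "?d (prod_list (map theta1 xs)) = prod_list (map (\<lambda>j. u j * v j) xs)" for xs :: "'n list"
    by (induction xs) (simp_all add: d)
  ultimately show ?thesis
    by (simp add: theta_list_def d d0 leg_simps leg_prod mult.assoc left_assoc[OF swap])
qed

lemma theta_counit: "tensor_map (\<lambda>x. x) Q_counit (theta_list xs) = 1"
proof -
  let ?e = "tensor_map (\<lambda>x :: 'a H_algebra. x) (Q_counit :: 'a Q_algebra \<Rightarrow> _)"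
  note e = alg_homD[OF alg_hom_tensor_map[OF alg_hom_id alg_hom_Q_counit]]
    tensor_map(2)[OF clinear_id alg_homD(1)[OF alg_hom_Q_counit]]
    alg_homD[OF alg_hom_Q_counit]
  have "?e theta0 = 1"
    by (simp add: theta0_def e Q_counit_p scaleC_half_twice scaleC_scaleC pure_tensor_one)
  moreover have "?e (prod_list (map theta1 xs)) = 1"
    by (induction xs) (simp_all add: e theta1_def Q_counit_g)
  ultimately show ?thesis by (simp add: theta_list_def e)
qed

text \<open>This is (S \<otimes> S)(R) = R. The factors come out reversed and to the left of
  \<open>theta0\<close>; passing \<open>theta0\<close> restores each \<open>theta1 j\<close>, and
  these commute with each other.\<close>

lemma theta_antipode:
  fixes xs :: "'n::finite list"
  assumes "even CARD('n)"
  shows "tensor_map (antipode H_hopf) Q_antipode (theta_list xs) = theta_list xs"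
proof -
  let ?\<Theta>0 = "theta0 :: ('n H_algebra, 'n Q_algebra) tensor"
  let ?s = "tensor_map (antipode H_hopf :: 'n H_algebra \<Rightarrow> _) (Q_antipode :: 'n Q_algebra \<Rightarrow> _)"
  note Q = Q_antipode_even[OF assms]
  note s = alg_antihomD[OF alg_antihom_tensor_map[OF alg_antihom_H_antipode Q(1)]]
    tensor_map(2)[OF alg_antihomD(1)[OF alg_antihom_H_antipode] alg_antihomD(1)[OF Q(1)]]
    alg_antihomD[OF alg_antihom_H_antipode] alg_antihomD[OF Q(1)] Q H_antipode_k H_antipode_f
  have s0: "?s ?\<Theta>0 = ?\<Theta>0"
    by (simp add: theta0_def s)
  have s1: "?s (theta1 j) * ?\<Theta>0 = ?\<Theta>0 * theta1 j" for j
  proof -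
    have "((hf j * hk) \<otimes>\<^sub>C (Qg j * omega_p)) * ?\<Theta>0 = - (?\<Theta>0 * (hf j \<otimes>\<^sub>C Qg j))"
      by (simp add: theta0_def tensor_ring_simps hf_hk hk_hk omega_relations mult.assoc Q_relations
          left_assoc[OF hk_hk] left_assoc[OF omega_relations(2)] left_assoc[OF hf_hk]
          left_assoc[OF Q_relations(5)] algebra_simps)
    then show ?thesis
      by (simp add: theta1_def s distrib_left left_diff_distrib pure_tensor_uminus_left)
  qed
  have "?s (prod_list (map theta1 xs)) * ?\<Theta>0 = ?\<Theta>0 * prod_list (map theta1 xs)"
  proof (induction xs)
    case (Cons j xs)
    have comm: "theta1 j * prod_list (map theta1 xs) = prod_list (map theta1 xs) * theta1 j"
    proof (rule commute_prod_list)
      show "theta1 j * theta1 l = theta1 l * theta1 j" for l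
        by (simp add: theta1_def tensor_ring_simps hf_hf[of j l] Q_relations(7)[of j l] algebra_simps)
    qed
    have "?s (prod_list (map theta1 (j # xs))) * ?\<Theta>0 = ?s (prod_list (map theta1 xs)) * ?\<Theta>0 * theta1 j"
      by (simp add: s s1 mult.assoc)
    then show ?case
      by (simp add: Cons.IH comm mult.assoc)
  qed (simp add: s)
  then show ?thesis
    by (simp add: theta_list_def s s0)
qed

section \<open>Finite dimensionality and dual bases\<close>

lemma span_closed_under:
  assumes "clinear g" "\<And>x. x \<in> F \<Longrightarrow> g x \<in> cvec.span F'" "x \<in> cvec.span F"
  shows "g x \<in> cvec.span F'"
  using assms(3)
proof (induction rule: cvec.span_induct_alt)
  case base
  then show ?case by (simp add: clinearD[OF assms(1)] cvec.span_zero)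
next
  case (step c x y)
  then show ?case
    by (simp add: clinearD[OF assms(1)] cvec.span_add cvec.span_scale assms(2))
qed

lemma clinear_times_right: "clinear (\<lambda>x :: 'a::complex_algebra_1. x * b)"
  by (rule cbilinear_clinear(2)[OF cbilinear_times])

text \<open>Each new generator \<open>f_j\<close> at most doubles the spanning set: it squares to
  zero, and the earlier generators anticommute with it, so \<open>F\<close> together with
  \<open>F f_j\<close> is stable again.\<close>

lemma finite_spanning_list:
  fixes xs :: "'n list"
  shows "\<exists>F. finite F \<and> 1 \<in> cvec.span F \<and> (\<forall>x \<in> cvec.span F. x * hk \<in> cvec.span F) \<and>
    (\<forall>i \<in> set xs. \<forall>x \<in> cvec.span F. x * hf i \<in> cvec.span F)"
proof (induction xs)
  case Nil
  have "x * hk \<in> cvec.span {1, hk :: 'n H_algebra}" if "x \<in> cvec.span {1, hk}" for x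
    by (rule span_closed_under[OF clinear_times_right _ that]) (auto simp: hk_hk cvec.span_base)
  then show ?case
    by (intro exI[of _ "{1, hk}"]) (simp add: cvec.span_base)
next
  case (Cons j xs)
  then obtain F where F: "finite F" "1 \<in> cvec.span F" "\<And>x. x \<in> cvec.span F \<Longrightarrow> x * hk \<in> cvec.span F"
    "\<And>i x. i \<in> set xs \<Longrightarrow> x \<in> cvec.span F \<Longrightarrow> x * hf i \<in> cvec.span F"
    by blast
  define F' where "F' = F \<union> (\<lambda>x. x * hf j) ` F"
  have sub: "x \<in> cvec.span F'" if "x \<in> cvec.span F" for x
    using that cvec.span_mono[of F F'] by (auto simp: F'_def)
  have f: "x * hf j \<in> cvec.span F'" if "x \<in> cvec.span F" for x
    by (rule span_closed_under[OF clinear_times_right _ that]) (auto simp: F'_def cvec.span_base)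
  have mult: "x * b \<in> cvec.span F'"
    if b: "\<And>x. x \<in> cvec.span F \<Longrightarrow> x * b \<in> cvec.span F" "hf j * b = - (b * hf j)"
      and x: "x \<in> cvec.span F'" for b x
  proof (rule span_closed_under[OF clinear_times_right _ x])
    fix y assume "y \<in> F'"
    then consider "y \<in> F" | z where "z \<in> F" "y = z * hf j" by (auto simp: F'_def)
    then show "y * b \<in> cvec.span F'"
    proof cases
      case 1
      then show ?thesis by (intro sub b(1) cvec.span_base)
    next
      case 2
      have "y * b = - (z * b * hf j)"
        by (simp add: 2 mult.assoc b(2))
      then show ?thesis
        using f[OF b(1)[OF cvec.span_base[OF 2(1)]]] by (simp add: cvec.span_neg)
    qed
  qed
  have "x * hf j \<in> cvec.span F'" if "x \<in> cvec.span F'" for x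
  proof (rule span_closed_under[OF clinear_times_right _ that])
    show "y * hf j \<in> cvec.span F'" if "y \<in> F'" for y
      using that by (auto simp: F'_def mult.assoc hf_sq cvec.span_zero cvec.span_base)
  qed
  then show ?case
    using F mult[OF F(3) hf_hk] mult[OF F(4) hf_hf]
    by (intro exI[of _ F']) (auto simp: F'_def intro!: sub[unfolded F'_def])
qed

lemma finite_spanning_H: "\<exists>F :: 'n::finite H_algebra set. finite F \<and> cvec.span F = UNIV"
proof -
  obtain xs :: "'n list" where xs: "set xs = UNIV"
    using finite_list[of "UNIV :: 'n set"] by auto
  then obtain F :: "'n H_algebra set" where F: "finite F" "1 \<in> cvec.span F"
    "\<And>x. x \<in> cvec.span F \<Longrightarrow> x * hk \<in> cvec.span F" "\<And>i x. x \<in> cvec.span F \<Longrightarrow> x * hf i \<in> cvec.span F"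
    using finite_spanning_list[of xs] by auto
  have "x \<in> cvec.span F" for x
    by (induction x rule: H_induct_right) (auto simp: F cvec.span_zero cvec.span_add cvec.span_scale)
  with F show ?thesis by auto
qed

lemma chosen_basis:
  shows independent_chosen_basis: "cvec.independent (chosen_basis :: 'a::complex_vector set)"
    and span_chosen_basis: "cvec.span (chosen_basis :: 'a set) = UNIV"
proof -
  obtain B :: "'a set" where "cvec.independent B" "UNIV \<subseteq> cvec.span B"
    using cvec.basis_exists[of UNIV] by blast
  then have "\<exists>B :: 'a set. cvec.independent B \<and> cvec.span B = UNIV" by auto
  from someI_ex[OF this] show "cvec.independent (chosen_basis :: 'a set)"
    "cvec.span (chosen_basis :: 'a set) = UNIV"
    by (simp_all add: chosen_basis_def)
qed

lemma finite_chosen_basis: "finite (chosen_basis :: 'n::finite H_algebra set)"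
proof -
  obtain F :: "'n H_algebra set" where F: "finite F" "cvec.span F = UNIV"
    using finite_spanning_H by blast
  show ?thesis
    using cvec.independent_span_bound[OF F(1) independent_chosen_basis] F(2) by simp
qed

abbreviation H_basis :: "'n::finite H_algebra set" where "H_basis \<equiv> chosen_basis"

definition dual_basis :: "'n::finite H_algebra \<Rightarrow> 'n H_algebra dual" where
  "dual_basis b = functional (\<lambda>x. cvec.representation chosen_basis x b)"

lemma dual_basis_apply: "dual_apply (dual_basis b) x = cvec.representation chosen_basis x b"
proof -
  have "clinear (\<lambda>x. cvec.representation chosen_basis x b)"
    by (rule clinearI) (simp_all add: cvec.representation_add cvec.representation_scale
        independent_chosen_basis span_chosen_basis scaleC_complex_def)
  then show ?thesis by (simp add: dual_basis_def dual_apply_functional)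
qed

lemma dual_basis_sum: "(\<Sum>b\<in>H_basis. dual_apply (dual_basis b) x *\<^sub>C b) = x"
  using cvec.sum_representation_eq[OF independent_chosen_basis _ finite_chosen_basis subset_refl, of x]
  by (simp add: dual_basis_apply span_chosen_basis)

lemma dual_apply_sum: "dual_apply \<phi> (sum g S) = (\<Sum>x\<in>S. dual_apply \<phi> (g x))"
  by (rule clinear_sum[OF clinear_dual_apply])

lemma dual_expand: "\<phi> = (\<Sum>b\<in>H_basis. dual_apply \<phi> b *\<^sub>C dual_basis b)"
proof (rule dual_eqI)
  fix x
  have "clinear (\<lambda>\<psi> :: 'a H_algebra dual. dual_apply \<psi> x)"
    by (rule clinearI) (simp_all add: dual_apply_simps scaleC_complex_def)
  note s = clinear_sum[OF this]
  have "dual_apply \<phi> x = dual_apply \<phi> (\<Sum>b\<in>H_basis. dual_apply (dual_basis b) x *\<^sub>C b)"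
    by (simp add: dual_basis_sum)
  then show "dual_apply \<phi> x = dual_apply (\<Sum>b\<in>H_basis. dual_apply \<phi> b *\<^sub>C dual_basis b) x"
    by (simp add: dual_apply_sum s dual_apply_simps mult.commute)
qed

text \<open>Applied to \<open>theta\<close>, this is its expansion as the sum of b \<otimes>
  \<open>dual_to_Q\<close> of the dual basis vector, the form in which the R-matrix of the double is
  given.\<close>

lemma contract_dual_basis_sum: "(\<Sum>b\<in>H_basis. b \<otimes>\<^sub>C contract (dual_basis b) t) = t"
proof (induction t rule: tensor_induct)
  case (add t x q)
  have "(\<Sum>b\<in>H_basis. b \<otimes>\<^sub>C (dual_apply (dual_basis b) x *\<^sub>C q)) =
      (\<Sum>b\<in>H_basis. dual_apply (dual_basis b) x *\<^sub>C b) \<otimes>\<^sub>C q"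
    by (simp add: clinear_sum[OF cbilinear_clinear(2)[OF cbilinear_pure_tensor]] pure_tensor_simps)
  then show ?case
    using add by (simp add: contract_simps pure_tensor_simps sum.distrib dual_basis_sum)
qed (simp add: contract_simps)

section \<open>The R-matrix\<close>

lemma sum_le_one: "(\<Sum>n\<le>1. f n) = f 0 + f (1 :: nat)"
  by simp

text \<open>On \<open>e_n\<close> the element \<i>^(-n) K is \<open>omega_m\<close>, and on
  \<open>e_m\<close> the element \<i>^m K is \<open>omega_p\<close>. So the powers of \<i> in
  \<open>Q_rho\<close> turn the double sum, whose weights are 1 for \<beta> = 1, into the image of
  \<open>theta0\<close>.\<close>

lemma Q_rmatrix_H_to_Q:
  "Q_rmatrix 1 = tensor_map H_to_Q (\<lambda>q. q) (theta :: ('n::{finite, linorder} H_algebra, 'n Q_algebra) tensor)"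
proof -
  let ?B = "tensor_map (H_to_Q :: 'n H_algebra \<Rightarrow> _) (\<lambda>q :: 'n Q_algebra. q)"
  note B = alg_homD[OF alg_hom_tensor_map[OF alg_hom_H_to_Q alg_hom_id]]
    tensor_map(2)[OF alg_homD(1)[OF alg_hom_H_to_Q] clinear_id] H_to_Q_k H_to_Q_f
    alg_homD[OF alg_hom_H_to_Q]
  define K e0 e1 :: "'n Q_algebra" where "K = gen Q_K" and "e0 = Q_e 0" and "e1 = Q_e 1"
  have one: "1 = e0 + e1"
    unfolding e0_def e1_def by (rule Q_e_split[symmetric])
  have om: "omega_m = K * e0 - \<i> *\<^sub>C (K * e1)" "omega_p = K * e0 + \<i> *\<^sub>C (K * e1)"
  proof -
    have "e0 * K = K * e0" "e1 * K = K * e1"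
      by (simp_all add: e0_def e1_def K_def Q_e_def power2_eq_square algebra_simps scaleC_ring_simps)
    then show "omega_m = K * e0 - \<i> *\<^sub>C (K * e1)" "omega_p = K * e0 + \<i> *\<^sub>C (K * e1)"
      by (simp_all add: omega_m_def omega_p_def distrib_right left_diff_distrib mult_scaleC_left
          flip: K_def e0_def e1_def[unfolded One_nat_def])
  qed
  have "(\<Sum>n\<le>1. \<Sum>m\<le>1. 1 ^ (n * m) *\<^sub>C (Q_rho n m * (Q_e n \<otimes>\<^sub>C Q_e m))) =
      (1/2) *\<^sub>C (1 \<otimes>\<^sub>C 1 + 1 \<otimes>\<^sub>C omega_p + omega_m \<otimes>\<^sub>C 1 - omega_m \<otimes>\<^sub>C (omega_p :: 'n Q_algebra))"
    unfolding om one sum_le_one Q_rho_def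
    by (simp add: e0_def[symmetric] e1_def[symmetric, unfolded One_nat_def] K_def[symmetric]
        tensor_ring_simps pure_tensor_simps pure_tensor_diff_left
        pure_tensor_diff_right power_int_minus)
  also have "\<dots> = ?B theta0"
    by (simp add: theta0_def B)
  finally have 1: "(\<Sum>n\<le>1. \<Sum>m\<le>1. 1 ^ (n * m) *\<^sub>C (Q_rho n m * (Q_e n \<otimes>\<^sub>C Q_e m))) = ?B theta0" .
  have 2: "?B (theta1 j) = 1 \<otimes>\<^sub>C 1 - 2 *\<^sub>C ((gen (Q_fm j) * omega_m) \<otimes>\<^sub>C gen (Q_fp j))" for j
    by (simp add: theta1_def B Qg_def Qb_def pure_tensor_one pure_tensor_simps pure_tensor_uminus_right)
  show ?thesis
    unfolding Q_rmatrix_def theta_def theta_list_def B(3) 1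
      alg_hom_prod_list[OF alg_hom_tensor_map[OF alg_hom_H_to_Q alg_hom_id]]
    by (simp add: 2 comp_def)
qed

lemma double_to_Q_eps: "double_to_Q (eps \<otimes>\<^sub>C a) = H_to_Q a"
  and double_to_Q_one: "double_to_Q (\<phi> \<otimes>\<^sub>C 1) = dual_to_Q \<phi>"
  by (simp_all add: double_to_Q_pure alg_homD[OF alg_hom_H_to_Q] dual_to_Q_def theta_def
      contract_eps_theta)

lemma rmatrix_double_to_Q: "tensor_map double_to_Q double_to_Q (double_rmatrix H_hopf) = Q_rmatrix 1"
proof -
  note hh = tensor_map[OF clinear_double_to_Q clinear_double_to_Q]
  have "tensor_map double_to_Q double_to_Q (double_rmatrix H_hopf) =
      (\<Sum>b\<in>H_basis. tensor_map double_to_Q double_to_Q ((eps \<otimes>\<^sub>C b) \<otimes>\<^sub>C (dual_basis b \<otimes>\<^sub>C 1)))"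
    by (simp add: double_rmatrix_def clinear_sum[OF hh(1)] dual_basis_def eps_def)
  also have "\<dots> = (\<Sum>b\<in>H_basis. H_to_Q b \<otimes>\<^sub>C dual_to_Q (dual_basis b))"
    by (simp add: hh(2) double_to_Q_eps double_to_Q_one)
  also have "\<dots> = tensor_map H_to_Q (\<lambda>q. q) (\<Sum>b\<in>H_basis. b \<otimes>\<^sub>C contract (dual_basis b) theta)"
    by (simp add: clinear_sum[OF tensor_map(1)[OF alg_homD(1)[OF alg_hom_H_to_Q] clinear_id]]
        tensor_map(2)[OF alg_homD(1)[OF alg_hom_H_to_Q] clinear_id] dual_to_Q_def)
  finally show ?thesis
    by (simp add: contract_dual_basis_sum Q_rmatrix_H_to_Q)
qed

section \<open>The coproduct of the double\<close>

abbreviation dual_pairing where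
  "dual_pairing a b \<equiv> tensor_lift (\<lambda>\<phi> \<psi>. dual_apply \<phi> a * dual_apply \<psi> b)"

lemma cbilinear_dual_pairing: "cbilinear (\<lambda>\<phi> \<psi>. dual_apply \<phi> a * dual_apply \<psi> b)"
  by (rule cbilinearI) (simp_all add: dual_apply_simps algebra_simps scaleC_complex_def)

lemmas dual_pairing_simps = clinearD[OF tensor_lift(1)[OF cbilinear_dual_pairing]]
  tensor_lift(2)[OF cbilinear_dual_pairing]

text \<open>Its pairings with basis vectors determine a tensor of functionals; this is the
  uniqueness needed for the \<open>THE\<close> in \<open>dual_comult\<close>.\<close>

lemma dual_tensor_expand:
  fixes t :: "('n::finite H_algebra dual, 'n H_algebra dual) tensor"
  shows "t = (\<Sum>b\<in>H_basis. \<Sum>c\<in>H_basis. dual_pairing b c t *\<^sub>C (dual_basis b \<otimes>\<^sub>C dual_basis c))"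
proof -
  define E where "E t = (\<Sum>b\<in>H_basis. \<Sum>c\<in>H_basis.
    dual_pairing b c t *\<^sub>C (dual_basis b \<otimes>\<^sub>C dual_basis c))"
    for t :: "('n H_algebra dual, 'n H_algebra dual) tensor"
  have "E (\<phi> \<otimes>\<^sub>C \<psi>) = \<phi> \<otimes>\<^sub>C \<psi>" for \<phi> \<psi>
  proof -
    have "\<phi> \<otimes>\<^sub>C \<psi> = (\<Sum>b\<in>H_basis. dual_apply \<phi> b *\<^sub>C dual_basis b) \<otimes>\<^sub>C
        (\<Sum>c\<in>H_basis. dual_apply \<psi> c *\<^sub>C dual_basis c)"
      by (simp flip: dual_expand)
    also have "\<dots> = E (\<phi> \<otimes>\<^sub>C \<psi>)"
      by (simp add: E_def clinear_sum[OF cbilinear_clinear(1)[OF cbilinear_pure_tensor]]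
          clinear_sum[OF cbilinear_clinear(2)[OF cbilinear_pure_tensor]] pure_tensor_simps
          cvec.scale_sum_right scaleC_scaleC dual_pairing_simps mult.commute) (rule sum.swap)
    finally show ?thesis ..
  qed
  moreover have "E (s + t) = E s + E t" "E 0 = 0" for s t
    by (simp_all add: E_def dual_pairing_simps scaleC_add_left sum.distrib)
  ultimately have "E t = t"
    by (induction t rule: tensor_induct) simp_all
  then show ?thesis by (simp add: E_def)
qed

text \<open>The witness has coefficients \<phi>(c b), in the order that the reversed coproduct of
  the dual demands. Expanding both arguments in the finite basis shows that it has the required
  pairings.\<close>

lemma H_dual_comult:
  shows dual_comult_eq: "dual_comult H_hopf \<phi> = (\<Sum>b\<in>H_basis. \<Sum>c\<in>H_basis.
      dual_apply \<phi> (c * b) *\<^sub>C (dual_basis b \<otimes>\<^sub>C dual_basis c))" (is "_ = ?t")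
    and dual_pairing_comult: "dual_pairing a b (dual_comult H_hopf \<phi>) = dual_apply \<phi> (b * a)"
proof -
  have t: "dual_pairing a b ?t = dual_apply \<phi> (b * a)" for a b
  proof -
    have "dual_apply \<phi> (b * a) = dual_apply \<phi> ((\<Sum>c\<in>H_basis. dual_apply (dual_basis c) b *\<^sub>C c) *
        (\<Sum>d\<in>H_basis. dual_apply (dual_basis d) a *\<^sub>C d))"
      by (simp add: dual_basis_sum)
    also have "\<dots> = (\<Sum>d\<in>H_basis. \<Sum>c\<in>H_basis. dual_apply \<phi> (c * d) *
        (dual_apply (dual_basis d) a * dual_apply (dual_basis c) b))"
      by (simp add: clinear_sum[OF cbilinear_clinear(1)[OF cbilinear_times]]
          clinear_sum[OF cbilinear_clinear(2)[OF cbilinear_times]] dual_apply_sum dual_apply_simps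
          mult_scaleC_left mult_scaleC_right scaleC_scaleC ac_simps)
    also have "\<dots> = dual_pairing a b ?t"
      by (simp add: clinear_sum[OF tensor_lift(1)[OF cbilinear_dual_pairing]] dual_pairing_simps
          scaleC_complex_def)
    finally show ?thesis ..
  qed
  have "(THE t. \<forall>a b. dual_pairing a b t = dual_apply \<phi> (b * a)) = ?t"
  proof (rule the_equality)
    fix s assume s: "\<forall>a b. dual_pairing a b s = dual_apply \<phi> (b * a)"
    show "s = ?t"
      by (subst dual_tensor_expand[of s]) (simp add: s)
  qed (simp add: t)
  then show eq: "dual_comult H_hopf \<phi> = ?t"
    by (simp add: dual_comult_def)
  show "dual_pairing a b (dual_comult H_hopf \<phi>) = dual_apply \<phi> (b * a)"
    unfolding eq by (rule t)
qed

lemma clinear_dual_comult: "clinear (dual_comult (H_hopf :: 'n::finite H_algebra hopf_structure))"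
  by (rule clinearI)
    (simp_all add: dual_comult_eq dual_apply_simps scaleC_add_left sum.distrib
      cvec.scale_sum_right scaleC_scaleC)

lemma tensor_lift_cbilinear_inner:
  assumes "\<And>x y. cbilinear (F x y)" "\<And>a b. cbilinear (\<lambda>x y. F x y a b)"
  shows "cbilinear (\<lambda>x y. tensor_lift (F x y) s)"
proof -
  note l = tensor_lift[OF assms(1)]
  note l = clinearD[OF l(1)] l(2)
  show ?thesis
    by (rule cbilinearI; induction s rule: tensor_induct)
      (simp_all add: l cbilinearD[OF assms(2)] scaleC_add_right)
qed

lemma tensor_lift_cbilinear_outer:
  assumes "\<And>x y. cbilinear (F x y)" "\<And>a b. cbilinear (\<lambda>x y. F x y a b)"
  shows "cbilinear (\<lambda>t s. tensor_lift (\<lambda>x y. tensor_lift (F x y) s) t)"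
proof (rule tensor_lift_cbilinear_param)
  show "cbilinear (\<lambda>x y. tensor_lift (F x y) s)" for s
    by (rule tensor_lift_cbilinear_inner[OF assms])
  show "clinear (tensor_lift (F x y))" for x y
    by (rule tensor_lift(1)[OF assms(1)])
qed

text \<open>The interchange of the two middle legs. It isolates the coproduct of the double as a
  bilinear function of the coproducts of \<phi> and \<open>a\<close>.\<close>

definition shuffle_tensor :: "('n H_algebra dual, 'n H_algebra dual) tensor \<Rightarrow>
    ('n H_algebra, 'n H_algebra) tensor \<Rightarrow> ('n double, 'n double) tensor" where
  "shuffle_tensor t s = tensor_lift (\<lambda>\<phi> \<psi>. tensor_lift (\<lambda>a b. (\<phi> \<otimes>\<^sub>C a) \<otimes>\<^sub>C (\<psi> \<otimes>\<^sub>C b)) s) t"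

lemma shuffle_cbilinear:
  "cbilinear (\<lambda>a b. (\<phi> \<otimes>\<^sub>C a) \<otimes>\<^sub>C (\<psi> \<otimes>\<^sub>C b))" "cbilinear (\<lambda>\<phi> \<psi>. (\<phi> \<otimes>\<^sub>C a) \<otimes>\<^sub>C (\<psi> \<otimes>\<^sub>C b))"
  by (rule cbilinearI; simp add: pure_tensor_simps)+

lemma cbilinear_shuffle: "cbilinear shuffle_tensor"
  using tensor_lift_cbilinear_outer[OF shuffle_cbilinear] by (simp add: shuffle_tensor_def[abs_def])

lemma shuffle_pure: "shuffle_tensor (\<phi> \<otimes>\<^sub>C \<psi>) (a \<otimes>\<^sub>C b) = (\<phi> \<otimes>\<^sub>C a) \<otimes>\<^sub>C (\<psi> \<otimes>\<^sub>C b)"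
  by (simp add: shuffle_tensor_def tensor_lift(2)[OF shuffle_cbilinear(1)]
      tensor_lift(2)[OF shuffle_cbilinear(2)])

lemma double_comult_shuffle:
  "double_comult H_hopf = tensor_lift (\<lambda>\<phi> a. shuffle_tensor (dual_comult H_hopf \<phi>) (H_delta a))"
  by (simp add: double_comult_def shuffle_tensor_def sweedler2_def)

lemma cbilinear_double_comult:
  "cbilinear (\<lambda>\<phi> a :: 'n::finite H_algebra. shuffle_tensor (dual_comult H_hopf \<phi>) (H_delta a))"
  by (rule cbilinear_compose[OF cbilinear_shuffle clinear_dual_comult alg_homD(1)[OF alg_hom_H_comult]])

lemma double_to_Q_shuffle:
  "tensor_map double_to_Q double_to_Q (shuffle_tensor t s) =
    tensor_map dual_to_Q dual_to_Q t * tensor_map H_to_Q H_to_Q s"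
proof (induction t rule: tensor_induct)
  note hh = tensor_map[OF clinear_double_to_Q clinear_double_to_Q]
  note AA = tensor_map[OF clinear_dual_to_Q clinear_dual_to_Q]
  note BB = tensor_map[OF alg_homD(1)[OF alg_hom_H_to_Q] alg_homD(1)[OF alg_hom_H_to_Q]]
  note sh = clinearD[OF cbilinear_clinear(1)[OF cbilinear_shuffle]]
    clinearD[OF cbilinear_clinear(2)[OF cbilinear_shuffle]]
  note lin = clinearD[OF hh(1)] clinearD[OF AA(1)] clinearD[OF BB(1)] hh(2) AA(2) BB(2) sh shuffle_pure
  case zero
  show ?case by (simp add: lin)
  case (add t \<phi> \<psi>)
  have "tensor_map double_to_Q double_to_Q (shuffle_tensor (\<phi> \<otimes>\<^sub>C \<psi>) s) =
      tensor_map dual_to_Q dual_to_Q (\<phi> \<otimes>\<^sub>C \<psi>) * tensor_map H_to_Q H_to_Q s"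
    by (induction s rule: tensor_induct)
      (simp_all add: lin distrib_left times_pure_tensor double_to_Q_pure)
  with add show ?case by (simp add: lin distrib_right)
qed

text \<open>The coproduct of the functional becomes a product on the first leg. Its reversed order
  puts leg 13 to the left of leg 12.\<close>

lemma contract_dual_pairing:
  fixes s u :: "('n H_algebra, 'b::complex_algebra_1) tensor"
  assumes "\<And>a b. dual_pairing a b t = dual_apply \<phi> (b * a)"
  shows "tensor_lift (\<lambda>\<phi>1 \<phi>2. contract \<phi>1 s \<otimes>\<^sub>C contract \<phi>2 u) t = contract \<phi> (leg13 u * leg12 s)"
proof -
  have bil: "cbilinear (\<lambda>\<phi>1 \<phi>2. contract \<phi>1 s \<otimes>\<^sub>C contract \<phi>2 u)"
    for s u :: "('n H_algebra, 'b) tensor"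
    by (rule cbilinear_compose[OF cbilinear_pure_tensor clinear_contract_left clinear_contract_left])
  define P where "P t s u = tensor_lift (\<lambda>\<phi>1 \<phi>2. contract \<phi>1 s \<otimes>\<^sub>C contract \<phi>2 u) t"
    for t and s u :: "('n H_algebra, 'b) tensor"
  have P_t: "P (t + t') s u = P t s u + P t' s u" "P 0 s u = 0"
    "P (\<phi>1 \<otimes>\<^sub>C \<phi>2) s u = contract \<phi>1 s \<otimes>\<^sub>C contract \<phi>2 u" for t t' \<phi>1 \<phi>2 s u
    by (simp_all add: P_def clinearD[OF tensor_lift(1)[OF bil]] tensor_lift(2)[OF bil])
  have P_pure: "P t (x \<otimes>\<^sub>C q) (y \<otimes>\<^sub>C r) = dual_pairing x y t *\<^sub>C (q \<otimes>\<^sub>C r)" for x y q r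
    by (induction t rule: tensor_induct)
      (simp_all add: P_t dual_pairing_simps contract_simps pure_tensor_simps scaleC_add_left
        scaleC_scaleC mult.commute)
  have P: "P t 0 u = 0" "P t s 0 = 0" "P t (s + s') u = P t s u + P t s' u"
    "P t s (u + u') = P t s u + P t s u'" for s s' u u'
    by (induction t rule: tensor_induct;
        simp add: P_t contract_simps pure_tensor_simps add_ac)+
  have "P t s u = contract \<phi> (leg13 u * leg12 s)"
  proof (induction s rule: tensor_induct)
    case (add s x q)
    have "P t (x \<otimes>\<^sub>C q) u = contract \<phi> (leg13 u * leg12 (x \<otimes>\<^sub>C q))"
      by (induction u rule: tensor_induct)
        (simp_all add: P P_pure leg_simps contract_simps distrib_right times_pure_tensor assms)
    with add show ?case by (simp add: P leg_simps contract_simps distrib_left)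
  qed (simp add: P leg_simps contract_simps)
  then show ?thesis by (simp add: P_def)
qed

lemma Q_comult_dual_to_Q:
  assumes "even CARD('n::{finite, linorder})"
  shows "Q_comult (dual_to_Q (\<phi> :: 'n H_algebra dual)) =
    tensor_map dual_to_Q dual_to_Q (dual_comult H_hopf \<phi>)"
proof -
  have "tensor_map dual_to_Q dual_to_Q (dual_comult H_hopf \<phi>) =
      contract \<phi> (leg13 theta * leg12 theta)"
    unfolding tensor_map_def dual_to_Q_def
    by (rule contract_dual_pairing[OF dual_pairing_comult])
  also have "\<dots> = contract \<phi> (tensor_map (\<lambda>x. x) Q_comult theta)"
    by (simp add: theta_def theta_comult[OF assms distinct_all(1)])
  also have "\<dots> = Q_comult (dual_to_Q \<phi>)"
    by (simp add: contract_post alg_homD(1)[OF alg_hom_Q_comult[OF assms]] dual_to_Q_def)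
  finally show ?thesis ..
qed

lemma Q_comult_H_to_Q:
  assumes "even CARD('n::finite)"
  shows "Q_comult (H_to_Q (a :: 'n H_algebra)) = tensor_map H_to_Q H_to_Q (H_delta a)"
proof -
  note BB = alg_hom_tensor_map[OF alg_hom_H_to_Q alg_hom_H_to_Q]
    tensor_map(2)[OF alg_homD(1)[OF alg_hom_H_to_Q] alg_homD(1)[OF alg_hom_H_to_Q]]
  note Q = Q_comult_even[OF assms]
  show ?thesis
    by (rule H_alg_hom_eqI[OF alg_hom_compose[OF Q(1) alg_hom_H_to_Q]
          alg_hom_compose[OF BB(1) alg_hom_H_comult]])
      (simp_all add: H_to_Q_k H_to_Q_f Q H_comult_k H_comult_f alg_homD[OF BB(1)] BB(2)
        alg_homD[OF alg_hom_H_to_Q])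
qed

lemma comult_double_to_Q:
  assumes "even CARD('n::{finite, linorder})"
  shows "Q_comult (double_to_Q (t :: 'n double)) =
    tensor_map double_to_Q double_to_Q (double_comult H_hopf t)"
proof (rule clinear_tensor_eqI[where f = "\<lambda>t. Q_comult (double_to_Q t)"
      and g = "\<lambda>t. tensor_map double_to_Q double_to_Q (double_comult H_hopf t)"])
  note Q = alg_homD[OF alg_hom_Q_comult[OF assms]]
  show "clinear (\<lambda>t :: 'n double. Q_comult (double_to_Q t))"
    by (rule clinear_compose[OF Q(1) clinear_double_to_Q])
  show "clinear (\<lambda>t :: 'n double. tensor_map double_to_Q double_to_Q (double_comult H_hopf t))"
    unfolding double_comult_shuffle
    by (rule clinear_compose[OF tensor_map(1)[OF clinear_double_to_Q clinear_double_to_Q]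
          tensor_lift(1)[OF cbilinear_double_comult]])
  show "Q_comult (double_to_Q (\<phi> \<otimes>\<^sub>C a)) =
      tensor_map double_to_Q double_to_Q (double_comult H_hopf (\<phi> \<otimes>\<^sub>C a))"
    for \<phi> and a :: "'n H_algebra"
    by (simp add: double_comult_shuffle tensor_lift(2)[OF cbilinear_double_comult]
        double_to_Q_shuffle double_to_Q_pure Q Q_comult_dual_to_Q[OF assms] Q_comult_H_to_Q[OF assms])
qed

section \<open>Counit and antipode of the double\<close>

lemma Q_counit_H_to_Q: "Q_counit (H_to_Q a) = counit H_hopf a"
  by (rule H_alg_hom_eqI[OF alg_hom_compose[OF alg_hom_Q_counit alg_hom_H_to_Q] alg_hom_H_counit])
    (simp_all add: H_to_Q_k H_to_Q_f Q_counit_m Q_counit_b H_counit_k H_counit_f)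

lemma Q_counit_dual_to_Q: "Q_counit (dual_to_Q \<phi>) = dual_counit H_hopf \<phi>"
proof -
  have "Q_counit (dual_to_Q \<phi>) = contract \<phi> (tensor_map (\<lambda>x. x) Q_counit theta)"
    by (simp add: contract_post alg_homD(1)[OF alg_hom_Q_counit] dual_to_Q_def)
  then show ?thesis
    by (simp add: theta_def theta_counit contract_simps scaleC_complex_def dual_counit_def
        flip: pure_tensor_one)
qed

lemma counit_double_to_Q:
  "Q_counit (double_to_Q t) = tensor_lift (\<lambda>\<phi> a. dual_counit H_hopf \<phi> * counit H_hopf a) t"
proof -
  have "Q_counit (double_to_Q t) = tensor_lift (\<lambda>\<phi> a. Q_counit (dual_to_Q \<phi> * H_to_Q a)) t"
    unfolding double_to_Q_def
    by (rule tensor_lift_post[OF alg_homD(1)[OF alg_hom_Q_counit] cbilinear_double_to_Q])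
  then show ?thesis
    by (simp add: alg_homD[OF alg_hom_Q_counit] Q_counit_H_to_Q Q_counit_dual_to_Q)
qed

lemma Q_antipode_H_to_Q:
  assumes "even CARD('n::finite)"
  shows "Q_antipode (H_to_Q (a :: 'n H_algebra)) = H_to_Q (antipode H_hopf a)"
  by (rule H_alg_antihom_eqI[OF alg_antihom_hom_compose[OF Q_antipode_even(1)[OF assms] alg_hom_H_to_Q]
        alg_hom_antihom_compose[OF alg_hom_H_to_Q alg_antihom_H_antipode]])
    (simp_all add: H_to_Q_k H_to_Q_f Q_antipode_even[OF assms] H_antipode_k H_antipode_f
      alg_hom_uminus[OF alg_hom_H_to_Q] alg_homD[OF alg_hom_H_to_Q])

text \<open>Undoing the antipode on the first leg of \<open>theta_antipode\<close> shows that the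
  inverse antipode on that leg has the same effect on \<open>theta\<close> as
  \<open>Q_antipode\<close> on the second; the antipode of the dual is the transpose of the
  former.\<close>

lemma Q_antipode_dual_to_Q:
  assumes "even CARD('n::{finite, linorder})"
  shows "Q_antipode (dual_to_Q (\<phi> :: 'n H_algebra dual)) = dual_to_Q (dual_antipode H_hopf \<phi>)"
proof -
  note S = alg_antihomD(1)[OF alg_antihom_H_antipode] alg_antihomD(1)[OF alg_antihom_antipode_inv]
    alg_antihomD(1)[OF Q_antipode_even(1)[OF assms]]
  have "tensor_map antipode_inv (\<lambda>q. q) (tensor_map (antipode H_hopf) Q_antipode t) =
      tensor_map (\<lambda>x. x) Q_antipode t" for t :: "('n H_algebra, 'n Q_algebra) tensor"
    by (induction t rule: tensor_induct)
      (simp_all add: clinearD[OF tensor_map(1)[OF S(2) clinear_id]]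
        clinearD[OF tensor_map(1)[OF S(1) S(3)]] clinearD[OF tensor_map(1)[OF clinear_id S(3)]]
        tensor_map(2)[OF S(2) clinear_id] tensor_map(2)[OF S(1) S(3)]
        tensor_map(2)[OF clinear_id S(3)] antipode_inv_antipode)
  from this[of theta] have "tensor_map antipode_inv (\<lambda>q. q) theta = tensor_map (\<lambda>x. x) Q_antipode (theta :: ('n H_algebra, _) tensor)"
    by (simp add: theta_def theta_antipode[OF assms])
  moreover have "dual_antipode H_hopf \<phi> = dual_pull antipode_inv \<phi>"
    by (simp add: dual_antipode_def dual_pull_def inv_antipode)
  ultimately show ?thesis
    by (simp add: dual_to_Q_def contract_post[OF S(3), symmetric] flip: contract_pull[OF S(2)])
qed

lemma antipode_double_to_Q:
  assumes "even CARD('n::{finite, linorder})"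
  shows "Q_antipode (double_to_Q (t :: 'n double)) = double_to_Q (double_antipode H_hopf t)"
proof -
  let ?F = "\<lambda>\<phi> a :: 'n H_algebra. double_mult H_hopf
    (eps \<otimes>\<^sub>C antipode H_hopf a) (dual_antipode H_hopf \<phi> \<otimes>\<^sub>C 1)"
  note Q = alg_antihomD[OF Q_antipode_even(1)[OF assms]]
  have mult: "cbilinear (double_mult (H_hopf :: 'n H_algebra hopf_structure))"
    by (rule cbilinearI) (simp_all add: double_mult_rho clinearD[OF clinear_double_to_Q]
        rho_simps endo_apply_simps clinearD[OF clinear_endo_apply])
  have "dual_antipode H_hopf = dual_pull (antipode_inv :: 'n H_algebra \<Rightarrow> _)"
    by (simp add: fun_eq_iff dual_antipode_def dual_pull_def inv_antipode)
  moreover have "clinear (dual_pull (antipode_inv :: 'n H_algebra \<Rightarrow> _))"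
    by (intro clinearI dual_eqI)
      (simp_all add: dual_apply_pull alg_antihomD[OF alg_antihom_antipode_inv] dual_apply_simps)
  \<comment> \<open>The arguments are swapped because the antipode reverses the product, so the
    \<open>H\<close> part is the first argument of \<open>double_mult\<close>.\<close>
  ultimately have "cbilinear (\<lambda>a \<phi>. ?F \<phi> a)"
    by (intro cbilinear_compose[OF mult]
        clinear_compose[OF cbilinear_clinear(1)[OF cbilinear_pure_tensor]]
        clinear_compose[OF cbilinear_clinear(2)[OF cbilinear_pure_tensor]]
        alg_antihomD(1)[OF alg_antihom_H_antipode]) simp
  then have F: "cbilinear ?F" by (simp add: cbilinear_def)
  have "Q_antipode (double_to_Q t) = tensor_lift (\<lambda>\<phi> a. Q_antipode (dual_to_Q \<phi> * H_to_Q a)) t"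
    unfolding double_to_Q_def by (rule tensor_lift_post[OF Q(1) cbilinear_double_to_Q])
  also have "\<dots> = tensor_lift (\<lambda>\<phi> a. double_to_Q (?F \<phi> a)) t"
    by (simp add: Q double_to_Q_mult Q_antipode_H_to_Q[OF assms] Q_antipode_dual_to_Q[OF assms]
        double_to_Q_eps double_to_Q_one)
  also have "\<dots> = double_to_Q (double_antipode H_hopf t)"
    by (simp add: double_antipode_def tensor_lift_post[OF clinear_double_to_Q F] flip: eps_def)
  finally show ?thesis .
qed

text \<open>\<open>K^2\<close> is 1 on \<open>e0\<close> and -1 on \<open>e1\<close>. Hence for even
  \<open>N\<close> the powers \<open>K^N\<close> on \<open>e0\<close> and (\<i> K)^N on
  \<open>e1\<close> are both 1, and with \<beta>^2 = 1 every correction term vanishes.\<close>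

lemma trivially_coassociated_Q:
  fixes \<beta> :: complex
  assumes "even CARD('n::{finite, linorder})" "\<beta>\<^sup>2 = 1"
  shows "trivially_coassociated (Q_quasi_hopf \<beta> :: 'n Q_algebra qt_quasi_hopf_structure)"
proof -
  define K e0 e1 :: "'n Q_algebra" where "K = gen Q_K" and "e0 = Q_e 0" and "e1 = Q_e 1"
  have K4: "K * (K * (K * K)) = 1"
    using Q_relations_raw(6) by (simp add: K_def mult.assoc)
  have e: "K ^ 2 * e0 = e0" "K ^ 2 * e1 = - e1"
    by (simp_all add: e0_def e1_def Q_e_def power2_eq_square K_def[symmetric] scaleC_ring_simps
        distrib_left right_diff_distrib mult.assoc K4 add.commute cvec.scale_right_diff_distrib)
  obtain m where m: "CARD('n) = 2 * m" using assms(1) by blast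
  have "(K ^ 2) ^ m * e0 = e0" "((\<i> *\<^sub>C K) ^ 2) ^ m * e1 = e1"
  proof -
    show "(K ^ 2) ^ m * e0 = e0"
      by (induction m) (simp_all add: mult.assoc e power_commutes)
    have "(\<i> *\<^sub>C K) ^ 2 * e1 = e1"
      using e(2) by (simp add: power2_eq_square scaleC_ring_simps)
    then show "((\<i> *\<^sub>C K) ^ 2) ^ m * e1 = e1"
      by (induction m) (simp_all add: mult.assoc power_commutes)
  qed
  then have K: "K ^ CARD('n) * e0 = e0" "(\<i> *\<^sub>C K) ^ CARD('n) * e1 = e1"
    by (simp_all add: m power_mult)
  have "e0 + e1 = 1"
    unfolding e0_def e1_def by (rule Q_e_split)
  then show ?thesis
    unfolding trivially_coassociated_def Q_quasi_hopf_def Q_coassociator_def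
    by (simp add: assms(2) left_diff_distrib K flip: K_def e0_def e1_def[unfolded One_nat_def])
qed

lemma drinfeld_double_simps:
  "comult (drinfeld_double H) = double_comult H"
  "counit (drinfeld_double H) = tensor_lift (\<lambda>\<phi> a. dual_counit H \<phi> * counit H a)"
  "antipode (drinfeld_double H) = double_antipode H"
  "rmatrix (drinfeld_double H) = double_rmatrix H"
  by (simp_all add: drinfeld_double_def Let_def)

lemma trivially_coassociated_double: "trivially_coassociated (drinfeld_double H)"
  by (simp add: trivially_coassociated_def drinfeld_double_def Let_def)

lemma Q_quasi_hopf_simps:
  "comult (Q_quasi_hopf \<beta>) = Q_comult" "counit (Q_quasi_hopf \<beta>) = Q_counit"
  "antipode (Q_quasi_hopf \<beta>) = Q_antipode" "rmatrix (Q_quasi_hopf \<beta>) = Q_rmatrix \<beta>"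
  by (simp_all add: Q_quasi_hopf_def Q_counit_def)

lemma hopf_iso_double_to_Q:
  fixes \<beta> :: complex
  assumes "even CARD('n::{finite, linorder})" "\<beta>\<^sup>2 = 1"
  shows "hopf_iso (drinfeld_double (H_hopf :: 'n H_algebra hopf_structure)) (Q_quasi_hopf \<beta>) double_to_Q"
  by (simp add: hopf_iso_def trivially_coassociated_double trivially_coassociated_Q[OF assms]
      algebra_iso_double_to_Q drinfeld_double_simps Q_quasi_hopf_simps counit_double_to_Q
      comult_double_to_Q[OF assms(1)] antipode_double_to_Q[OF assms(1)])

theorem proposition3p10:
  fixes N :: nat and \<beta> :: complex
  assumes "N = CARD('n::{finite, linorder})" and "N \<ge> 1" and "\<beta> ^ 4 = (-1) ^ N"
  shows "\<exists>h :: ('n H_algebra dual, 'n H_algebra) tensor \<Rightarrow> 'n Q_algebra.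
    algebra_iso (drinfeld_double H_hopf) (Q_quasi_hopf \<beta>) h \<and>
    (even N \<and> (\<beta> = 1 \<or> \<beta> = -1) \<longrightarrow>
      hopf_iso (drinfeld_double H_hopf) (Q_quasi_hopf \<beta>) h) \<and>
    (even N \<and> \<beta> = 1 \<longrightarrow>
      quasitriangular_hopf_iso (drinfeld_double H_hopf) (Q_quasi_hopf \<beta>) h)"
proof (intro exI[of _ double_to_Q] conjI impI)
  show "algebra_iso (drinfeld_double H_hopf) (Q_quasi_hopf \<beta>) (double_to_Q :: 'n double \<Rightarrow> _)"
    by (rule algebra_iso_double_to_Q)
  show hopf: "hopf_iso (drinfeld_double H_hopf) (Q_quasi_hopf \<beta>) (double_to_Q :: 'n double \<Rightarrow> _)"
    if "even N \<and> (\<beta> = 1 \<or> \<beta> = -1)"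
    using that by (intro hopf_iso_double_to_Q) (auto simp: assms(1))
  show "quasitriangular_hopf_iso (drinfeld_double H_hopf) (Q_quasi_hopf \<beta>) (double_to_Q :: 'n double \<Rightarrow> _)"
    if "even N \<and> \<beta> = 1"
    using that hopf unfolding quasitriangular_hopf_iso_def
    by (simp add: drinfeld_double_simps Q_quasi_hopf_simps rmatrix_double_to_Q)
qed

end
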